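(* Let $d\ge 1$, let $\sigma\colon\Omega\to\Omega$ be an invertible ergodic transformation preserving a probability measure $\mathbb{P}$, and let $O\colon\Omega\to O(d,\mathbb{R})$, $\omega\mapsto O_\omega$, be a measurable map into the $d\times d$ real orthogonal matrices. Suppose that $N\colon\Omega\to M_{d\times d}(\mathbb{R})$, $\omega\mapsto N_\omega$, is measurable and that, conditioned on $(O_{\sigma^n\omega})_{n\in\mathbb{Z}}$ and $(N_{\sigma^n\omega})_{n\neq 0}$, the matrix $N_\omega$ has independent standard normal entries. Then for all $\epsilon\in\mathbb{R}$, the Lyapunov exponents $\lambda_1,\dots,\lambda_d$ of the cocycle generated by $A_\omega=O_\omega+\epsilon N_\omega$ are given by $$\lambda_j=\mathbb{E}\log\big\|c_j^\perp(I+\epsilon N)\big\|,\qquad 1\le j\le d,$$ where, on the right-hand side, $N$ is a $d\times d$ random matrix with independent standard normal entries.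
   Context: The cocycle of partial products is $A^{(n)}_\omega=A_{\sigma^{n-1}\omega}\cdots A_{\sigma\omega}A_\omega$. For a $d\times d$ matrix $B$, $s_1(B)\ge\dots\ge s_d(B)$ denote its singular values. The $j$th Lyapunov exponent $\lambda_j$ is the almost sure constant limit $\lambda_j=\lim_{n\to\infty}\frac1n\log s_j(A^{(n)}_\omega)$. For a $d\times d$ matrix $A$, $c_k(A)$ is its $k$th column and $c_k^\perp(A)$ is the $k$th column of the (non-normalized) Gram-Schmidt orthogonalization of $A$, i.e. the component of $c_k(A)$ orthogonal to the span of the first $k-1$ columns: $c_1^\perp=c_1$ and $c_k^\perp=c_k-\sum_{1\le j<k}\frac{\langle c_j^\perp,c_k\rangle}{\langle c_j^\perp,c_j^\perp\rangle}c_j^\perp$. $\|\cdot\|$ is the Euclidean norm. *)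

theory Defs
  imports
    "HOL-Probability.Probability"
    "HOL-Computational_Algebra.Polynomial"
begin

text \<open>
  A \<open>d \<times> d\<close> matrix is an element of \<open>real^'n^'n\<close>, where \<open>'n\<close> is a finite linearly ordered type with
  \<open>d\<close> elements. The order of \<open>'n\<close> supplies the order of the columns and of the singular values:
  the index \<open>k\<close> stands for the number \<open>card {..<k} + 1\<close> of \<open>{1, \<dots>, d}\<close>.
\<close>

definition charpoly :: "real^'n^'n \<Rightarrow> real poly" where
  "charpoly A = det (\<chi> i j. (if i = j then [:0, 1:] else 0) - [:A $ i $ j:])"

text \<open>
  The eigenvalues of \<open>B\<^sup>T B\<close> are all real, so its characteristic polynomial has \<open>d\<close> real roots with
  multiplicity and the list below has length \<open>d\<close>.
\<close>

definition singular_values :: "real^'n^'n \<Rightarrow> real list" where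
  "singular_values B =
     map sqrt (rev (sorted_list_of_multiset (proots (charpoly (transpose B ** B)))))"

definition singular_value :: "real^'n::{finite,linorder}^'n::{finite,linorder} \<Rightarrow> 'n \<Rightarrow> real" where
  "singular_value B k = singular_values B ! card {..<k}"

text \<open>
  If \<open>gram_schmidt_column A j\<close> vanishes, the corresponding summand is zero
  by the convention \<open>x / 0 = 0\<close>, as it should be for an orthogonal projection.
\<close>

function gram_schmidt_column :: "real^'n::{finite,linorder}^'n::{finite,linorder} \<Rightarrow> 'n \<Rightarrow> real^'n::{finite,linorder}" where
  "gram_schmidt_column A k = column k A -
     (\<Sum>j\<in>{..<k}. ((gram_schmidt_column A j \<bullet> column k A) /
        (gram_schmidt_column A j \<bullet> gram_schmidt_column A j)) *\<^sub>R gram_schmidt_column A j)"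
  by auto
termination
  by (relation "Wellfounded.measure (\<lambda>(A, k). card {..<k})") (auto intro!: psubset_card_mono)

declare gram_schmidt_column.simps [simp del]

locale invertible_ergodic_system = prob_space M for M :: "'a measure" +
  fixes \<sigma> :: "'a \<Rightarrow> 'a"
  assumes bij: "bij_betw \<sigma> (space M) (space M)"
    and measurable_map: "\<sigma> \<in> measurable M M"
    and measurable_inverse: "inv_into (space M) \<sigma> \<in> measurable M M"
    and measure_preserving: "distr M M \<sigma> = M"
    and ergodic: "\<And>A. A \<in> sets M \<Longrightarrow> \<sigma> -` A \<inter> space M = A \<Longrightarrow> prob A = 0 \<or> prob A = 1"

definition int_iterate :: "'a measure \<Rightarrow> ('a \<Rightarrow> 'a) \<Rightarrow> int \<Rightarrow> 'a \<Rightarrow> 'a" where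
  "int_iterate M \<sigma> n =
     (if n \<ge> 0 then \<sigma> ^^ nat n else inv_into (space M) \<sigma> ^^ nat (- n))"

primrec cocycle :: "('a \<Rightarrow> 'a) \<Rightarrow> ('a \<Rightarrow> real^'n^'n) \<Rightarrow> nat \<Rightarrow> 'a \<Rightarrow> real^'n^'n" where
  "cocycle \<sigma> A 0 \<omega> = mat 1"
| "cocycle \<sigma> A (Suc n) \<omega> = A ((\<sigma> ^^ n) \<omega>) ** cocycle \<sigma> A n \<omega>"

text \<open>
  The logarithm with \<open>log 0 = -\<infinity>\<close>; the library's total function \<open>ln\<close> has \<open>ln 0 = 0\<close>,
  which would be wrong for the growth rate of a singular value that vanishes.
\<close>

definition log_ereal :: "real \<Rightarrow> ereal" where
  "log_ereal x = (if x > 0 then ereal (ln x) else -\<infinity>)"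

definition is_lyapunov_exponent ::
  "'a measure \<Rightarrow> ('a \<Rightarrow> 'a) \<Rightarrow> ('a \<Rightarrow> real^'n::{finite,linorder}^'n::{finite,linorder}) \<Rightarrow> 'n \<Rightarrow> real \<Rightarrow> bool" where
  "is_lyapunov_exponent M \<sigma> A j l \<longleftrightarrow>
     (AE \<omega> in M. (\<lambda>n. ereal (1 / real n) * log_ereal (singular_value (cocycle \<sigma> A n \<omega>) j))
        \<longlonglongrightarrow> ereal l)"

definition gaussian_matrix :: "(real^'n^'n) measure" where
  "gaussian_matrix =
     distr (PiM (UNIV :: ('n \<times> 'n) set) (\<lambda>_. std_normal_distribution)) borel
       (\<lambda>x. \<chi> i j. x (i, j))"

definition has_conditional_law :: "'a measure \<Rightarrow> 'a measure \<Rightarrow> ('a \<Rightarrow> 'b) \<Rightarrow> 'b measure \<Rightarrow> bool" where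
  "has_conditional_law M F X \<nu> \<longleftrightarrow>
     (\<forall>B\<in>sets \<nu>. AE \<omega> in M.
        real_cond_exp M F (indicator (X -` B \<inter> space M)) \<omega> = measure \<nu> B)"

definition conditioning_algebra ::
  "'a measure \<Rightarrow> ('a \<Rightarrow> 'a) \<Rightarrow> ('a \<Rightarrow> real^'n^'n) \<Rightarrow> ('a \<Rightarrow> real^'n^'n) \<Rightarrow> 'a measure" where
  "conditioning_algebra M \<sigma> Q N = sigma (space M)
     ({(\<lambda>\<omega>. Q (int_iterate M \<sigma> n \<omega>)) -` B \<inter> space M | n B. B \<in> sets borel} \<union>
      {(\<lambda>\<omega>. N (int_iterate M \<sigma> n \<omega>)) -` B \<inter> space M | n B. n \<noteq> 0 \<and> B \<in> sets borel})"

end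

theory Submission
  imports Defs "HOL-Computational_Algebra.Fundamental_Theorem_Algebra"
begin

text \<open>
  Let \<open>P\<close> be orthogonal. If \<open>A\<^sup>(\<^sup>n\<^sup>) P = U R\<close> with \<open>U\<close> orthogonal and \<open>R\<close> upper triangular, then
  \<open>c\<^sub>j\<^sup>\<bottom>(A\<^sup>(\<^sup>n\<^sup>+\<^sup>1\<^sup>) P) = R\<^sub>j\<^sub>j c\<^sub>j\<^sup>\<bottom>((O + \<epsilon> N) U)\<close>, and since the Gaussian law is invariant under
  multiplication by orthogonal matrices from both sides, the increment of \<open>log \<parallel>c\<^sub>j\<^sup>\<bottom>(A\<^sup>(\<^sup>n\<^sup>) P)\<parallel>\<close> is
  independent of the past and distributed as \<open>log \<parallel>c\<^sub>j\<^sup>\<bottom>(I + \<epsilon> N)\<parallel>\<close>. The strong law of large numbers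
  gives the growth rate \<open>\<mu>\<^sub>j = E log \<parallel>c\<^sub>j\<^sup>\<bottom>(I + \<epsilon> N)\<parallel>\<close> for every \<open>P\<close>, in particular for all
  permutation matrices. Now \<open>s\<^sub>1\<^sup>2 \<cdots> s\<^sub>k\<^sup>2\<close> is comparable to the \<open>k\<close>-th elementary symmetric
  polynomial of \<open>s\<^sub>1\<^sup>2, \<dots>, s\<^sub>d\<^sup>2\<close>, that is, up to sign a coefficient of the characteristic polynomial of
  \<open>B\<^sup>T B\<close>. This is the sum of the principal \<open>k\<close>-minors of \<open>B\<^sup>T B\<close>, each of which is a product of
  \<open>\<parallel>c\<^sub>j\<^sup>\<bottom>(B P)\<parallel>\<^sup>2\<close> over \<open>j \<le> k\<close> for a permutation matrix \<open>P\<close>. Hence \<open>s\<^sub>1 \<cdots> s\<^sub>k\<close> grows at the rate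
  \<open>\<mu>\<^sub>1 + \<cdots> + \<mu>\<^sub>k\<close>.
\<close>

section \<open>Invariance of the Gaussian measure\<close>

text \<open>The matrices \<open>O\<close> along an orbit may depend on each other in any way, so the
  factors of the cocycle need not be independent. But given \<open>O\<close> and the past product,
  the law of the logarithmic increment depends on neither, so independence and equal distribution
  come together. The hypothesis describes \<open>N\<close> at time 0, whereas the increment contains
  \<open>N\<close> at time \<open>n\<close>; invariance of the measure moves the event to time 0,
  where the past is a product over the times \<open>-n, ..., -1\<close>.

  The strong law needs moments of a logarithm, which is singular at 0. Large values are controlled
  by the norm of \<open>N\<close>. As \<open>|det (I + \<epsilon> N)|\<close> is the product of all
  \<open>||c_j^perp||\<close>, a lower bound for one factor follows from the determinant and upper
  bounds for the others, and the expectation of \<open>|det|^(-1/2)\<close> is finite.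

  One ordering of the columns gives only one principal minor for each \<open>k\<close>, and the
  others might grow faster; hence all permutation matrices. There are finitely many of them, and a
  finite sum of positive sequences with a common exponential rate has that rate.\<close>

lemma nn_integral_lborel_shift:
  fixes h :: "'a::euclidean_space \<Rightarrow> ennreal"
  assumes [measurable]: "h \<in> borel_measurable borel"
  shows "(\<integral>\<^sup>+x. h (x + c) \<partial>lborel) = (\<integral>\<^sup>+x. h x \<partial>lborel)"
  by (subst (2) lborel_distr_plus[of c, symmetric])
    (simp add: nn_integral_distr add.commute)

text \<open>
  The image of Lebesgue measure is again translation invariant. Comparing it with Lebesgue measure
  by Fubini as in the uniqueness proof of Haar measure, the factor is found from the unit ball.
\<close>

lemma lborel_distr_linear_isometry:
  fixes f :: "'a::euclidean_space \<Rightarrow> 'a"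
  assumes "linear f" and norm_f: "\<And>x. norm (f x) = norm x"
  shows "distr lborel borel f = lborel"
proof -
  have f_meas [measurable]: "f \<in> borel_measurable borel"
    by (intro borel_measurable_continuous_onI linear_continuous_on linear_conv_bounded_linear[THEN iffD1] assms)
  have "inj f"
    using assms by (metis linear_inj_iff_eq_0 norm_eq_zero)
  then have "surj f"
    using linear_inj_imp_surj[OF assms(1)] by simp
  define \<mu> where "\<mu> = distr lborel borel f"
  have sets_\<mu> [measurable_cong, simp]: "sets \<mu> = sets borel"
    by (simp add: \<mu>_def)
  have space_\<mu> [simp]: "space \<mu> = UNIV"
    by (simp add: \<mu>_def)
  have ball: "emeasure \<mu> (cball 0 r) = emeasure lborel (cball (0::'a) r)" for r
    by (simp add: \<mu>_def emeasure_distr vimage_def norm_f cball_def)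
  have fin: "emeasure lborel (cball (0::'a) r) < \<infinity>" for r
    using emeasure_bounded_finite[OF bounded_cball] .
  have trans_\<mu>: "(\<integral>\<^sup>+y. h (y + c) \<partial>\<mu>) = (\<integral>\<^sup>+y. h y \<partial>\<mu>)"
    if [measurable]: "h \<in> borel_measurable borel" for h c
  proof -
    obtain z where z: "c = f z"
      using \<open>surj f\<close> by (metis surjD)
    have "(\<integral>\<^sup>+y. h (y + c) \<partial>\<mu>) = (\<integral>\<^sup>+y. h (f (y + z)) \<partial>lborel)"
      by (simp add: \<mu>_def nn_integral_distr z linear_add[OF assms(1)])
    also have "\<dots> = (\<integral>\<^sup>+y. h (f y) \<partial>lborel)"
      by (rule nn_integral_lborel_shift) simp
    finally show ?thesis
      by (simp add: \<mu>_def nn_integral_distr)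
  qed
  interpret \<mu>: sigma_finite_measure \<mu>
  proof
    show "\<exists>A. countable A \<and> A \<subseteq> sets \<mu> \<and> \<Union>A = space \<mu> \<and> (\<forall>a\<in>A. emeasure \<mu> a \<noteq> \<infinity>)"
    proof (intro exI conjI ballI)
      show "\<Union>(range (\<lambda>n. cball 0 (real n))) = space \<mu>"
        by (auto simp: real_arch_simple)
      fix a assume "a \<in> range (\<lambda>n. cball (0::'a) (real n))"
      then show "emeasure \<mu> a \<noteq> \<infinity>"
        using fin by (auto simp: ball less_top)
    qed auto
  qed
  interpret P: pair_sigma_finite \<mu> lborel
    by standard
  have "lborel = \<mu>"
  proof (rule measure_eqI)
    fix A assume "A \<in> sets (lborel :: 'a measure)"
    then have [measurable]: "A \<in> sets borel" by simp
    define g where "g = (indicator (cball 0 1) :: 'a \<Rightarrow> ennreal)"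
    define h where "h = (indicator A :: 'a \<Rightarrow> ennreal)"
    have [measurable]: "g \<in> borel_measurable borel" "h \<in> borel_measurable borel"
      using \<open>A \<in> sets borel\<close> unfolding g_def h_def by (auto intro!: borel_measurable_indicator)
    \<comment> \<open>The ball is symmetric, so \<open>g (x - y)\<close> is also a translate of
      \<open>g\<close> in the variable \<open>y\<close>, to which the translation invariance of
      \<open>\<mu>\<close> applies.\<close>
    have sym: "g (x - y) = g (y + - x)" for x y
      by (auto simp: g_def indicator_def norm_minus_commute)
    have "(\<integral>\<^sup>+x. g x \<partial>lborel) * (\<integral>\<^sup>+y. h y \<partial>\<mu>) = (\<integral>\<^sup>+x. g x * (\<integral>\<^sup>+y. h y \<partial>\<mu>) \<partial>lborel)"
      by (simp add: nn_integral_multc)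
    also have "\<dots> = (\<integral>\<^sup>+x. g x * (\<integral>\<^sup>+y. h (y + x) \<partial>\<mu>) \<partial>lborel)"
      by (simp add: trans_\<mu>)
    also have "\<dots> = (\<integral>\<^sup>+x. (\<integral>\<^sup>+y. g x * h (y + x) \<partial>\<mu>) \<partial>lborel)"
      by (simp add: nn_integral_cmult)
    also have "\<dots> = (\<integral>\<^sup>+y. (\<integral>\<^sup>+x. g x * h (y + x) \<partial>lborel) \<partial>\<mu>)"
      by (rule P.Fubini') simp
    also have "\<dots> = (\<integral>\<^sup>+y. (\<integral>\<^sup>+x. g (x + - y) * h (y + (x + - y)) \<partial>lborel) \<partial>\<mu>)"
      by (intro nn_integral_cong nn_integral_lborel_shift[where h="\<lambda>x. g x * h (_ + x)", symmetric]) simp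
    also have "\<dots> = (\<integral>\<^sup>+y. (\<integral>\<^sup>+x. g (x - y) * h x \<partial>lborel) \<partial>\<mu>)"
      by simp
    also have "\<dots> = (\<integral>\<^sup>+x. (\<integral>\<^sup>+y. g (x - y) * h x \<partial>\<mu>) \<partial>lborel)"
      by (rule P.Fubini'[symmetric]) simp
    also have "\<dots> = (\<integral>\<^sup>+x. (\<integral>\<^sup>+y. g (y + - x) \<partial>\<mu>) * h x \<partial>lborel)"
      unfolding sym by (intro nn_integral_cong nn_integral_multc) simp
    also have "\<dots> = (\<integral>\<^sup>+x. (\<integral>\<^sup>+y. g y \<partial>\<mu>) * h x \<partial>lborel)"
      by (simp only: trans_\<mu>[OF \<open>g \<in> borel_measurable borel\<close>])
    also have "\<dots> = (\<integral>\<^sup>+y. g y \<partial>\<mu>) * (\<integral>\<^sup>+x. h x \<partial>lborel)"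
      by (simp add: nn_integral_cmult)
    finally have "emeasure lborel (cball (0::'a) 1) * emeasure \<mu> A = emeasure lborel (cball (0::'a) 1) * emeasure lborel A"
      by (simp add: g_def h_def ball)
    moreover have "emeasure lborel (cball (0::'a) 1) \<noteq> 0"
      using less_imp_neq[OF unit_ball_vol_pos[of "real DIM('a)"]] by (simp add: emeasure_cball)
    ultimately show "emeasure lborel A = emeasure \<mu> A"
      using fin[of 1] by (metis ennreal_mult_cancel_left infinity_ennreal_def less_irrefl)
  qed simp
  then show ?thesis by (simp add: \<mu>_def)
qed

section \<open>Density and orthogonal invariance of the Gaussian matrix\<close>

lemma borel_measurable_vec_lambda [measurable (raw)]:
  fixes f :: "'i::finite \<Rightarrow> 'a \<Rightarrow> 'b::euclidean_space"
  assumes [measurable]: "\<And>i. f i \<in> borel_measurable M"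
  shows "(\<lambda>x. \<chi> i. f i x) \<in> borel_measurable M"
  by (subst borel_measurable_euclidean_space) (auto simp: Basis_vec_def inner_axis)

lemma borel_measurable_vec_nth [measurable (raw)]:
  fixes f :: "'a \<Rightarrow> ('b::euclidean_space)^'i"
  assumes "f \<in> borel_measurable M"
  shows "(\<lambda>x. f x $ i) \<in> borel_measurable M"
  by (rule measurable_compose[OF assms]) (auto intro!: borel_measurable_continuous_onI continuous_intros)

text \<open>Connects the coordinates by index pairs, on which \<open>gaussian_matrix\<close> is
  built, with the Euclidean structure of the matrix space. Agreement on boxes suffices.\<close>

lemma lborel_eq_distr_PiM_matrix:
  "(lborel :: (real^'n^'m) measure) =
    distr (PiM (UNIV :: ('m \<times> 'n) set) (\<lambda>_. lborel)) borel (\<lambda>x. \<chi> i j. x (i, j))"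
proof (rule lborel_eqI)
  interpret product_sigma_finite "\<lambda>_::'m \<times> 'n. lborel :: real measure" by standard
  fix l u :: "real^'n^'m"
  assume le: "\<And>b. b \<in> Basis \<Longrightarrow> l \<bullet> b \<le> u \<bullet> b"
  have Basis_eq: "(Basis :: (real^'n^'m) set) = (\<lambda>(i, j). axis i (axis j 1)) ` UNIV"
    unfolding Basis_vec_def by auto
  have inj: "inj (\<lambda>(i, j). axis i (axis j 1) :: real^'n^'m)"
    by (auto simp: inj_on_def axis_eq_axis)
  have le': "l $ i $ j \<le> u $ i $ j" for i j
    using le[of "axis i (axis j 1)"] by (auto simp: inner_axis Basis_vec_def)
  have [measurable]: "(\<lambda>x. \<chi> i j. x (i, j)) \<in> borel_measurable (PiM (UNIV :: ('m \<times> 'n) set) (\<lambda>_. lborel :: real measure))"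
    by measurable
  have "(\<lambda>x. \<chi> i j. x (i, j)) -` box l u \<inter> space (PiM UNIV (\<lambda>_. lborel)) = PiE UNIV (\<lambda>(i,j). {l$i$j <..< u$i$j})"
    by (auto simp: box_def Basis_eq inner_axis space_PiM PiE_def Pi_def)
  then show "emeasure (distr (PiM (UNIV :: ('m \<times> 'n) set) (\<lambda>_. lborel)) borel (\<lambda>x. \<chi> i j. x (i, j))) (box l u) =
      ennreal (\<Prod>b\<in>Basis. (u - l) \<bullet> b)"
    by (simp add: emeasure_distr emeasure_PiM case_prod_unfold Basis_eq inner_axis prod_ennreal le'
        prod.reindex[OF inj[unfolded case_prod_unfold]])
qed simp

text \<open>Both measures agree on rectangles, because there the density and the indicator factor
  together over the coordinates.\<close>

lemma PiM_density:
  fixes \<phi> :: "'i \<Rightarrow> 'a \<Rightarrow> ennreal"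
  assumes "finite I" and [measurable]: "\<And>i. \<phi> i \<in> borel_measurable (M i)"
    and "\<And>i. sigma_finite_measure (M i)"
    and "\<And>i. sigma_finite_measure (density (M i) (\<phi> i))"
  shows "PiM I (\<lambda>i. density (M i) (\<phi> i)) = density (PiM I M) (\<lambda>x. \<Prod>i\<in>I. \<phi> i (x i))"
proof (rule sym)
  interpret M: product_sigma_finite M by (rule product_sigma_finite.intro) fact
  interpret D: product_sigma_finite "\<lambda>i. density (M i) (\<phi> i)" by (rule product_sigma_finite.intro) fact
  have meas [measurable]: "(\<lambda>x. \<Prod>i\<in>I. \<phi> i (x i)) \<in> borel_measurable (PiM I M)"
    by (intro borel_measurable_prod_ennreal) measurable
  show "density (PiM I M) (\<lambda>x. \<Prod>i\<in>I. \<phi> i (x i)) = PiM I (\<lambda>i. density (M i) (\<phi> i))"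
  proof (rule D.PiM_eqI)
    show "sets (density (PiM I M) (\<lambda>x. \<Prod>i\<in>I. \<phi> i (x i))) = sets (PiM I (\<lambda>i. density (M i) (\<phi> i)))"
      by (simp cong: sets_PiM_cong)
    fix A assume A: "\<And>i. i \<in> I \<Longrightarrow> A i \<in> sets (density (M i) (\<phi> i))"
    have ind: "(\<Prod>i\<in>I. \<phi> i (x i)) * indicator (PiE I A) x = (\<Prod>i\<in>I. \<phi> i (x i) * indicator (A i) (x i))"
      if x: "x \<in> space (PiM I M)" for x
    proof (cases "x \<in> PiE I A")
      case True
      then show ?thesis by (auto intro!: prod.cong simp: indicator_def PiE_def Pi_def)
    next
      case False
      then obtain i where "i \<in> I" "x i \<notin> A i"
        using x unfolding space_PiM by (auto simp: PiE_iff)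
      then have "(\<Prod>i\<in>I. \<phi> i (x i) * indicator (A i) (x i)) = 0"
        by (intro prod_zero[OF \<open>finite I\<close>]) (auto intro!: bexI[of _ i])
      then show ?thesis using False by simp
    qed
    have "emeasure (density (PiM I M) (\<lambda>x. \<Prod>i\<in>I. \<phi> i (x i))) (PiE I A)
        = (\<integral>\<^sup>+x. (\<Prod>i\<in>I. \<phi> i (x i)) * indicator (PiE I A) x \<partial>PiM I M)"
      using A \<open>finite I\<close> by (subst emeasure_density) auto
    also have "\<dots> = (\<integral>\<^sup>+x. (\<Prod>i\<in>I. \<phi> i (x i) * indicator (A i) (x i)) \<partial>PiM I M)"
      by (intro nn_integral_cong ind)
    also have "\<dots> = (\<Prod>i\<in>I. (\<integral>\<^sup>+x. \<phi> i x * indicator (A i) x \<partial>M i))"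
      using A by (intro M.product_nn_integral_prod[OF \<open>finite I\<close>]) auto
    also have "\<dots> = (\<Prod>i\<in>I. emeasure (density (M i) (\<phi> i)) (A i))"
      using A by (intro prod.cong) (auto simp: emeasure_density)
    finally show "emeasure (density (PiM I M) (\<lambda>x. \<Prod>i\<in>I. \<phi> i (x i))) (PiE I A)
        = (\<Prod>i\<in>I. emeasure (density (M i) (\<phi> i)) (A i))" .
  qed (fact assms(1))
qed

lemma inner_matrix_eq: "(X::real^'n^'m) \<bullet> Y = (\<Sum>p\<in>UNIV. X $ fst p $ snd p * Y $ fst p $ snd p)"
  by (simp add: inner_vec_def sum.cartesian_product case_prod_unfold flip: UNIV_Times_UNIV)

text \<open>The exponents of the one-dimensional densities add up to the squared Frobenius norm, so
  the density is unchanged by every linear isometry.\<close>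

lemma gaussian_matrix_eq_density:
  "(gaussian_matrix :: (real^'n^'n) measure) =
    density lborel (\<lambda>X. ennreal ((1 / sqrt (2 * pi)) ^ CARD('n \<times> 'n) * exp (- (norm X)\<^sup>2 / 2)))"
    (is "_ = density lborel ?g")
proof -
  let ?I = "UNIV :: ('n \<times> 'n) set"
  let ?m = "\<lambda>x::'n \<times> 'n \<Rightarrow> real. \<chi> i j. x (i, j)"
  have meas [measurable]: "?m \<in> borel_measurable (PiM ?I (\<lambda>_. lborel))"
    by measurable
  have "PiM ?I (\<lambda>_. std_normal_distribution)
      = density (PiM ?I (\<lambda>_. lborel)) (\<lambda>x. \<Prod>p\<in>?I. ennreal (std_normal_density (x p)))"
    by (rule PiM_density)
      (simp_all add: lborel.sigma_finite_measure_axioms prob_space_imp_sigma_finite[OF prob_space_normal_density])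
  also have "\<dots> = density (PiM ?I (\<lambda>_. lborel)) (\<lambda>x. ?g (?m x))"
  proof (intro arg_cong2[where f=density] refl ext)
    fix x :: "'n \<times> 'n \<Rightarrow> real"
    have "(\<Prod>p\<in>?I. std_normal_density (x p)) = (1 / sqrt (2 * pi)) ^ CARD('n \<times> 'n) * exp (\<Sum>p\<in>?I. - (x p)\<^sup>2 / 2)"
      by (simp add: std_normal_density_def prod.distrib exp_sum power_divide prod_dividef)
    also have "(\<Sum>p\<in>?I. - (x p)\<^sup>2 / 2) = - (norm (?m x))\<^sup>2 / 2"
      unfolding power2_norm_eq_inner inner_matrix_eq
      by (simp add: sum_negf power2_eq_square flip: sum_divide_distrib)
    finally show "(\<Prod>p\<in>?I. ennreal (std_normal_density (x p))) = ?g (?m x)"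
      by (simp add: prod_ennreal)
  qed
  finally show ?thesis
    unfolding gaussian_matrix_def lborel_eq_distr_PiM_matrix
    by (simp add: density_distr)
qed

lemma gaussian_matrix_invariant:
  fixes f :: "real^'n^'n \<Rightarrow> real^'n^'n"
  assumes "linear f" "\<And>X. norm (f X) = norm X"
  shows "distr gaussian_matrix borel f = gaussian_matrix"
proof -
  have [measurable]: "f \<in> borel_measurable borel"
    by (intro borel_measurable_continuous_onI linear_continuous_on linear_conv_bounded_linear[THEN iffD1] assms)
  show ?thesis
    unfolding gaussian_matrix_eq_density
    by (subst (2) lborel_distr_linear_isometry[OF assms, symmetric])
      (simp add: density_distr assms)
qed

lemma trace_transpose_mult: "(X::real^'n^'m) \<bullet> Y = trace (transpose X ** Y)"
  by (simp add: inner_vec_def trace_def matrix_matrix_mult_def transpose_def) (rule sum.swap)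

lemma linear_matrix_conj: "linear (\<lambda>X. (U::real^'n^'m) ** X ** (V::real^'l^'k))"
  by (intro linearI)
    (simp_all add: matrix_matrix_mult_def vec_eq_iff sum.distrib sum_distrib_left sum_distrib_right algebra_simps)

text \<open>Cyclicity of the trace moves \<open>V\<close> next to its transpose, so two-sided
  multiplication is an isometry for the Frobenius norm.\<close>

lemma gaussian_matrix_orthogonal_invariant:
  fixes U V :: "real^'n^'n"
  assumes "orthogonal_matrix U" "orthogonal_matrix V"
  shows "distr gaussian_matrix borel (\<lambda>X. U ** X ** V) = gaussian_matrix"
proof (rule gaussian_matrix_invariant)
  show "linear (\<lambda>X. U ** X ** V)"
    by (rule linear_matrix_conj)
  fix X
  have "(U ** X ** V) \<bullet> (U ** X ** V) = trace (transpose (U ** X ** V) ** (U ** X ** V))"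
    by (rule trace_transpose_mult)
  also have "\<dots> = trace (transpose V ** (transpose X ** (transpose U ** U) ** X ** V))"
    by (simp add: matrix_transpose_mul matrix_mul_assoc)
  also have "\<dots> = trace (transpose X ** (transpose U ** U) ** X ** (V ** transpose V))"
    by (subst trace_mul_sym) (simp add: matrix_mul_assoc)
  also have "\<dots> = trace (transpose X ** X)"
    using assms by (simp add: orthogonal_matrix_def)
  finally show "norm (U ** X ** V) = norm X"
    by (simp add: trace_transpose_mult norm_eq_sqrt_inner)
qed

section \<open>Gram-Schmidt orthogonalization\<close>

lemma finite_linorder_induct [case_names less]:
  fixes k :: "'n::{finite,linorder}"
  assumes "\<And>k. (\<And>i. i < k \<Longrightarrow> P i) \<Longrightarrow> P k"
  shows "P k"
proof (induction "card {..<k}" arbitrary: k rule: less_induct)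
  case less
  show ?case
    by (rule assms, rule less) (auto intro!: psubset_card_mono)
qed

lemma permutes_decreasing_imp_id:
  fixes p :: "'n::{finite,linorder} \<Rightarrow> 'n"
  assumes "p permutes UNIV" "\<And>i. p i \<le> i"
  shows "p = id"
proof
  fix i show "p i = id i"
  proof (induction i rule: finite_linorder_induct)
    case (less i)
    have "\<not> p i < i"
    proof
      assume "p i < i"
      then have "p (p i) = p i" using less by simp
      then have "p i = i" using permutes_inj[OF assms(1)] by (simp add: inj_eq)
      with \<open>p i < i\<close> show False by simp
    qed
    with assms(2)[of i] show ?case by simp
  qed
qed

lemma det_lower_triangular:
  fixes A :: "'a::comm_ring_1^'n::{finite,linorder}^'n::{finite,linorder}"
  assumes "\<And>i j. i < j \<Longrightarrow> A $ i $ j = 0"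
  shows "det A = (\<Prod>i\<in>UNIV. A $ i $ i)"
proof -
  have "(\<Prod>i\<in>UNIV. A $ i $ p i) = 0" if "p permutes UNIV" "p \<noteq> id" for p
  proof -
    obtain i where "i < p i"
      using permutes_decreasing_imp_id[OF \<open>p permutes UNIV\<close>] \<open>p \<noteq> id\<close> by (metis not_le)
    then show ?thesis
      using assms by (intro prod_zero) auto
  qed
  then have "det A = (\<Sum>p\<in>{id}. of_int (sign p) * (\<Prod>i\<in>UNIV. A $ i $ p i))"
    unfolding det_def
    by (intro sum.mono_neutral_right finite_permutations) (auto simp: permutes_id)
  then show ?thesis by (simp add: sign_id)
qed

lemma det_upper_triangular:
  fixes A :: "'a::comm_ring_1^'n::{finite,linorder}^'n::{finite,linorder}"
  assumes "\<And>i j. j < i \<Longrightarrow> A $ i $ j = 0"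
  shows "det A = (\<Prod>i\<in>UNIV. A $ i $ i)"
  using det_lower_triangular[of "transpose A"] assms
  by (simp add: det_transpose) (simp add: transpose_def)

abbreviation (input) gs where "gs \<equiv> gram_schmidt_column"

lemma column_eq_gram_schmidt:
  "column k A = gs A k + (\<Sum>j\<in>{..<k}. ((gs A j \<bullet> column k A) / (gs A j \<bullet> gs A j)) *\<^sub>R gs A j)"
  by (subst gram_schmidt_column.simps) simp

lemma gram_schmidt_orthogonal_less:
  "i < k \<Longrightarrow> gs A i \<bullet> gs A k = 0"
proof (induction k arbitrary: i rule: finite_linorder_induct)
  case (less k)
  have orth: "gs A i \<bullet> gs A j = 0" if "j < k" "j \<noteq> i" for j
    using that less by (metis inner_commute linorder_neqE)
  have "gs A i \<bullet> (\<Sum>j\<in>{..<k}. ((gs A j \<bullet> column k A) / (gs A j \<bullet> gs A j)) *\<^sub>R gs A j)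
      = (\<Sum>j\<in>{..<k}. (gs A j \<bullet> column k A) / (gs A j \<bullet> gs A j) * (gs A i \<bullet> gs A j))"
    by (simp add: inner_sum_right)
  also have "\<dots> = (\<Sum>j\<in>{i}. (gs A j \<bullet> column k A) / (gs A j \<bullet> gs A j) * (gs A i \<bullet> gs A j))"
    using less.prems orth by (intro sum.mono_neutral_right) auto
  \<comment> \<open>If \<open>gs A i\<close> vanishes, both sides are 0 because of
    \<open>x / 0 = 0\<close>, so dependent columns need no separate case.\<close>
  also have "\<dots> = gs A i \<bullet> column k A"
    by simp
  finally show ?case
    by (subst (2) gram_schmidt_column.simps) (simp add: inner_diff_right)
qed

lemma gram_schmidt_orthogonal:
  "i \<noteq> k \<Longrightarrow> gs A i \<bullet> gs A k = 0"
  by (metis gram_schmidt_orthogonal_less inner_commute linorder_neqE)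

lemma column_minus_gram_schmidt_in_span:
  "column k A - gs A k \<in> span (gs A ` {..<k})"
proof -
  have "column k A - gs A k = (\<Sum>j\<in>{..<k}. ((gs A j \<bullet> column k A) / (gs A j \<bullet> gs A j)) *\<^sub>R gs A j)"
    using column_eq_gram_schmidt[of k A] unfolding diff_eq_eq by (simp only: add.commute)
  also have "\<dots> \<in> span (gs A ` {..<k})"
    by (intro span_sum span_scale span_base) auto
  finally show ?thesis .
qed

lemma span_gram_schmidt:
  "span (gs A ` {..<k}) = span ((\<lambda>i. column i A) ` {..<k})"
proof -
  have "gs A j \<in> span ((\<lambda>i. column i A) ` {..j})" for j
  proof (induction j rule: finite_linorder_induct)
    case (less j)
    show ?case
    proof (subst gram_schmidt_column.simps, intro span_diff span_sum span_scale)
      show "column j A \<in> span ((\<lambda>i. column i A) ` {..j})"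
        by (intro span_base) auto
      fix i assume "i \<in> {..<j}"
      then show "gs A i \<in> span ((\<lambda>i. column i A) ` {..j})"
        using less[of i] span_mono[of "(\<lambda>i. column i A) ` {..i}" "(\<lambda>i. column i A) ` {..j}"]
        by fastforce
    qed
  qed
  then have 1: "gs A j \<in> span ((\<lambda>i. column i A) ` {..<k})" if "j < k" for j
    using that span_mono[of "(\<lambda>i. column i A) ` {..j}" "(\<lambda>i. column i A) ` {..<k}"]
    by fastforce
  have 2: "column j A \<in> span (gs A ` {..<k})" if "j < k" for j
    by (subst column_eq_gram_schmidt, intro span_add span_sum span_scale span_base)
      (use that in auto)
  show ?thesis
    using 1 2 by (intro subset_antisym span_minimal subspace_span) auto
qed

text \<open>Two vectors with these properties differ by an element of the span of the earlier
  columns that is orthogonal to that span. This identifies Gram-Schmidt columns without unfolding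
  the recursion.\<close>

lemma gram_schmidt_column_unique:
  assumes v: "v - column k A \<in> span ((\<lambda>i. column i A) ` {..<k})"
    and orth: "\<And>i. i < k \<Longrightarrow> v \<bullet> column i A = 0"
  shows "v = gs A k"
proof -
  let ?S = "(\<lambda>i. column i A) ` {..<k}"
  have "gs A k - column k A \<in> span (gs A ` {..<k})"
    using span_neg[OF column_minus_gram_schmidt_in_span] by (metis minus_diff_eq)
  then have w: "v - gs A k \<in> span ?S"
    using span_diff[OF v] unfolding span_gram_schmidt by fastforce
  have "orthogonal (gs A k) (column i A)" if "i < k" for i
  proof (rule orthogonal_to_span)
    show "column i A \<in> span (gs A ` {..<k})"
      unfolding span_gram_schmidt by (intro span_base) (use that in auto)
  qed (auto simp: orthogonal_def intro!: gram_schmidt_orthogonal)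
  then have "orthogonal (v - gs A k) x" if "x \<in> ?S" for x
    using that orth by (auto simp: orthogonal_def inner_diff_left)
  then have "orthogonal (v - gs A k) (v - gs A k)"
    by (rule orthogonal_to_span[OF w])
  then show ?thesis by (simp add: orthogonal_def)
qed

section \<open>Gram-Schmidt columns under matrix multiplication\<close>

lemma column_matrix_mult: "column k (A ** B) = A *v column k B"
  by (simp add: column_def matrix_matrix_mult_def matrix_vector_mult_def vec_eq_iff)

lemma inner_orthogonal_matrix:
  fixes U :: "real^'n^'n"
  assumes "orthogonal_matrix U"
  shows "(U *v x) \<bullet> (U *v y) = x \<bullet> y"
proof -
  have "(U *v x) \<bullet> (U *v y) = (transpose U *v (U *v x)) \<bullet> y"
    by (simp flip: dot_lmul_matrix)
  also have "transpose U *v (U *v x) = x"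
    using assms by (simp add: matrix_vector_mul_assoc orthogonal_matrix_def del: transpose_matrix_vector)
  finally show ?thesis .
qed

lemma gram_schmidt_orthogonal_matrix_mult:
  assumes "orthogonal_matrix U"
  shows "gs (U ** A) k = U *v gs A k"
proof (induction k rule: finite_linorder_induct)
  case (less k)
  have "gs (U ** A) k = U *v column k A - (\<Sum>j\<in>{..<k}. ((gs A j \<bullet> column k A) / (gs A j \<bullet> gs A j)) *\<^sub>R (U *v gs A j))"
    by (subst gram_schmidt_column.simps)
      (simp add: less column_matrix_mult inner_orthogonal_matrix[OF assms])
  also have "\<dots> = U *v gs A k"
    by (subst (2) gram_schmidt_column.simps)
      (simp add: matrix_vector_mult_diff_distrib matrix_vector_mult_scaleR
        linear_sum[OF matrix_vector_mul_linear])
  finally show ?case .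
qed

lemma norm_gram_schmidt_orthogonal_matrix_mult:
  "orthogonal_matrix U \<Longrightarrow> norm (gs (U ** A) k) = norm (gs A k)"
  by (simp add: gram_schmidt_orthogonal_matrix_mult norm_eq_sqrt_inner inner_orthogonal_matrix)

lemma column_mult_upper_triangular:
  fixes A R :: "real^'n::{finite,linorder}^'n::{finite,linorder}"
  assumes "\<And>i j. j < i \<Longrightarrow> R $ i $ j = 0"
  shows "column k (A ** R) = R $ k $ k *\<^sub>R column k A + (\<Sum>i\<in>{..<k}. R $ i $ k *\<^sub>R column i A)"
proof -
  have "column k (A ** R) = (\<Sum>i\<in>UNIV. R $ i $ k *\<^sub>R column i A)"
    by (simp add: column_def matrix_matrix_mult_def vec_eq_iff mult.commute)
  also have "\<dots> = (\<Sum>i\<in>insert k {..<k}. R $ i $ k *\<^sub>R column i A)"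
    using assms by (intro sum.mono_neutral_right) auto
  finally show ?thesis by simp
qed

text \<open>Since the diagonal has no zeros, the columns before \<open>k\<close> of
  \<open>A ** R\<close> and of \<open>A\<close> have the same span. The entries of \<open>R\<close>
  above the diagonal only add vectors of that span, which do not affect the orthogonal
  component.\<close>

lemma gram_schmidt_mult_upper_triangular:
  fixes A R :: "real^'n::{finite,linorder}^'n::{finite,linorder}"
  assumes upper: "\<And>i j. j < i \<Longrightarrow> R $ i $ j = 0" and diag: "\<And>i. R $ i $ i \<noteq> 0"
  shows "gs (A ** R) k = R $ k $ k *\<^sub>R gs A k"
proof -
  let ?S = "\<lambda>A. (\<lambda>i. column i A) ` {..<k}"
  have col: "column i (B ** R) = R $ i $ i *\<^sub>R column i B + (\<Sum>j\<in>{..<i}. R $ j $ i *\<^sub>R column j B)"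
    for B :: "real^'n::{finite,linorder}^'n::{finite,linorder}" and i
    by (rule column_mult_upper_triangular) (rule upper)
  have AR: "column i (A ** R) \<in> span (?S A)" if "i < k" for i
    by (subst col, intro span_add span_sum span_scale span_base) (use that in auto)
  have A: "i < k \<Longrightarrow> column i A \<in> span (?S (A ** R))" for i
  proof (induction i rule: finite_linorder_induct)
    case (less i)
    have "column i A = (1 / R $ i $ i) *\<^sub>R (column i (A ** R) - (\<Sum>j\<in>{..<i}. R $ j $ i *\<^sub>R column j A))"
      unfolding col using diag[of i] by simp
    also have "\<dots> \<in> span (?S (A ** R))"
      using less by (intro span_scale span_diff span_sum) (auto intro: span_base)
    finally show ?case .
  qed
  have span: "span (?S (A ** R)) = span (?S A)"
    using A AR by (intro subset_antisym span_minimal subspace_span) auto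
  have gs_orth: "orthogonal (gs A k) x" if "x \<in> span (?S A)" for x
    using that unfolding span_gram_schmidt[symmetric]
    by (rule orthogonal_to_span) (auto simp: orthogonal_def intro!: gram_schmidt_orthogonal)
  have "R $ k $ k *\<^sub>R gs A k = gs (A ** R) k"
  proof (rule gram_schmidt_column_unique)
    have "gs A k - column k A \<in> span (?S A)"
      unfolding span_gram_schmidt[symmetric]
      using span_neg[OF column_minus_gram_schmidt_in_span] by (metis minus_diff_eq)
    moreover have "(\<Sum>i\<in>{..<k}. R $ i $ k *\<^sub>R column i A) \<in> span (?S A)"
      by (intro span_sum span_scale span_base) auto
    ultimately have "R $ k $ k *\<^sub>R (gs A k - column k A) - (\<Sum>i\<in>{..<k}. R $ i $ k *\<^sub>R column i A) \<in> span (?S A)"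
      by (meson span_diff span_scale)
    then show "R $ k $ k *\<^sub>R gs A k - column k (A ** R) \<in> span (?S (A ** R))"
      unfolding span col[of k A] by (simp add: scaleR_diff_right diff_diff_eq)
    show "(R $ k $ k *\<^sub>R gs A k) \<bullet> column i (A ** R) = 0" if "i < k" for i
      using gs_orth[OF AR[OF that]] by (simp add: orthogonal_def)
  qed
  then show ?thesis by simp
qed

text \<open>\<open>U\<close> consists of the normalized Gram-Schmidt columns. By
  \<open>gram_schmidt_mult_upper_triangular\<close>, the ratio of the Gram-Schmidt norms of
  \<open>A ** B\<close> and \<open>B\<close> is then the norm for \<open>A ** U\<close>, where only
  the orthogonal factor is left.\<close>

lemma QR_decomposition:
  fixes B :: "real^'n::{finite,linorder}^'n::{finite,linorder}"
  assumes nz: "\<And>k. gs B k \<noteq> 0"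
  obtains U R :: "real^'n::{finite,linorder}^'n::{finite,linorder}"
  where "orthogonal_matrix U" "B = U ** R"
    "\<And>i j. j < i \<Longrightarrow> R $ i $ j = 0" "\<And>k. R $ k $ k = norm (gs B k)"
proof
  define U :: "real^'n::{finite,linorder}^'n::{finite,linorder}" where "U = (\<chi> i k. gs B k $ i / norm (gs B k))"
  define R :: "real^'n::{finite,linorder}^'n::{finite,linorder}" where
    "R = (\<chi> j k. if j < k then (gs B j \<bullet> column k B) / norm (gs B j) else if j = k then norm (gs B k) else 0)"
  have "(\<Sum>i\<in>UNIV. gs B k $ i * gs B l $ i) = (if k = l then (norm (gs B k))\<^sup>2 else 0)" for k l
    using gram_schmidt_orthogonal[of k l B] unfolding power2_norm_eq_inner
    by (auto simp: inner_vec_def)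
  then have "transpose U ** U = mat 1"
    using nz by (simp add: U_def transpose_def matrix_matrix_mult_def mat_def vec_eq_iff
        power2_eq_square flip: sum_divide_distrib)
  then show "orthogonal_matrix U" by (simp add: orthogonal_matrix)
  show "R $ i $ j = 0" if "j < i" for i j
    using that by (auto simp: R_def)
  show "R $ k $ k = norm (gs B k)" for k
    by (simp add: R_def)
  have colU: "column i U = (1 / norm (gs B i)) *\<^sub>R gs B i" for i
    by (simp add: U_def column_def vec_eq_iff)
  have "column k (U ** R) = column k B" for k
  proof -
    have "column k (U ** R) = gs B k + (\<Sum>i\<in>{..<k}. R $ i $ k *\<^sub>R column i U)"
      by (subst column_mult_upper_triangular) (auto simp: colU R_def nz)
    also have "\<dots> = column k B"
      by (subst (2) column_eq_gram_schmidt)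
        (auto simp: R_def colU power2_norm_eq_inner[symmetric] power2_eq_square intro!: sum.cong)
    finally show ?thesis .
  qed
  then show "B = U ** R"
    by (simp add: column_def vec_eq_iff)
qed

text \<open>The Gram matrix is \<open>R^T D R\<close>, where \<open>R\<close> is the unit triangular
  matrix of the Gram-Schmidt coefficients and \<open>D\<close> the diagonal matrix of the squared
  norms. As \<open>S\<close> is closed downwards, the factorization survives replacing the rows
  outside \<open>S\<close> by unit rows. Vanishing Gram-Schmidt vectors only put zeros into
  \<open>D\<close>.\<close>

lemma det_gram_initial_segment:
  fixes C :: "real^'n::{finite,linorder}^'n::{finite,linorder}"
  assumes S: "\<And>i j. i \<in> S \<Longrightarrow> j < i \<Longrightarrow> j \<in> S"
  shows "det (\<chi> i j. if i \<in> S then (transpose C ** C) $ i $ j else if i = j then 1 else 0)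
    = (\<Prod>j\<in>S. (norm (gs C j))\<^sup>2)"
proof -
  define r where "r m i = (if m < i then (gs C m \<bullet> column i C) / (gs C m \<bullet> gs C m) else if m = i then 1 else 0)" for m i
  define D where "D m = (norm (gs C m))\<^sup>2" for m
  have col: "column i C = (\<Sum>m\<in>UNIV. r m i *\<^sub>R gs C m)" for i
  proof -
    have "(\<Sum>m\<in>UNIV. r m i *\<^sub>R gs C m) = (\<Sum>m\<in>insert i {..<i}. r m i *\<^sub>R gs C m)"
      by (intro sum.mono_neutral_right) (auto simp: r_def)
    also have "\<dots> = column i C"
      using column_eq_gram_schmidt[of i C] by (simp add: r_def)
    finally show ?thesis ..
  qed
  have gram: "(transpose C ** C) $ i $ j = (\<Sum>m\<in>UNIV. r m i * (D m * r m j))" for i j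
  proof -
    have "(transpose C ** C) $ i $ j = column i C \<bullet> column j C"
      by (simp add: transpose_def matrix_matrix_mult_def column_def inner_vec_def)
    also have "\<dots> = (\<Sum>m\<in>UNIV. \<Sum>l\<in>UNIV. r m i * r l j * (gs C m \<bullet> gs C l))"
      unfolding col by (simp add: inner_sum_left inner_sum_right sum_distrib_left mult.assoc)
        (subst sum.swap, simp add: ac_simps)
    also have "\<dots> = (\<Sum>m\<in>UNIV. \<Sum>l\<in>{m}. r m i * r l j * (gs C m \<bullet> gs C l))"
      by (intro sum.cong sum.mono_neutral_right) (auto simp: gram_schmidt_orthogonal)
    finally show ?thesis
      by (simp add: D_def power2_norm_eq_inner ac_simps)
  qed
  text \<open>With \<open>C = V R\<close>, the rows of \<open>R\<^sup>T\<close> in \<open>S\<close> vanish outside the columns in \<open>S\<close>.\<close>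
  define L :: "real^'n::{finite,linorder}^'n::{finite,linorder}" where "L = (\<chi> i m. if i \<in> S \<and> m \<in> S then r m i else if i = m then 1 else 0)"
  define E :: "real^'n::{finite,linorder}^'n::{finite,linorder}" where "E = (\<chi> m j. if m \<in> S then D m * r m j else if m = j then 1 else 0)"
  have "(\<Sum>m\<in>UNIV. L $ i $ m * E $ m $ j) = (if i \<in> S then (transpose C ** C) $ i $ j else if i = j then 1 else 0)" for i j
  proof (cases "i \<in> S")
    case True
    have "L $ i $ m * E $ m $ j = r m i * (D m * r m j)" for m
      using S[OF True, of m] True by (auto simp: L_def E_def r_def)
    then show ?thesis using True by (simp add: gram)
  next
    case False
    have "(\<Sum>m\<in>UNIV. L $ i $ m * E $ m $ j) = (\<Sum>m\<in>{i}. L $ i $ m * E $ m $ j)"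
      using False by (intro sum.mono_neutral_right) (auto simp: L_def)
    then show ?thesis using False by (simp add: L_def E_def)
  qed
  then have "(\<chi> i j. if i \<in> S then (transpose C ** C) $ i $ j else if i = j then 1 else 0) = L ** E"
    by (simp add: matrix_matrix_mult_def vec_eq_iff)
  moreover have "det L = 1"
    by (subst det_lower_triangular) (auto simp: L_def r_def intro!: prod.neutral)
  moreover have "det E = (\<Prod>m\<in>UNIV. if m \<in> S then D m else 1)"
    by (subst det_upper_triangular) (auto simp: E_def r_def S intro!: prod.cong)
  moreover have "\<dots> = (\<Prod>m\<in>S. D m)"
    by (simp add: prod.If_cases)
  ultimately show ?thesis
    by (simp add: det_mul D_def)
qed

lemma det_power2_eq_prod_gram_schmidt:
  fixes C :: "real^'n::{finite,linorder}^'n::{finite,linorder}"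
  shows "(det C)\<^sup>2 = (\<Prod>j\<in>UNIV. (norm (gs C j))\<^sup>2)"
proof -
  have "(\<chi> i j. if i \<in> UNIV then (transpose C ** C) $ i $ j else if i = j then 1 else 0) = transpose C ** C"
    by (simp add: vec_eq_iff)
  then show ?thesis
    using det_gram_initial_segment[of UNIV C] by (simp add: det_mul det_transpose power2_eq_square)
qed

lemma gram_schmidt_nonzero_iff_det:
  "det C \<noteq> 0 \<longleftrightarrow> (\<forall>j. gs C j \<noteq> 0)"
proof -
  have "det C \<noteq> 0 \<longleftrightarrow> (\<Prod>j\<in>UNIV. (norm (gs C j))\<^sup>2) \<noteq> 0"
    by (simp flip: det_power2_eq_prod_gram_schmidt)
  then show ?thesis by (simp add: prod_zero_iff)
qed

lemma norm_gram_schmidt_le: "norm (gs A k) \<le> norm (column k A)"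
proof -
  have "orthogonal (gs A k) (column k A - gs A k)"
    using column_minus_gram_schmidt_in_span
    by (rule orthogonal_to_span) (auto simp: orthogonal_def intro!: gram_schmidt_orthogonal)
  then have "gs A k \<bullet> gs A k = gs A k \<bullet> column k A"
    by (simp add: orthogonal_def inner_diff_right)
  also have "\<dots> \<le> norm (gs A k) * norm (column k A)"
    by (rule norm_cauchy_schwarz)
  finally show ?thesis
    by (cases "gs A k = 0") (auto simp: power2_norm_eq_inner[symmetric] power2_eq_square)
qed

section \<open>Singular values and principal minors\<close>

text \<open>Unit rows outside \<open>S\<close> leave the minor with rows and columns in
  \<open>S\<close>, and avoid a matrix type indexed by \<open>S\<close>.\<close>

definition principal_minor :: "'a::comm_ring_1^'n^'n \<Rightarrow> 'n set \<Rightarrow> 'a" where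
  "principal_minor B S = det (\<chi> i j. if i \<in> S then B $ i $ j else if i = j then 1 else 0)"

text \<open>In each term of the Leibniz formula the product of sums is expanded, \<open>S\<close>
  being the set of rows that contribute an entry of \<open>B\<close>. The other rows contribute
  \<open>x\<close> and must be fixed by the permutation, which is what the unit rows encode.\<close>

lemma det_add_scalar_matrix:
  fixes B :: "'a::comm_ring_1^'n^'n"
  shows "det (\<chi> i j. (if i = j then x else 0) + B $ i $ j) =
    (\<Sum>S\<in>UNIV. principal_minor B S * x ^ (CARD('n) - card S))"
proof -
  have "(\<Prod>i\<in>UNIV. (if i = p i then x else 0) + B $ i $ p i) =
    (\<Sum>S\<in>UNIV. (\<Prod>i\<in>UNIV. if i \<in> S then B $ i $ p i else if i = p i then 1 else 0) * x ^ (CARD('n) - card S))" for p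
  proof -
    have "(\<Prod>i\<in>UNIV. (if i = p i then x else 0) + B $ i $ p i)
        = (\<Sum>S\<in>Pow UNIV. (\<Prod>i\<in>S. B $ i $ p i) * (\<Prod>i\<in>UNIV - S. if i = p i then x else 0))"
      by (subst add.commute, rule prod_add) simp
    also have "\<dots> = (\<Sum>S\<in>UNIV. (\<Prod>i\<in>UNIV. if i \<in> S then B $ i $ p i else if i = p i then 1 else 0) * x ^ (CARD('n) - card S))"
    proof (intro sum.cong)
      fix S
      have "(\<Prod>i\<in>UNIV - S. if i = p i then x else 0) = (\<Prod>i\<in>UNIV - S. x * (if i = p i then 1 else 0))"
        by (intro prod.cong) auto
      also have "\<dots> = x ^ (CARD('n) - card S) * (\<Prod>i\<in>UNIV - S. if i = p i then 1 else 0)"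
        by (simp add: prod.distrib card_Diff_subset)
      finally show "(\<Prod>i\<in>S. B $ i $ p i) * (\<Prod>i\<in>UNIV - S. if i = p i then x else 0) =
          (\<Prod>i\<in>UNIV. if i \<in> S then B $ i $ p i else if i = p i then 1 else 0) * x ^ (CARD('n) - card S)"
        by (simp add: prod.If_cases Compl_eq_Diff_UNIV ac_simps)
    qed simp
    finally show ?thesis .
  qed
  then show ?thesis
    unfolding det_def principal_minor_def
    by (simp add: sum_distrib_left sum_distrib_right mult.assoc) (subst sum.swap, simp)
qed

lemma principal_minor_const_poly:
  "principal_minor (\<chi> i j. [:- (A $ i $ j):]) S = [:(- 1) ^ card S * principal_minor A S:]"
proof -
  have "(\<Prod>i\<in>UNIV. if i \<in> S then [:- (A $ i $ p i):] else if i = p i then 1 else 0)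
      = [:(- 1) ^ card S * (\<Prod>i\<in>UNIV. if i \<in> S then A $ i $ p i else if i = p i then 1 else 0):]" for p
  proof -
    have "(\<Prod>i\<in>UNIV. if i \<in> S then [:- (A $ i $ p i):] else if i = p i then 1 else 0)
      = (\<Prod>i\<in>UNIV. [:(if i \<in> S then - 1 else 1) * (if i \<in> S then A $ i $ p i else if i = p i then 1 else 0):])"
      by (intro prod.cong) (auto simp: one_pCons)
    also have "\<dots> = [:\<Prod>i\<in>UNIV. (if i \<in> S then - 1 else 1) * (if i \<in> S then A $ i $ p i else if i = p i then 1 else 0):]"
      by (rule prod_to_poly)
    also have "(\<Prod>i\<in>UNIV. (if i \<in> S then - 1 else 1) * (if i \<in> S then A $ i $ p i else if i = p i then 1 else 0))
        = (- 1) ^ card S * (\<Prod>i\<in>UNIV. if i \<in> S then A $ i $ p i else if i = p i then 1 else 0)"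
      by (simp add: prod.distrib prod.If_cases)
    finally show ?thesis .
  qed
  then show ?thesis
    unfolding principal_minor_def det_def
    by (simp add: of_int_poly sum_to_poly sum_distrib_left ac_simps cong: if_cong)
qed

lemma charpoly_eq_sum:
  fixes A :: "real^'n^'n"
  shows "charpoly A = (\<Sum>S\<in>UNIV. [:(- 1) ^ card S * principal_minor A S:] * [:0, 1:] ^ (CARD('n) - card S))"
proof -
  have "charpoly A = det (\<chi> i j. (if i = j then [:0, 1:] else 0) + (\<chi> i j. [:- (A $ i $ j):]) $ i $ j)"
    unfolding charpoly_def by (intro arg_cong[where f=det]) (simp add: vec_eq_iff)
  then show ?thesis
    by (simp only: det_add_scalar_matrix principal_minor_const_poly)
qed

lemma coeff_sum_const_power:
  assumes "finite F"
  shows "coeff (\<Sum>S\<in>F. [:c S:] * [:0, 1:] ^ n S) m = (\<Sum>S\<in>{S\<in>F. n S = m}. c S)"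
proof -
  have "[:c S:] * [:0, 1:] ^ n S = monom (c S) (n S)" for S
    by (simp add: monom_altdef)
  then have "coeff (\<Sum>S\<in>F. [:c S:] * [:0, 1:] ^ n S) m = (\<Sum>S\<in>F. if n S = m then c S else 0)"
    by (simp only: coeff_sum coeff_monom)
  also have "\<dots> = (\<Sum>S\<in>{S\<in>F. n S = m}. c S)"
    using assms by (simp add: sum.inter_filter)
  finally show ?thesis .
qed

lemma coeff_charpoly:
  fixes A :: "real^'n^'n"
  assumes "k \<le> CARD('n)"
  shows "coeff (charpoly A) (CARD('n) - k) = (- 1) ^ k * (\<Sum>S | card S = k. principal_minor A S)"
proof -
  have "card (S :: 'n set) \<le> CARD('n)" for S
    by (intro card_mono) auto
  \<comment> \<open>Subtraction on \<open>nat\<close> is truncated, so the exponent determines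
    \<open>card S\<close> only because \<open>card S\<close> is at most the dimension.\<close>
  with assms have "CARD('n) - card S = CARD('n) - k \<longleftrightarrow> card S = k" for S :: "'n set"
    by (metis diff_diff_cancel)
  then show ?thesis
    unfolding charpoly_eq_sum coeff_sum_const_power[OF finite] sum_distrib_left
    by (intro sum.cong) auto
qed

lemma degree_charpoly_le: "degree (charpoly (A :: real^'n^'n)) \<le> CARD('n)"
  unfolding charpoly_eq_sum
proof (intro degree_sum_le)
  fix S :: "'n set"
  have "degree ([:(- 1) ^ card S * principal_minor A S:] * [:0, 1:] ^ (CARD('n) - card S))
      \<le> 0 + (CARD('n) - card S)"
    using degree_power_le[of "[:0, 1::real:]" "CARD('n) - card S"]
    by (intro order_trans[OF degree_mult_le]) simp
  then show "degree ([:(- 1) ^ card S * principal_minor A S:] * [:0, 1:] ^ (CARD('n) - card S)) \<le> CARD('n)"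
    by simp
qed simp

lemma monic_charpoly:
  fixes A :: "real^'n^'n"
  shows "degree (charpoly A) = CARD('n)" "lead_coeff (charpoly A) = 1"
proof -
  have "{S :: 'n set. card S = 0} = {{}}"
    by auto
  moreover have "principal_minor A {} = 1"
  proof -
    have "(\<chi> i j. if i \<in> {} then A $ i $ j else if i = j then 1 else 0) = mat 1"
      by (simp add: mat_def vec_eq_iff)
    then show ?thesis by (simp add: principal_minor_def)
  qed
  ultimately have 1: "coeff (charpoly A) CARD('n) = 1"
    using coeff_charpoly[of 0 A] by simp
  then show 2: "degree (charpoly A) = CARD('n)"
    using degree_charpoly_le[of A] le_degree[of "charpoly A" "CARD('n)"] by simp
  show "lead_coeff (charpoly A) = 1"
    using 1 2 by simp
qed

section \<open>Real roots of the characteristic polynomial of a Gram matrix\<close>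

definition complex_eval :: "complex \<Rightarrow> real poly \<Rightarrow> complex" where
  "complex_eval z p = poly (map_poly of_real p) z"

lemma complex_eval_pCons [simp]: "complex_eval z (pCons a p) = of_real a + z * complex_eval z p"
  by (simp add: complex_eval_def map_poly_pCons)

lemma complex_eval_0 [simp]: "complex_eval z 0 = 0"
  by (simp add: complex_eval_def)

lemma complex_eval_add [simp]: "complex_eval z (p + q) = complex_eval z p + complex_eval z q"
  by (induction p q rule: poly_induct2) (simp_all add: algebra_simps)

lemma complex_eval_smult [simp]: "complex_eval z (smult a p) = of_real a * complex_eval z p"
  by (induction p) (simp_all add: algebra_simps)

lemma complex_eval_mult [simp]: "complex_eval z (p * q) = complex_eval z p * complex_eval z q"
  by (induction p) (simp_all add: algebra_simps)

lemma complex_eval_sum: "complex_eval z (\<Sum>x\<in>A. f x) = (\<Sum>x\<in>A. complex_eval z (f x))"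
  by (induction A rule: infinite_finite_induct) simp_all

lemma complex_eval_1 [simp]: "complex_eval z 1 = 1"
  by (simp add: one_pCons)

lemma complex_eval_prod: "complex_eval z (\<Prod>x\<in>A. f x) = (\<Prod>x\<in>A. complex_eval z (f x))"
  by (induction A rule: infinite_finite_induct) simp_all

lemma complex_eval_of_real: "complex_eval (of_real x) p = of_real (poly p x)"
  by (induction p) simp_all

lemma complex_eval_diff: "complex_eval z (p - q) = complex_eval z p - complex_eval z q"
  using complex_eval_add[of z "p - q" q] by simp

lemma complex_eval_of_int: "complex_eval z (of_int k) = of_int k"
  by (simp add: of_int_poly)

lemma complex_eval_charpoly:
  "complex_eval z (charpoly A) = det (\<chi> i j. (if i = j then z else 0) - of_real (A $ i $ j))"
  unfolding charpoly_def det_def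
  by (simp add: complex_eval_sum complex_eval_prod complex_eval_diff complex_eval_of_int)
    (intro sum.cong refl arg_cong2[where f="(*)"] prod.cong, auto)

lemma complex_root_real_of_symmetric:
  assumes sym: "transpose A = A" and z: "complex_eval z (charpoly A) = 0"
  shows "z \<in> \<real>"
proof -
  let ?M = "\<chi> i j. (if i = j then z else 0) - of_real (A $ i $ j)"
  have "\<not> invertible ?M"
    using z unfolding complex_eval_charpoly by (simp add: invertible_det_nz)
  then obtain v where v: "?M *v v = 0" "v \<noteq> 0"
    using matrix_left_invertible_ker[of ?M] by (auto simp: invertible_left_inverse)
  have eig: "(\<Sum>j\<in>UNIV. of_real (A $ i $ j) * v $ j) = z * v $ i" for i
  proof -
    have "(\<Sum>j\<in>UNIV. ((if i = j then z else 0) - of_real (A $ i $ j)) * v $ j) = 0"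
      using v(1) by (simp add: matrix_vector_mult_def vec_eq_iff)
    moreover have "(\<Sum>j\<in>UNIV. (if i = j then z else 0) * v $ j) = z * v $ i"
      by (simp add: if_distrib[of "\<lambda>x. x * _"] cong: if_cong)
    ultimately show ?thesis
      by (simp add: left_diff_distrib sum_subtractf)
  qed
  \<comment> \<open>\<open>T\<close> is the Hermitian form \<open>v^* A v\<close> at a complex
    eigenvector: it is real by symmetry and equals \<open>z\<close> times the squared norm of
    \<open>v\<close>.\<close>
  define T where "T = (\<Sum>i\<in>UNIV. \<Sum>j\<in>UNIV. cnj (v $ i) * of_real (A $ i $ j) * v $ j)"
  have A_sym: "A $ i $ j = A $ j $ i" for i j
    using sym by (simp add: transpose_def vec_eq_iff)
  have "cnj T = (\<Sum>i\<in>UNIV. \<Sum>j\<in>UNIV. cnj (v $ j) * of_real (A $ j $ i) * v $ i)"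
    unfolding T_def cnj_sum
    by (intro sum.cong refl, subst A_sym) (simp add: ac_simps)
  also have "\<dots> = T"
    unfolding T_def by (rule sum.swap)
  finally have "T \<in> \<real>"
    by (simp add: complex_is_Real_iff complex_eq_iff)
  have "T = (\<Sum>i\<in>UNIV. cnj (v $ i) * (z * v $ i))"
    unfolding T_def by (simp add: eig[symmetric] sum_distrib_left mult.assoc)
  also have "\<dots> = z * of_real (\<Sum>i\<in>UNIV. (cmod (v $ i))\<^sup>2)"
  proof -
    have "cnj a * (z * a) = z * of_real ((cmod a)\<^sup>2)" for a
      by (simp only: complex_norm_square ac_simps)
    then show ?thesis by (simp only: of_real_sum sum_distrib_left)
  qed
  finally have T: "T = z * of_real (\<Sum>i\<in>UNIV. (cmod (v $ i))\<^sup>2)" .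
  obtain i where "v $ i \<noteq> 0"
    using v(2) by (auto simp: vec_eq_iff)
  then have "(\<Sum>i\<in>UNIV. (cmod (v $ i))\<^sup>2) > 0"
    by (intro sum_pos2[of _ i]) auto
  then have "z = T / of_real (\<Sum>i\<in>UNIV. (cmod (v $ i))\<^sup>2)"
    unfolding T by (simp del: of_real_sum)
  with \<open>T \<in> \<real>\<close> show ?thesis by (auto intro!: Reals_divide simp del: of_real_sum)
qed

text \<open>The fundamental theorem of algebra gives a complex root, which is real by assumption;
  splitting it off preserves real-rootedness. The count of the roots makes the list
  \<open>singular_values\<close> long enough for every index.\<close>

lemma real_rooted_imp_split:
  fixes p :: "real poly"
  assumes "p \<noteq> 0" "\<And>z. complex_eval z p = 0 \<Longrightarrow> z \<in> \<real>"
  shows "size (proots p) = degree p \<and> p = smult (lead_coeff p) (\<Prod>x\<in>#proots p. [:- x, 1:])"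
  using assms
proof (induction "degree p" arbitrary: p)
  case 0
  then obtain c where "p = [:c:]" by (metis degree_eq_zeroE)
  then show ?case by simp
next
  case (Suc n)
  have "\<not> constant (poly (map_poly complex_of_real p))"
    using Suc.hyps(2) by (subst constant_degree) (simp add: degree_map_poly)
  then obtain z where z: "complex_eval z p = 0"
    using fundamental_theorem_of_algebra unfolding complex_eval_def by blast
  then obtain x where "z = of_real x"
    using Suc.prems(2) by (meson Reals_cases)
  with z have "poly p x = 0"
    by (simp add: complex_eval_of_real)
  then obtain q where q: "p = [:- x, 1:] * q"
    by (metis poly_eq_0_iff_dvd dvdE)
  have "q \<noteq> 0" using Suc.prems(1) q by auto
  have "degree p = Suc (degree q)"
    unfolding q using \<open>q \<noteq> 0\<close> by (subst degree_mult_eq) auto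
  have "size (proots q) = degree q \<and> q = smult (lead_coeff q) (\<Prod>x\<in>#proots q. [:- x, 1:])"
  proof (rule Suc.hyps(1))
    show "n = degree q" using Suc.hyps(2) \<open>degree p = Suc (degree q)\<close> by simp
    show "z \<in> \<real>" if "complex_eval z q = 0" for z
      using Suc.prems(2)[of z] that by (simp add: q complex_eval_diff)
  qed fact
  moreover have "proots p = add_mset x (proots q)"
    unfolding q using \<open>q \<noteq> 0\<close> by (subst proots_mult) auto
  moreover have "lead_coeff p = lead_coeff q"
    unfolding q by (simp only: lead_coeff_mult) simp
  ultimately show ?case
    using \<open>degree p = Suc (degree q)\<close> q by (simp only: size_add_mset image_mset_add_mset prod_mset.add_mset
        mult_smult_right[symmetric])
qed

text \<open>For an eigenvector \<open>v\<close>, \<open>x\<close> times the squared norm of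
  \<open>v\<close> is the squared norm of \<open>A *v v\<close>. Nonnegativity of the roots ensures
  that squaring a singular value gives back the eigenvalue.\<close>

lemma nonneg_real_root_of_gram:
  fixes A :: "real^'n^'n"
  assumes "poly (charpoly (transpose A ** A)) x = 0"
  shows "0 \<le> x"
proof -
  let ?B = "transpose A ** A"
  have "poly (charpoly ?B) x = det (\<chi> i j. (if i = j then x else 0) - ?B $ i $ j)"
    unfolding charpoly_def det_def
    by (simp add: poly_sum poly_prod) (intro sum.cong refl arg_cong2[where f="(*)"] prod.cong, auto)
  also have "(\<chi> i j. (if i = j then x else 0) - ?B $ i $ j) = x *\<^sub>R mat 1 - ?B"
    by (simp add: vec_eq_iff mat_def)
  finally have "\<not> invertible (x *\<^sub>R mat 1 - ?B)"
    using assms by (simp add: invertible_det_nz)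
  then obtain v where v: "(x *\<^sub>R mat 1 - ?B) *v v = 0" "v \<noteq> 0"
    using matrix_left_invertible_ker[of "x *\<^sub>R mat 1 - ?B"] by (auto simp: invertible_left_inverse)
  then have "transpose A *v (A *v v) = x *\<^sub>R v"
    by (simp add: matrix_vector_mult_diff_rdistrib scaleR_matrix_vector_assoc[symmetric] matrix_vector_mul_assoc)
  then have "v \<bullet> (transpose A *v (A *v v)) = x * (v \<bullet> v)"
    by simp
  moreover have "v \<bullet> (transpose A *v (A *v v)) = (A *v v) \<bullet> (A *v v)"
    by (simp add: dot_lmul_matrix[symmetric] inner_commute)
  ultimately have "x * (v \<bullet> v) \<ge> 0" by simp
  with v(2) show ?thesis
    by (metis inner_gt_zero_iff zero_le_mult_iff not_le)
qed

lemma
  fixes A :: "real^'n^'n"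
  shows singular_values_nonneg: "i < CARD('n) \<Longrightarrow> 0 \<le> singular_values A ! i"
    and singular_values_decreasing: "i \<le> j \<Longrightarrow> j < CARD('n) \<Longrightarrow> singular_values A ! j \<le> singular_values A ! i"
    and charpoly_eq_prod_singular_values:
      "charpoly (transpose A ** A) = (\<Prod>i<CARD('n). [:- ((singular_values A ! i)\<^sup>2):] + [:0, 1:])"
proof -
  let ?p = "charpoly (transpose A ** A)"
  define xs where "xs = rev (sorted_list_of_multiset (proots ?p))"
  have sym: "transpose (transpose A ** A) = transpose A ** A"
    by (simp add: matrix_transpose_mul)
  have "?p \<noteq> 0"
    using monic_charpoly(2)[of "transpose A ** A"] by auto
  then have split: "size (proots ?p) = CARD('n)" "?p = (\<Prod>x\<in>#proots ?p. [:- x, 1:])"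
    using real_rooted_imp_split[of ?p] complex_root_real_of_symmetric[OF sym]
      monic_charpoly[of "transpose A ** A"] by (metis, metis smult_1_left)
  have mset_xs: "mset xs = proots ?p"
    by (simp add: xs_def)
  then have len: "length xs = CARD('n)"
    using split(1) by (metis size_mset)
  have nonneg: "0 \<le> x" if "x \<in> set xs" for x
    using that \<open>?p \<noteq> 0\<close> nonneg_real_root_of_gram[of A x] by (simp add: xs_def)
  have sv: "singular_values A = map sqrt xs"
    by (simp add: singular_values_def xs_def)
  show "0 \<le> singular_values A ! i" if "i < CARD('n)" for i
    using nonneg[of "xs ! i"] that len by (simp add: sv)
  have sorted: "sorted (rev xs)"
    by (simp add: xs_def)
  show "singular_values A ! j \<le> singular_values A ! i" if "i \<le> j" "j < CARD('n)" for i j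
    using sorted_rev_nth_mono[OF sorted that(1)] that len by (simp add: sv)
  have "?p = prod_list (map (\<lambda>x. [:- x, 1:]) xs)"
    by (subst split(2), subst mset_xs[symmetric]) (metis mset_map prod_mset_prod_list)
  also have "\<dots> = (\<Prod>i<CARD('n). [:- (xs ! i), 1:])"
    by (simp add: prod.list_conv_set_nth len atLeast0LessThan)
  also have "\<dots> = (\<Prod>i<CARD('n). [:- ((singular_values A ! i)\<^sup>2):] + [:0, 1:])"
    using nonneg by (intro prod.cong) (auto simp: sv len)
  finally show "?p = (\<Prod>i<CARD('n). [:- ((singular_values A ! i)\<^sup>2):] + [:0, 1:])" .
qed

text \<open>Both sides are, up to the same sign, the coefficient of degree
  \<open>CARD('n) - k\<close> of the characteristic polynomial: once from its factorization, once
  from \<open>coeff_charpoly\<close>.\<close>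

lemma elementary_symmetric_singular_values:
  fixes A :: "real^'n^'n"
  assumes "k \<le> CARD('n)"
  shows "(\<Sum>S | S \<subseteq> {..<CARD('n)} \<and> card S = k. \<Prod>i\<in>S. (singular_values A ! i)\<^sup>2) =
    (\<Sum>S | card S = k. principal_minor (transpose A ** A) S)"
proof -
  let ?d = "CARD('n)" and ?r = "\<lambda>i. (singular_values A ! i)\<^sup>2"
  have card_le: "card S \<le> ?d" if "S \<subseteq> {..<?d}" for S
    using card_mono[OF _ that] by simp
  have "charpoly (transpose A ** A) = (\<Sum>S\<in>Pow {..<?d}. (\<Prod>i\<in>S. [:- ?r i:]) * (\<Prod>i\<in>{..<?d} - S. [:0, 1:]))"
    unfolding charpoly_eq_prod_singular_values by (rule prod_add) simp
  also have "\<dots> = (\<Sum>S\<in>Pow {..<?d}. [:\<Prod>i\<in>S. - ?r i:] * [:0, 1:] ^ (?d - card S))"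
    by (intro sum.cong refl arg_cong2[where f="(*)"] prod_to_poly)
      (auto simp: card_Diff_subset finite_subset)
  finally have "coeff (charpoly (transpose A ** A)) (?d - k) =
      (\<Sum>S\<in>{S\<in>Pow {..<?d}. ?d - card S = ?d - k}. \<Prod>i\<in>S. - ?r i)"
    by (simp only: coeff_sum_const_power[OF finite_Pow_iff[THEN iffD2, OF finite_lessThan]])
  also have "{S\<in>Pow {..<?d}. ?d - card S = ?d - k} = {S. S \<subseteq> {..<?d} \<and> card S = k}"
    using card_le assms by (auto, metis diff_diff_cancel)
  also have "(\<Sum>S\<in>{S. S \<subseteq> {..<?d} \<and> card S = k}. \<Prod>i\<in>S. - ?r i)
      = (\<Sum>S\<in>{S. S \<subseteq> {..<?d} \<and> card S = k}. (- 1) ^ k * (\<Prod>i\<in>S. ?r i))"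
  proof (intro sum.cong refl)
    fix S assume "S \<in> {S. S \<subseteq> {..<?d} \<and> card S = k}"
    then have "card S = k" by simp
    have "(\<Prod>i\<in>S. - ?r i) = (\<Prod>i\<in>S. (- 1) * ?r i)" by simp
    also have "\<dots> = (- 1) ^ k * (\<Prod>i\<in>S. ?r i)"
      using \<open>card S = k\<close> by (simp only: prod.distrib prod_constant)
    finally show "(\<Prod>i\<in>S. - ?r i) = (- 1) ^ k * (\<Prod>i\<in>S. ?r i)" .
  qed
  also have "\<dots> = (- 1) ^ k * (\<Sum>S\<in>{S. S \<subseteq> {..<?d} \<and> card S = k}. \<Prod>i\<in>S. ?r i)"
    by (simp add: sum_distrib_left)
  finally show ?thesis
    using coeff_charpoly[OF assms, of "transpose A ** A"] by simp
qed

lemma prod_le_prod_initial_segment: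
  fixes f :: "nat \<Rightarrow> real"
  assumes "\<And>i. i < d \<Longrightarrow> 0 \<le> f i" and "\<And>i j. i \<le> j \<Longrightarrow> j < d \<Longrightarrow> f j \<le> f i"
    and "S \<subseteq> {..<d}" "card S = k"
  shows "prod f S \<le> prod f {..<k}"
  using assms(3,4)
proof (induction k arbitrary: S)
  case 0
  then have "S = {}" using finite_subset by fastforce
  then show ?case by simp
next
  case (Suc k)
  have fin: "finite S" using Suc.prems finite_subset by blast
  have "S \<noteq> {}" using Suc.prems by auto
  define m where "m = Max S"
  have m: "m \<in> S" "\<And>i. i \<in> S \<Longrightarrow> i \<le> m" "m < d"
    using fin \<open>S \<noteq> {}\<close> Suc.prems(1) by (auto simp: m_def)
  \<comment> \<open>\<open>S\<close> has \<open>Suc k\<close> elements, all at most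
    \<open>m\<close>; hence \<open>k \<le> m\<close>, and the factor \<open>f m\<close> can be
    exchanged for \<open>f k\<close>, which is at least as large.\<close>
  have "S \<subseteq> {..m}" using m by auto
  from card_mono[OF _ this] have "k \<le> m" using Suc.prems by simp
  have "prod f S = f m * prod f (S - {m})"
    using fin m(1) by (rule prod.remove)
  also have "\<dots> \<le> f k * prod f {..<k}"
  proof (intro mult_mono)
    show "f m \<le> f k" using assms(2) \<open>k \<le> m\<close> m(3) by simp
    show "prod f (S - {m}) \<le> prod f {..<k}"
      using Suc.prems fin m(1) by (intro Suc.IH) auto
    show "0 \<le> f k" using assms(1) \<open>k \<le> m\<close> m(3) by simp
    show "0 \<le> prod f (S - {m})"
      using Suc.prems assms(1) by (intro prod_nonneg) auto
  qed
  finally show ?case by (simp add: mult.commute)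
qed

text \<open>The leading product is one of the terms of the elementary symmetric polynomial and the
  largest of them; \<open>2 ^ CARD('n)\<close> bounds the number of terms. This constant disappears
  from the growth rate.\<close>

lemma prod_singular_values_bounds:
  fixes A :: "real^'n^'n"
  assumes "k \<le> CARD('n)"
  defines "G \<equiv> \<Sum>S | card S = k. principal_minor (transpose A ** A) S"
  shows "(\<Prod>i<k. (singular_values A ! i)\<^sup>2) \<le> G"
    and "G \<le> 2 ^ CARD('n) * (\<Prod>i<k. (singular_values A ! i)\<^sup>2)"
proof -
  let ?d = "CARD('n)" and ?r = "\<lambda>i. (singular_values A ! i)\<^sup>2"
  have G: "G = (\<Sum>S | S \<subseteq> {..<?d} \<and> card S = k. \<Prod>i\<in>S. ?r i)"
    unfolding G_def elementary_symmetric_singular_values[OF assms(1)] ..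
  have fin: "finite {S. S \<subseteq> {..<?d} \<and> card S = k}"
    by (rule finite_subset[of _ "Pow {..<?d}"]) auto
  show "(\<Prod>i<k. ?r i) \<le> G"
    unfolding G by (rule member_le_sum[of "{..<k}"]) (use assms(1) fin in \<open>auto intro!: prod_nonneg\<close>)
  have "G \<le> of_nat (card {S. S \<subseteq> {..<?d} \<and> card S = k}) * (\<Prod>i<k. ?r i)"
    unfolding G
  proof (rule sum_bounded_above)
    fix S assume "S \<in> {S. S \<subseteq> {..<?d} \<and> card S = k}"
    then show "(\<Prod>i\<in>S. ?r i) \<le> (\<Prod>i<k. ?r i)"
      by (intro prod_le_prod_initial_segment[of ?d])
        (auto intro!: power_mono singular_values_nonneg singular_values_decreasing)
  qed
  also have "\<dots> \<le> 2 ^ ?d * (\<Prod>i<k. ?r i)"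
  proof (rule mult_right_mono)
    have "card {S. S \<subseteq> {..<?d} \<and> card S = k} \<le> card (Pow {..<?d})"
      by (intro card_mono) auto
    then show "real (card {S. S \<subseteq> {..<?d} \<and> card S = k}) \<le> 2 ^ ?d"
      by (simp add: card_Pow)
  qed (auto intro!: prod_nonneg)
  finally show "G \<le> 2 ^ ?d * (\<Prod>i<k. ?r i)" .
qed

section \<open>Initial segments, permutation matrices and minors of Gram matrices\<close>

lemma bij_betw_rank:
  "bij_betw (\<lambda>j::'n::{finite,linorder}. card {..<j}) UNIV {..<CARD('n)}"
proof -
  let ?r = "\<lambda>j::'n. card {..<j}"
  have less: "?r i < ?r j" if "i < j" for i j
    using that by (intro psubset_card_mono) auto
  have inj: "inj ?r"
    by (rule injI) (metis less less_irrefl linorder_neqE)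
  have "?r ` UNIV \<subseteq> {..<CARD('n)}"
    by (auto intro!: psubset_card_mono)
  moreover have "card (?r ` UNIV) = card {..<CARD('n)}"
    using inj by (simp add: card_image)
  ultimately show ?thesis
    using inj by (simp add: bij_betw_def card_subset_eq)
qed

definition initial_segment :: "nat \<Rightarrow> 'n::{finite,linorder} set" where
  "initial_segment k = {j. card {..<j} < k}"

lemma initial_segment_closed: "i \<in> initial_segment k \<Longrightarrow> j < i \<Longrightarrow> j \<in> initial_segment k"
  unfolding initial_segment_def using card_mono[of "{..<i}" "{..<j}"] by fastforce

lemma card_initial_segment:
  assumes "k \<le> CARD('n)"
  shows "card (initial_segment k :: 'n::{finite,linorder} set) = k"
proof -
  have "bij_betw (\<lambda>j::'n. card {..<j}) (initial_segment k) {..<k}"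
    using bij_betw_rank[where 'n='n] assms
    by (rule_tac bij_betw_subset[of _ UNIV "{..<CARD('n)}"])
      (auto simp: initial_segment_def bij_betw_def image_iff set_eq_iff, metis order_less_le_trans lessThan_iff)
  then show ?thesis by (simp add: bij_betw_same_card)
qed

lemma initial_segment_Suc:
  fixes j :: "'n::{finite,linorder}"
  shows "initial_segment (Suc (card {..<j})) = insert j (initial_segment (card {..<j}))"
    "j \<notin> initial_segment (card {..<j})"
  using bij_betw_rank[where 'n='n]
  by (auto simp: initial_segment_def less_Suc_eq bij_betw_def inj_on_def)

definition permutation_matrix :: "('n \<Rightarrow> 'n) \<Rightarrow> real^'n^'n" where
  "permutation_matrix \<pi> = (\<chi> i j. if i = \<pi> j then 1 else 0)"

lemma mult_permutation_matrix:
  "(A ** permutation_matrix \<pi>) $ i $ j = A $ i $ \<pi> j"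
  by (simp add: permutation_matrix_def matrix_matrix_mult_def if_distrib[of "\<lambda>x. _ * x"] cong: if_cong)

lemma orthogonal_permutation_matrix:
  assumes "\<pi> permutes UNIV"
  shows "orthogonal_matrix (permutation_matrix \<pi>)"
proof -
  have "(transpose (permutation_matrix \<pi>) ** permutation_matrix \<pi>) $ i $ j = (mat 1 :: real^'a^'a) $ i $ j" for i j
    unfolding mult_permutation_matrix using permutes_inj[OF assms]
    by (auto simp: transpose_def permutation_matrix_def mat_def inj_eq)
  then show ?thesis by (simp add: orthogonal_matrix vec_eq_iff)
qed

text \<open>The same permutation acts on rows and columns, so its sign enters twice and
  cancels.\<close>

lemma principal_minor_permute:
  fixes A :: "real^'n^'n"
  assumes "\<pi> permutes UNIV"
  shows "principal_minor (\<chi> i j. A $ \<pi> i $ \<pi> j) T = principal_minor A (\<pi> ` T)"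
proof -
  define M :: "real^'n^'n" where "M = (\<chi> i j. if i \<in> \<pi> ` T then A $ i $ j else if i = j then 1 else 0)"
  have inj: "inj \<pi>" using permutes_inj[OF assms] .
  have "principal_minor (\<chi> i j. A $ \<pi> i $ \<pi> j) T = det (\<chi> i. (\<chi> i j. M $ i $ \<pi> j) $ \<pi> i)"
    unfolding principal_minor_def using inj
    by (intro arg_cong[where f=det]) (auto simp: vec_eq_iff M_def inj_eq inj_image_mem_iff)
  also have "\<dots> = of_int (sign \<pi>) * (of_int (sign \<pi>) * det M)"
    by (simp only: det_permute_rows[OF assms] det_permute_columns[OF assms])
  also have "\<dots> = det M"
    by (simp add: sign_def)
  finally show ?thesis
    by (simp add: principal_minor_def M_def)
qed

text \<open>A permutation that carries the initial segment onto \<open>I\<close> turns the minor for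
  \<open>I\<close> into a leading one, to which \<open>det_gram_initial_segment\<close> applies. It
  is chosen before \<open>A\<close>, so one permutation serves the whole sequence of
  products.\<close>

lemma principal_minor_gram:
  fixes I :: "'n::{finite,linorder} set"
  assumes "k \<le> CARD('n)" "card I = k"
  obtains \<pi> where "\<pi> permutes UNIV"
    "\<And>A. principal_minor (transpose A ** A) I =
      (\<Prod>j\<in>initial_segment k. (norm (gram_schmidt_column (A ** permutation_matrix \<pi>) j))\<^sup>2)"
proof -
  let ?T = "initial_segment k :: 'n set"
  have card_T: "card ?T = card I"
    using card_initial_segment[OF assms(1)] assms(2) by simp
  then obtain f where f: "bij_betw f ?T I"
    by (meson finite finite_same_card_bij)
  have "card (- ?T) = card (- I)"
    using card_T by (simp add: Compl_eq_Diff_UNIV card_Diff_subset)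
  then obtain g where g: "bij_betw g (- ?T) (- I)"
    by (meson finite finite_same_card_bij)
  define \<pi> where "\<pi> x = (if x \<in> ?T then f x else g x)" for x
  have "bij_betw \<pi> ?T I" "bij_betw \<pi> (- ?T) (- I)"
    using f g bij_betw_cong[of ?T \<pi> f I] bij_betw_cong[of "- ?T" \<pi> g "- I"] by (auto simp: \<pi>_def)
  then have "bij_betw \<pi> (?T \<union> - ?T) (I \<union> - I)"
    by (rule bij_betw_combine) auto
  then have perm: "\<pi> permutes UNIV"
    by (intro bij_imp_permutes) (simp_all add: Compl_partition)
  have image: "\<pi> ` ?T = I"
    using f by (simp add: \<pi>_def bij_betw_def)
  have "principal_minor (transpose A ** A) I =
      (\<Prod>j\<in>?T. (norm (gram_schmidt_column (A ** permutation_matrix \<pi>) j))\<^sup>2)" for A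
  proof -
    let ?C = "A ** permutation_matrix \<pi>"
    have gram: "transpose ?C ** ?C = (\<chi> i j. (transpose A ** A) $ \<pi> i $ \<pi> j)"
    proof -
      have "(transpose B ** B) $ i $ j = (\<Sum>l\<in>UNIV. B $ l $ i * B $ l $ j)"
        for B :: "real^'n::{finite,linorder}^'n::{finite,linorder}" and i j
        by (simp add: matrix_matrix_mult_def transpose_def)
      then show ?thesis by (simp add: vec_eq_iff mult_permutation_matrix)
    qed
    have "principal_minor (transpose A ** A) I = principal_minor (transpose ?C ** ?C) ?T"
      unfolding gram principal_minor_permute[OF perm] image ..
    also have "\<dots> = (\<Prod>j\<in>?T. (norm (gram_schmidt_column ?C j))\<^sup>2)"
      unfolding principal_minor_def
      by (rule det_gram_initial_segment) (rule initial_segment_closed)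
    finally show ?thesis .
  qed
  then show ?thesis using that perm by blast
qed

section \<open>Logarithmic moments\<close>

text \<open>
  The value at \<open>0\<close> is \<open>\<infinity>\<close>, so a finite integral of \<open>inv_sqrt_abs \<circ> f\<close> also shows that \<open>f\<close>
  vanishes almost nowhere.
\<close>

definition inv_sqrt_abs :: "real \<Rightarrow> ennreal" where
  "inv_sqrt_abs t = inverse (ennreal (sqrt \<bar>t\<bar>))"

lemma borel_measurable_inv_sqrt_abs [measurable]: "inv_sqrt_abs \<in> borel_measurable borel"
  unfolding inv_sqrt_abs_def by measurable

lemma inv_sqrt_abs_0 [simp]: "inv_sqrt_abs 0 = \<infinity>"
  by (simp add: inv_sqrt_abs_def)

lemma inv_sqrt_abs_eq: "t \<noteq> 0 \<Longrightarrow> inv_sqrt_abs t = ennreal (inverse (sqrt \<bar>t\<bar>))"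
  by (simp add: inv_sqrt_abs_def inverse_ennreal)

lemma inv_sqrt_abs_1 [simp]: "inv_sqrt_abs 1 = 1"
  by (simp add: inv_sqrt_abs_eq)

lemma inv_sqrt_abs_pos: "0 < inv_sqrt_abs t"
  by (cases "t = 0") (auto simp: inv_sqrt_abs_eq)

lemma inv_sqrt_abs_mult: "inv_sqrt_abs (s * t) = inv_sqrt_abs s * inv_sqrt_abs t"
proof (cases "s = 0 \<or> t = 0")
  case True
  then show ?thesis using inv_sqrt_abs_pos[of s] inv_sqrt_abs_pos[of t]
    by (auto simp: ennreal_top_mult ennreal_mult_top)
next
  case False
  then show ?thesis
    by (simp add: inv_sqrt_abs_eq abs_mult real_sqrt_mult flip: ennreal_mult)
qed

lemma nn_integral_inv_sqrt_abs_Icc: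
  "(\<integral>\<^sup>+t. inv_sqrt_abs t * indicator {-1..1} t \<partial>lborel) \<le> 4"
proof -
  have pos: "(\<integral>\<^sup>+t. inv_sqrt_abs t * indicator {0..1} t \<partial>lborel) = 2"
  proof -
    have "((\<lambda>x::real. x powr (- 1/2)) has_integral 2) {0..1}"
      using has_integral_powr_from_0[of "- 1/2" 1] by simp
    then have I: "((\<lambda>x::real. x powr (- 1/2) * indicator {0..1} x) has_integral 2) UNIV"
      by (subst (asm) has_integral_restrict_UNIV[symmetric])
        (auto elim!: has_integral_eq[rotated] simp: indicator_def)
    have "(\<integral>\<^sup>+t. inv_sqrt_abs t * indicator {0..1} t \<partial>lborel)
        = (\<integral>\<^sup>+x. ennreal (x powr (- 1/2) * indicator {0..1} x) \<partial>lborel)"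
    proof (rule nn_integral_cong_AE)
      show "AE x in lborel. inv_sqrt_abs x * indicator {0..1} x = ennreal (x powr (- 1/2) * indicator {0..1} x)"
        using AE_lborel_singleton[of 0]
        by eventually_elim (auto simp: inv_sqrt_abs_eq indicator_def powr_minus powr_half_sqrt)
    qed
    also have "\<dots> = 2"
      by (subst nn_integral_has_integral_lborel[OF _ _ I]) auto
    finally show ?thesis .
  qed
  have neg: "(\<integral>\<^sup>+t. inv_sqrt_abs t * indicator {-1..0} t \<partial>lborel) = 2"
  proof -
    have "(\<integral>\<^sup>+t. inv_sqrt_abs t * indicator {-1..0} t \<partial>lborel)
        = (\<integral>\<^sup>+t. inv_sqrt_abs (- t) * indicator {-1..0} (- t) \<partial>lborel)"
      by (subst lborel_distr_uminus[symmetric]) (simp add: nn_integral_distr)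
    also have "\<dots> = (\<integral>\<^sup>+t. inv_sqrt_abs t * indicator {0..1} t \<partial>lborel)"
      by (intro nn_integral_cong) (auto simp: inv_sqrt_abs_def indicator_def)
    finally show ?thesis by (simp add: pos)
  qed
  have "(\<integral>\<^sup>+t. inv_sqrt_abs t * indicator {-1..1} t \<partial>lborel)
      \<le> (\<integral>\<^sup>+t. inv_sqrt_abs t * indicator {-1..0} t + inv_sqrt_abs t * indicator {0..1} t \<partial>lborel)"
    by (intro nn_integral_mono) (auto simp: indicator_def)
  also have "\<dots> = 4"
    by (subst nn_integral_add) (auto simp: pos neg)
  finally show ?thesis .
qed

lemma std_normal_density_le_1: "std_normal_density x \<le> 1"
proof -
  have "1 * 1 \<le> sqrt (2 * pi)"
    using pi_ge_two by (simp add: real_le_rsqrt)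
  then have "1 / sqrt (2 * pi) \<le> 1" by simp
  moreover have "exp (- x\<^sup>2 / 2) \<le> 1" by simp
  ultimately show ?thesis
    unfolding std_normal_density_def by (intro mult_le_one) auto
qed

text \<open>The 5 is 1 for the region where \<open>y + c\<close> lies outside
  \<open>[-1, 1]\<close>, plus 4 for the integral of \<open>|t|^(-1/2)\<close> over
  \<open>[-1, 1]\<close>, the density being at most 1. The bound is uniform in \<open>c\<close>, so
  the other matrix entries can be held fixed while one entry is integrated.\<close>

lemma nn_integral_inv_sqrt_abs_shift:
  "(\<integral>\<^sup>+y. inv_sqrt_abs (y + c) \<partial>std_normal_distribution) \<le> 5"
proof -
  interpret N: prob_space std_normal_distribution
    by (rule prob_space_normal_density) simp
  have "(\<integral>\<^sup>+y. inv_sqrt_abs (y + c) \<partial>std_normal_distribution)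
      \<le> (\<integral>\<^sup>+y. 1 + inv_sqrt_abs (y + c) * indicator {-1..1} (y + c) \<partial>std_normal_distribution)"
  proof (intro nn_integral_mono)
    fix y
    show "inv_sqrt_abs (y + c) \<le> 1 + inv_sqrt_abs (y + c) * indicator {-1..1} (y + c)"
    proof (cases "y + c \<in> {-1..1}")
      case False
      then have "1 \<le> sqrt \<bar>y + c\<bar>" by (auto simp: real_le_rsqrt)
      then have "inv_sqrt_abs (y + c) \<le> ennreal 1"
        using False by (subst inv_sqrt_abs_eq) (auto simp: inverse_le_1_iff intro!: ennreal_leI)
      then show ?thesis using False by simp
    qed (simp add: indicator_def add_increasing)
  qed
  also have "\<dots> = 1 + (\<integral>\<^sup>+y. inv_sqrt_abs (y + c) * indicator {-1..1} (y + c) \<partial>std_normal_distribution)"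
    using N.emeasure_space_1 by (subst nn_integral_add) auto
  also have "(\<integral>\<^sup>+y. inv_sqrt_abs (y + c) * indicator {-1..1} (y + c) \<partial>std_normal_distribution)
      = (\<integral>\<^sup>+y. ennreal (std_normal_density y) * (inv_sqrt_abs (y + c) * indicator {-1..1} (y + c)) \<partial>lborel)"
    by (subst nn_integral_density) auto
  also have "\<dots> \<le> (\<integral>\<^sup>+y. 1 * (inv_sqrt_abs (y + c) * indicator {-1..1} (y + c)) \<partial>lborel)"
    using std_normal_density_le_1 by (intro nn_integral_mono mult_right_mono) (auto simp: ennreal_le_1)
  also have "\<dots> = (\<integral>\<^sup>+y. inv_sqrt_abs y * indicator {-1..1} y \<partial>lborel)"
    using nn_integral_lborel_shift[of "\<lambda>y. inv_sqrt_abs y * indicator {-1..1} y" c] by simp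
  also have "\<dots> \<le> 4" by (rule nn_integral_inv_sqrt_abs_Icc)
  finally show ?thesis by (simp add: add_left_mono)
qed

lemma nn_integral_inv_sqrt_abs_affine:
  "(\<integral>\<^sup>+y. inv_sqrt_abs (b + a * y) \<partial>std_normal_distribution) \<le> 5 * inv_sqrt_abs a"
proof (cases "a = 0")
  \<comment> \<open>Here the right-hand side is infinite, so that a vanishing slope needs no null
    set argument where the bound is applied.\<close>
  case True
  then show ?thesis by (simp add: ennreal_mult_top)
next
  case False
  have "inv_sqrt_abs (b + a * y) = inv_sqrt_abs a * inv_sqrt_abs (y + b / a)" for y
    using False by (simp add: distrib_left add.commute flip: inv_sqrt_abs_mult)
  then have "(\<integral>\<^sup>+y. inv_sqrt_abs (b + a * y) \<partial>std_normal_distribution)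
      = inv_sqrt_abs a * (\<integral>\<^sup>+y. inv_sqrt_abs (y + b / a) \<partial>std_normal_distribution)"
    by (simp add: nn_integral_cmult)
  also have "\<dots> \<le> inv_sqrt_abs a * 5"
    by (intro mult_left_mono nn_integral_inv_sqrt_abs_shift) simp
  finally show ?thesis by (simp add: mult.commute)
qed

text \<open>
  The rows of \<open>I + \<epsilon> X\<close> in \<open>S\<close> are replaced by unit vectors. The determinant is affine in the
  diagonal entry \<open>X\<^sub>i\<^sub>i\<close>, \<open>i \<notin> S\<close>, with the determinant for \<open>insert i S\<close> as slope, so that the diagonal
  entries can be integrated out one at a time.
\<close>

definition diag_replaced :: "real \<Rightarrow> 'n set \<Rightarrow> ('n \<times> 'n \<Rightarrow> real) \<Rightarrow> real^'n^'n" where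
  "diag_replaced \<epsilon> S x =
    (\<chi> i. if i \<in> S then axis i 1 else axis i 1 + \<epsilon> *\<^sub>R (\<chi> j. x (i, j)))"

lemma det_diag_replaced_affine:
  assumes "i \<notin> S"
  shows "det (diag_replaced \<epsilon> S (x((i, i) := y))) =
    det (diag_replaced \<epsilon> S (x((i, i) := 0))) + \<epsilon> * det (diag_replaced \<epsilon> (insert i S) x) * y"
proof -
  let ?c = "\<lambda>k. diag_replaced \<epsilon> S x $ k"
  have "diag_replaced \<epsilon> S (x((i, i) := y)) =
      (\<chi> k. if k = i then diag_replaced \<epsilon> S (x((i, i) := 0)) $ i + (\<epsilon> * y) *s axis i 1 else ?c k)"
    using assms by (auto simp: diag_replaced_def vec_eq_iff axis_def)
  then have "det (diag_replaced \<epsilon> S (x((i, i) := y))) =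
      det (\<chi> k. if k = i then diag_replaced \<epsilon> S (x((i, i) := 0)) $ i else ?c k) +
      (\<epsilon> * y) * det (\<chi> k. if k = i then axis i 1 else ?c k)"
    by (simp only: det_row_add[where a="\<lambda>_. diag_replaced \<epsilon> S (x((i, i) := 0)) $ i" and b="\<lambda>_. (\<epsilon> * y) *s axis i 1"]
        det_row_mul[where a="\<lambda>_. axis i 1"])
  also have "(\<chi> k. if k = i then diag_replaced \<epsilon> S (x((i, i) := 0)) $ i else ?c k) = diag_replaced \<epsilon> S (x((i, i) := 0))"
    by (auto simp: diag_replaced_def vec_eq_iff)
  also have "(\<chi> k. if k = i then axis i 1 else ?c k) = diag_replaced \<epsilon> (insert i S) x"
    by (auto simp: diag_replaced_def vec_eq_iff)
  finally show ?thesis by (simp only: ac_simps)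
qed

lemma diag_replaced_update: "i \<in> S \<Longrightarrow> diag_replaced \<epsilon> S (x((i, i) := y)) = diag_replaced \<epsilon> S x"
  by (auto simp: diag_replaced_def vec_eq_iff)

lemma measurable_det [measurable (raw)]:
  fixes f :: "'a \<Rightarrow> real^'n^'n"
  assumes [measurable]: "f \<in> borel_measurable M"
  shows "(\<lambda>x. det (f x)) \<in> borel_measurable M"
  unfolding det_def by measurable

lemma measurable_det_diag_replaced [measurable]:
  "(\<lambda>x. det (diag_replaced \<epsilon> S x)) \<in> borel_measurable (PiM UNIV (\<lambda>_::'n::finite \<times> 'n. std_normal_distribution))"
  unfolding diag_replaced_def by measurable

lemma nn_integral_inv_sqrt_det_diag_replaced:
  fixes S :: "'n::finite set"
  shows "(\<integral>\<^sup>+x. inv_sqrt_abs (det (diag_replaced \<epsilon> S x)) \<partial>PiM UNIV (\<lambda>_::'n \<times> 'n. std_normal_distribution))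
    \<le> (5 * inv_sqrt_abs \<epsilon>) ^ card (- S)"
proof -
  let ?P = "PiM (UNIV :: ('n \<times> 'n) set) (\<lambda>_. std_normal_distribution)"
  let ?I = "\<lambda>S. \<integral>\<^sup>+x. inv_sqrt_abs (det (diag_replaced \<epsilon> S x)) \<partial>?P"
  interpret N: prob_space std_normal_distribution
    by (rule prob_space_normal_density) simp
  interpret product_prob_space "\<lambda>_::'n \<times> 'n. std_normal_distribution" UNIV
    by standard
  have step: "?I S \<le> 5 * inv_sqrt_abs \<epsilon> * ?I (insert i S)" if "i \<notin> S" for i S
  proof -
    let ?J = "UNIV - {(i, i)}"
    let ?PJ = "PiM ?J (\<lambda>_::'n \<times> 'n. std_normal_distribution)"
    have U: "insert (i, i) ?J = UNIV" by auto
    have fold: "integral\<^sup>N ?P f = (\<integral>\<^sup>+x. (\<integral>\<^sup>+y. f (x((i, i) := y)) \<partial>std_normal_distribution) \<partial>?PJ)"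
      if "f \<in> borel_measurable ?P" for f
      using product_nn_integral_insert[of ?J "(i, i)" f, unfolded U] that by simp
    have "?I S = (\<integral>\<^sup>+x. (\<integral>\<^sup>+y. inv_sqrt_abs (det (diag_replaced \<epsilon> S (x((i, i) := y)))) \<partial>std_normal_distribution) \<partial>?PJ)"
      by (rule fold) measurable
    also have "\<dots> \<le> (\<integral>\<^sup>+x. 5 * inv_sqrt_abs (\<epsilon> * det (diag_replaced \<epsilon> (insert i S) x)) \<partial>?PJ)"
    proof (intro nn_integral_mono)
      fix x :: "'n \<times> 'n \<Rightarrow> real"
      have "(\<lambda>y. inv_sqrt_abs (det (diag_replaced \<epsilon> S (x((i, i) := y))))) =
          (\<lambda>y. inv_sqrt_abs (det (diag_replaced \<epsilon> S (x((i, i) := 0))) + \<epsilon> * det (diag_replaced \<epsilon> (insert i S) x) * y))"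
        by (rule ext, subst det_diag_replaced_affine[OF \<open>i \<notin> S\<close>], rule refl)
      then show "(\<integral>\<^sup>+y. inv_sqrt_abs (det (diag_replaced \<epsilon> S (x((i, i) := y)))) \<partial>std_normal_distribution)
          \<le> 5 * inv_sqrt_abs (\<epsilon> * det (diag_replaced \<epsilon> (insert i S) x))"
        by (simp only: nn_integral_inv_sqrt_abs_affine)
    qed
    \<comment> \<open>Row \<open>i\<close> is now a unit vector, so the integrand does not depend on
      the entry \<open>(i, i)\<close>. Integrating over that entry as well changes nothing and
      restores the full product space for the next step.\<close>
    also have "\<dots> = (\<integral>\<^sup>+x. (\<integral>\<^sup>+y. 5 * inv_sqrt_abs (\<epsilon> * det (diag_replaced \<epsilon> (insert i S) (x((i, i) := y)))) \<partial>std_normal_distribution) \<partial>?PJ)"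
      using N.emeasure_space_1 by (simp add: diag_replaced_update)
    also have "\<dots> = (\<integral>\<^sup>+x. 5 * inv_sqrt_abs (\<epsilon> * det (diag_replaced \<epsilon> (insert i S) x)) \<partial>?P)"
      by (rule fold[symmetric]) measurable
    also have "\<dots> = 5 * inv_sqrt_abs \<epsilon> * ?I (insert i S)"
      by (simp add: inv_sqrt_abs_mult nn_integral_cmult mult.assoc flip: nn_integral_cmult)
    finally show ?thesis .
  qed
  show ?thesis
  proof (induction "card (- S)" arbitrary: S)
    case 0
    then have "S = UNIV" by auto
    have "diag_replaced \<epsilon> UNIV x = mat 1" for x :: "'n \<times> 'n \<Rightarrow> real"
      by (simp add: diag_replaced_def vec_eq_iff mat_def axis_def)
    then show ?case
      by (simp add: \<open>S = UNIV\<close> P.emeasure_space_1)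
  next
    case (Suc n)
    then obtain i where i: "i \<in> - S"
      by (metis card.empty ex_in_conv nat.distinct(1))
    then have n: "n = card (- insert i S)"
      using Suc.hyps(2) by (simp add: Compl_insert card_Diff_singleton)
    have "?I S \<le> 5 * inv_sqrt_abs \<epsilon> * ?I (insert i S)"
      using step i by simp
    also have "\<dots> \<le> 5 * inv_sqrt_abs \<epsilon> * (5 * inv_sqrt_abs \<epsilon>) ^ n"
      using Suc.hyps(1)[OF n] n by (intro mult_left_mono) auto
    finally show ?case
      by (simp flip: Suc.hyps(2))
  qed
qed

section \<open>Moments and invertibility for the Gaussian matrix\<close>

lemma sets_gaussian_matrix [measurable_cong, simp]: "sets gaussian_matrix = sets borel"
  and space_gaussian_matrix [simp]: "space gaussian_matrix = UNIV"
  by (simp_all add: gaussian_matrix_def)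

lemma prob_space_gaussian_matrix: "prob_space (gaussian_matrix :: (real^'n^'n) measure)"
proof -
  interpret product_prob_space "\<lambda>_::'n \<times> 'n. std_normal_distribution" UNIV
    by (intro product_prob_spaceI prob_space_normal_density) simp
  show ?thesis
    unfolding gaussian_matrix_def by (rule P.prob_space_distr) measurable
qed

lemma nn_integral_inv_sqrt_det_gaussian:
  "(\<integral>\<^sup>+X. inv_sqrt_abs (det (mat 1 + \<epsilon> *\<^sub>R X)) \<partial>(gaussian_matrix :: (real^'n^'n) measure)) < \<infinity>"
\<comment> \<open>For \<open>\<epsilon> = 0\<close> the general bound is infinite, as
  \<open>inv_sqrt_abs 0\<close> is, but then the determinant is constantly 1.\<close>
proof (cases "\<epsilon> = 0")
  case True
  interpret prob_space "gaussian_matrix :: (real^'n^'n) measure"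
    by (rule prob_space_gaussian_matrix)
  show ?thesis using True emeasure_space_1 by simp
next
  case False
  have "(\<integral>\<^sup>+X. inv_sqrt_abs (det (mat 1 + \<epsilon> *\<^sub>R X)) \<partial>(gaussian_matrix :: (real^'n^'n) measure))
      = (\<integral>\<^sup>+x. inv_sqrt_abs (det (diag_replaced \<epsilon> {} x)) \<partial>PiM UNIV (\<lambda>_::'n \<times> 'n. std_normal_distribution))"
    unfolding gaussian_matrix_def
    by (subst nn_integral_distr)
      (auto intro!: nn_integral_cong arg_cong[where f="\<lambda>A. inv_sqrt_abs (det A)"]
        simp: diag_replaced_def vec_eq_iff mat_def axis_def)
  also have "\<dots> \<le> (5 * inv_sqrt_abs \<epsilon>) ^ card (- {} :: 'n set)"
    by (rule nn_integral_inv_sqrt_det_diag_replaced)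
  also have "\<dots> < \<infinity>"
    using False by (simp add: inv_sqrt_abs_eq  ennreal_mult_less_top power_less_top_ennreal)
  finally show ?thesis .
qed

lemma AE_gaussian_det_nonzero:
  "AE X in (gaussian_matrix :: (real^'n^'n) measure). det (mat 1 + \<epsilon> *\<^sub>R X) \<noteq> 0"
proof -
  have "AE X in (gaussian_matrix :: (real^'n^'n) measure). inv_sqrt_abs (det (mat 1 + \<epsilon> *\<^sub>R X)) \<noteq> \<infinity>"
    using nn_integral_inv_sqrt_det_gaussian[where 'n='n and \<epsilon>=\<epsilon>]
    by (intro nn_integral_PInf_AE) auto
  then show ?thesis
    by eventually_elim auto
qed

lemma integrable_norm_gaussian:
  "integrable (gaussian_matrix :: (real^'n^'n) measure) norm"
proof -
  let ?P = "PiM (UNIV :: ('n \<times> 'n) set) (\<lambda>_. std_normal_distribution)"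
  have int: "integrable std_normal_distribution (\<lambda>x. x)"
    using integrable_std_normal_moment[of 1] by (subst integrable_real_density) auto
  have coord: "integrable ?P (\<lambda>x. x p)" for p
  proof (rule integrable_distr)
    have "distr ?P std_normal_distribution (\<lambda>x. x p) = std_normal_distribution"
      by (rule distr_PiM_component) (simp_all add: prob_space_normal_density)
    then show "integrable (distr ?P std_normal_distribution (\<lambda>x. x p)) (\<lambda>x. x)"
      using int by (simp only:)
  qed measurable
  have bound: "integrable ?P (\<lambda>x. \<Sum>i\<in>UNIV. \<Sum>j\<in>UNIV. \<bar>x (i, j)\<bar>)"
    using coord by (intro Bochner_Integration.integrable_sum integrable_abs) auto
  have "integrable ?P (\<lambda>x. norm (\<chi> i j. x (i, j) :: real^'n^'n))"
  proof (rule Bochner_Integration.integrable_bound[OF bound])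
    show "AE x in ?P. norm (norm (\<chi> i j. x (i, j) :: real^'n^'n)) \<le> norm (\<Sum>i\<in>UNIV. \<Sum>j\<in>UNIV. \<bar>x (i, j)\<bar>)"
    proof (intro AE_I2)
      fix x :: "'n \<times> 'n \<Rightarrow> real"
      have "norm (\<chi> i j. x (i, j) :: real^'n^'n) \<le> (\<Sum>i\<in>UNIV. norm (\<chi> j. x (i, j) :: real^'n))"
        unfolding norm_vec_def[of "\<chi> i j. x (i, j)"] by (intro order_trans[OF L2_set_le_sum]) auto
      also have "\<dots> \<le> (\<Sum>i\<in>UNIV. \<Sum>j\<in>UNIV. \<bar>x (i, j)\<bar>)"
        unfolding norm_vec_def by (intro sum_mono order_trans[OF L2_set_le_sum]) auto
      finally show "norm (norm (\<chi> i j. x (i, j) :: real^'n^'n)) \<le> norm (\<Sum>i\<in>UNIV. \<Sum>j\<in>UNIV. \<bar>x (i, j)\<bar>)"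
        by (simp add: sum_nonneg)
    qed
  qed measurable
  then show ?thesis
    unfolding gaussian_matrix_def by (subst integrable_distr_eq) auto
qed

lemma integrable_inverse_sqrt_det_gaussian:
  "integrable (gaussian_matrix :: (real^'n^'n) measure) (\<lambda>X. inverse (sqrt \<bar>det (mat 1 + \<epsilon> *\<^sub>R X)\<bar>))"
proof (rule integrableI_bounded)
  show "(\<lambda>X. inverse (sqrt \<bar>det (mat 1 + \<epsilon> *\<^sub>R X)\<bar>)) \<in> borel_measurable (gaussian_matrix :: (real^'n^'n) measure)"
    by measurable
  have "(\<integral>\<^sup>+X. ennreal (norm (inverse (sqrt \<bar>det (mat 1 + \<epsilon> *\<^sub>R X)\<bar>))) \<partial>(gaussian_matrix :: (real^'n^'n) measure))
      \<le> (\<integral>\<^sup>+X. inv_sqrt_abs (det (mat 1 + \<epsilon> *\<^sub>R X)) \<partial>(gaussian_matrix :: (real^'n^'n) measure))"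
  proof (intro nn_integral_mono)
    fix X :: "real^'n^'n"
    show "ennreal (norm (inverse (sqrt \<bar>det (mat 1 + \<epsilon> *\<^sub>R X)\<bar>))) \<le> inv_sqrt_abs (det (mat 1 + \<epsilon> *\<^sub>R X))"
      by (cases "det (mat 1 + \<epsilon> *\<^sub>R X) = 0") (auto simp: inv_sqrt_abs_eq)
  qed
  then show "(\<integral>\<^sup>+X. ennreal (norm (inverse (sqrt \<bar>det (mat 1 + \<epsilon> *\<^sub>R X)\<bar>))) \<partial>(gaussian_matrix :: (real^'n^'n) measure)) < \<infinity>"
    using nn_integral_inv_sqrt_det_gaussian[where 'n='n and \<epsilon>=\<epsilon>] by (rule order_le_less_trans)
qed

text \<open>\<open>256 = 4 ^ 4\<close>, from \<open>(1 + v / 4) ^ 4 \<le> exp v\<close>.\<close>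

lemma power4_le_exp:
  assumes "0 \<le> (v::real)"
  shows "v ^ 4 \<le> 256 * exp v"
proof -
  have "(v / 4) ^ 4 \<le> (1 + v / real 4) ^ 4"
    using assms by (intro power_mono) auto
  also have "\<dots> \<le> exp v"
    by (rule exp_ge_one_plus_x_over_n_power_n) (use assms in auto)
  finally show ?thesis by (simp add: power_divide)
qed

lemma power4_add_le: "((a::real) + b) ^ 4 \<le> 8 * (a ^ 4 + b ^ 4)"
proof -
  have sq: "(x + y)\<^sup>2 \<le> 2 * (x\<^sup>2 + y\<^sup>2)" for x y :: real
    using sum_squares_bound[of x y] by (simp add: power2_sum)
  have "(a + b) ^ 4 = ((a + b)\<^sup>2)\<^sup>2" by simp
  also have "\<dots> \<le> (2 * (a\<^sup>2 + b\<^sup>2))\<^sup>2"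
    using sq by (intro power_mono) auto
  also have "\<dots> = 4 * (a\<^sup>2 + b\<^sup>2)\<^sup>2"
    by (simp only: power_mult_distrib) simp
  also have "\<dots> \<le> 4 * (2 * ((a\<^sup>2)\<^sup>2 + (b\<^sup>2)\<^sup>2))"
    using sq[of "a\<^sup>2" "b\<^sup>2"] by (intro mult_left_mono) auto
  finally show ?thesis by simp
qed

text \<open>In the application \<open>m\<close> is one Gram-Schmidt norm, \<open>D\<close> the
  modulus of the determinant and \<open>H\<close> a bound for all the norms; the upper bound for
  \<open>D\<close> keeps \<open>m\<close> away from 0. Thus \<open>ln m\<close> has modulus at most
  \<open>a + b\<close>. The moment available is that of the inverse square root of \<open>D\<close>,
  whence \<open>b / 2\<close> in the exponential and \<open>4096 = 2 ^ 4 * 256\<close>; the 8 comes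
  from \<open>power4_add_le\<close>.\<close>

lemma ln_power4_bound:
  assumes "0 < D" "1 \<le> H" "0 < m" "m \<le> H" "D \<le> m * H ^ n" "1 \<le> n"
  shows "(ln m) ^ 4 \<le> 8 * (256 * real n ^ 4 * H + 4096 * (1 + inverse (sqrt D)))"
proof -
  define a b where "a = real n * ln H" and "b = max 0 (- ln D)"
  have "ln m \<le> ln H" using assms by simp
  also have "\<dots> \<le> a"
    using assms mult_right_mono[of 1 "real n" "ln H"] by (simp add: a_def)
  finally have up: "ln m \<le> a" .
  have "ln D \<le> ln (m * H ^ n)"
    using assms by simp
  also have "\<dots> = ln m + a"
    using assms by (simp add: ln_mult ln_realpow a_def)
  finally have "- ln m \<le> a + b"
    by (simp add: b_def)
  with up have "\<bar>ln m\<bar> \<le> a + b" by (simp add: b_def)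
  then have "\<bar>ln m\<bar> ^ 4 \<le> (a + b) ^ 4" by (intro power_mono) auto
  then have "(ln m) ^ 4 \<le> (a + b) ^ 4" by simp
  also have "\<dots> \<le> 8 * (a ^ 4 + b ^ 4)" by (rule power4_add_le)
  also have "a ^ 4 \<le> 256 * real n ^ 4 * H"
    using mult_left_mono[OF power4_le_exp[of "ln H"], of "real n ^ 4"] assms(2)
    by (simp add: a_def power_mult_distrib ac_simps)
  also have "b ^ 4 \<le> 4096 * (1 + inverse (sqrt D))"
  proof -
    have "b ^ 4 = 16 * (b / 2) ^ 4" by (simp add: power_divide)
    also have "\<dots> \<le> 4096 * exp (b / 2)"
      using power4_le_exp[of "b / 2"] by (simp add: b_def)
    also have "exp (b / 2) \<le> 1 + inverse (sqrt D)"
    proof (cases "ln D \<ge> 0")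
      case True
      then show ?thesis using assms(1) by (simp add: b_def)
    next
      case False
      then have "b = - ln D" by (simp add: b_def)
      then have "exp (b / 2) = inverse (exp (ln (sqrt D)))"
        using assms(1) by (simp add: ln_sqrt exp_minus)
      then show ?thesis using assms(1) by simp
    qed
    finally show ?thesis by simp
  qed
  finally show ?thesis by simp
qed

lemma norm_column_le: "norm (column j (A :: real^'n^'m)) \<le> norm A"
proof -
  have "norm (column j A) = L2_set (\<lambda>i. \<bar>A $ i $ j\<bar>) UNIV"
    by (simp add: norm_vec_def column_def)
  also have "\<dots> \<le> L2_set (\<lambda>i. norm (A $ i)) UNIV"
    by (intro L2_set_mono) (auto simp: component_le_norm_cart)
  finally show ?thesis by (simp add: norm_vec_def)
qed

lemma measurable_gram_schmidt_column [measurable (raw)]: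
  fixes f :: "'a \<Rightarrow> real^'n::{finite,linorder}^'n::{finite,linorder}"
  assumes [measurable]: "f \<in> borel_measurable M"
  shows "(\<lambda>x. gs (f x) k) \<in> borel_measurable M"
proof (induction k rule: finite_linorder_induct)
  case (less k)
  have [measurable]: "(\<lambda>x. column k (f x)) \<in> borel_measurable M"
    unfolding column_def by measurable
  have "(\<lambda>x. ((gs (f x) j \<bullet> column k (f x)) / (gs (f x) j \<bullet> gs (f x) j)) *\<^sub>R gs (f x) j) \<in> borel_measurable M"
    if "j < k" for j
  proof -
    note less[OF that, measurable]
    show ?thesis by measurable
  qed
  then show ?case
    by (subst gram_schmidt_column.simps) (auto intro!: borel_measurable_diff borel_measurable_sum)
qed

text \<open>The pointwise bound is linear in \<open>norm X\<close> and in the inverse square root of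
  the determinant, both integrable. The fourth moment is what the strong law below requires.\<close>

lemma integrable_ln_gram_schmidt_power4:
  fixes j :: "'n::{finite,linorder}"
  shows "integrable (gaussian_matrix :: (real^'n::{finite,linorder}^'n::{finite,linorder}) measure) (\<lambda>X. (ln (norm (gs (mat 1 + \<epsilon> *\<^sub>R X) j))) ^ 4)"
proof -
  let ?\<nu> = "gaussian_matrix :: (real^'n::{finite,linorder}^'n::{finite,linorder}) measure"
  interpret \<nu>: prob_space ?\<nu> by (rule prob_space_gaussian_matrix)
  let ?D = "\<lambda>X::real^'n::{finite,linorder}^'n::{finite,linorder}. \<bar>det (mat 1 + \<epsilon> *\<^sub>R X)\<bar>"
  let ?H = "\<lambda>X::real^'n::{finite,linorder}^'n::{finite,linorder}. 1 + \<bar>\<epsilon>\<bar> * norm X"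
  have bound: "integrable ?\<nu> (\<lambda>X. 8 * (256 * real CARD('n) ^ 4 * ?H X + 4096 * (1 + inverse (sqrt (?D X)))))"
    using integrable_norm_gaussian integrable_inverse_sqrt_det_gaussian[where \<epsilon>=\<epsilon>]
    by (intro integrable_mult_right Bochner_Integration.integrable_add) auto
  show ?thesis
  proof (rule Bochner_Integration.integrable_bound[OF bound])
    show "AE X in ?\<nu>. norm ((ln (norm (gs (mat 1 + \<epsilon> *\<^sub>R X) j))) ^ 4)
        \<le> norm (8 * (256 * real CARD('n) ^ 4 * ?H X + 4096 * (1 + inverse (sqrt (?D X)))))"
      using AE_gaussian_det_nonzero[where \<epsilon>=\<epsilon>]
    proof eventually_elim
      case (elim X)
      let ?A = "mat 1 + \<epsilon> *\<^sub>R X"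
      let ?m = "\<lambda>i. norm (gs ?A i)"
      have m_pos: "?m i > 0" for i
        using elim gram_schmidt_nonzero_iff_det[of ?A] by simp
      have m_le: "?m i \<le> ?H X" for i
      proof -
        have "column i ?A = axis i 1 + \<epsilon> *\<^sub>R column i X"
          by (auto simp: column_def vec_eq_iff mat_def axis_def)
        then have "norm (column i ?A) \<le> 1 + \<bar>\<epsilon>\<bar> * norm (column i X)"
          using norm_triangle_ineq[of "axis i 1" "\<epsilon> *\<^sub>R column i X"] by simp
        also have "\<dots> \<le> ?H X"
          by (simp add: norm_column_le mult_left_mono)
        finally show ?thesis
          using norm_gram_schmidt_le[of ?A i] by simp
      qed
      have "(?D X)\<^sup>2 = (\<Prod>i\<in>UNIV. ?m i)\<^sup>2"
        by (simp add: det_power2_eq_prod_gram_schmidt prod_power_distrib)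
      then have "?D X = (\<Prod>i\<in>UNIV. ?m i)"
        using power2_eq_iff_nonneg[of "?D X" "\<Prod>i\<in>UNIV. ?m i"] by (simp add: prod_nonneg)
      also have "\<dots> = ?m j * (\<Prod>i\<in>UNIV - {j}. ?m i)"
        by (rule prod.remove) auto
      also have "\<dots> \<le> ?m j * (\<Prod>i\<in>UNIV - {j}. ?H X)"
        using m_le by (intro mult_left_mono prod_mono) auto
      \<comment> \<open>There are \<open>CARD('n) - 1\<close> other columns; the larger exponent is
        harmless because the base is at least 1.\<close>
      also have "\<dots> \<le> ?m j * ?H X ^ CARD('n)"
        by (intro mult_left_mono) (auto intro!: power_increasing simp: card_Diff_singleton)
      finally have "(ln (?m j)) ^ 4 \<le> 8 * (256 * real CARD('n) ^ 4 * ?H X + 4096 * (1 + inverse (sqrt (?D X))))"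
        using elim m_pos m_le by (intro ln_power4_bound) (auto simp: Suc_leI)
      then show ?case by simp
    qed
  qed measurable
qed

lemma integrable_power_of_integrable_power4:
  fixes f :: "'a \<Rightarrow> real"
  assumes "prob_space M" and [measurable]: "f \<in> borel_measurable M"
    and "integrable M (\<lambda>x. f x ^ 4)" and "k \<le> 4"
  shows "integrable M (\<lambda>x. f x ^ k)"
proof -
  interpret prob_space M by fact
  have bound: "integrable M (\<lambda>x. 1 + f x ^ 4)"
    using assms(3) by simp
  show ?thesis
  proof (rule Bochner_Integration.integrable_bound[OF bound])
    have "\<bar>t\<bar> ^ k \<le> 1 + t ^ 4" for t :: real
    proof (cases "\<bar>t\<bar> \<le> 1")
      case True
      then have "\<bar>t\<bar> ^ k \<le> 1" by (simp add: power_le_one)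
      then show ?thesis by (simp add: add_increasing2)
    next
      case False
      then have "\<bar>t\<bar> ^ k \<le> \<bar>t\<bar> ^ 4" using assms(4) by (intro power_increasing) auto
      then show ?thesis by simp
    qed
    then show "AE x in M. norm (f x ^ k) \<le> norm (1 + f x ^ 4)"
      by (simp add: power_abs)
  qed measurable
qed

section \<open>The strong law of large numbers\<close>

lemma indep_var_expectation_mult:
  assumes "prob_space M" "prob_space.indep_var M borel X borel Y"
    and [measurable]: "f \<in> borel_measurable borel" "g \<in> borel_measurable borel"
    and "integrable M (\<lambda>\<omega>. f (X \<omega>))" "integrable M (\<lambda>\<omega>. g (Y \<omega>))"
  shows "integrable M (\<lambda>\<omega>. f (X \<omega>) * g (Y \<omega>) :: real)"
    and "(\<integral>\<omega>. f (X \<omega>) * g (Y \<omega>) \<partial>M) = (\<integral>\<omega>. f (X \<omega>) \<partial>M) * (\<integral>\<omega>. g (Y \<omega>) \<partial>M)"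
proof -
  interpret prob_space M by fact
  have "indep_var borel (f \<circ> X) borel (g \<circ> Y)"
    using assms(2) by (rule indep_var_compose) measurable
  then have ind: "indep_var borel (\<lambda>\<omega>. f (X \<omega>)) borel (\<lambda>\<omega>. g (Y \<omega>))"
    by (simp add: comp_def)
  show "integrable M (\<lambda>\<omega>. f (X \<omega>) * g (Y \<omega>))"
    using assms ind by (intro indep_var_integrable)
  show "(\<integral>\<omega>. f (X \<omega>) * g (Y \<omega>) \<partial>M) = (\<integral>\<omega>. f (X \<omega>) \<partial>M) * (\<integral>\<omega>. g (Y \<omega>) \<partial>M)"
    using assms ind by (intro indep_var_lebesgue_integral)
qed

text \<open>
  The fourth moment of \<open>S n\<close> is of order \<open>n\<^sup>2\<close>, so the expectations of \<open>(S n / n) ^ 4\<close> are summable.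
\<close>

lemma (in prob_space) strong_law_fourth_moment:
  fixes X :: "nat \<Rightarrow> 'a \<Rightarrow> real"
  defines "S \<equiv> \<lambda>n \<omega>. \<Sum>i<n. X i \<omega>"
  assumes meas [measurable]: "\<And>n. X n \<in> borel_measurable M"
    and indep: "\<And>n. indep_var borel (S n) borel (X n)"
    and int: "\<And>n. integrable M (\<lambda>\<omega>. X n \<omega> ^ 4)"
    and mean: "\<And>n. expectation (X n) = 0"
    and bound: "\<And>n. expectation (\<lambda>\<omega>. X n \<omega> ^ 4) \<le> C"
  shows "AE \<omega> in M. (\<lambda>n. S n \<omega> / real n) \<longlonglongrightarrow> 0"
proof -
  have [measurable]: "S n \<in> borel_measurable M" for n
    unfolding S_def by measurable
  have intX: "integrable M (\<lambda>\<omega>. X n \<omega> ^ k)" if "k \<le> 4" for n k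
    by (rule integrable_power_of_integrable_power4[OF prob_space_axioms _ int that]) measurable
  have "0 \<le> expectation (\<lambda>\<omega>. X 0 \<omega> ^ 4)" by simp
  with bound[of 0] have "0 \<le> C" by linarith
  \<comment> \<open>\<open>K\<close> bounds the second moments too, because
    \<open>t ^ 2 \<le> 1 + t ^ 4\<close>, and \<open>1 \<le> K\<close> lets the last summand
    \<open>K\<close> be absorbed into \<open>3 * K\<^sup>2\<close> in the induction.\<close>
  define K where "K = 1 + C"
  have "1 \<le> K" using \<open>0 \<le> C\<close> by (simp add: K_def)
  have X2: "expectation (\<lambda>\<omega>. X n \<omega> ^ 2) \<le> K" for n
  proof -
    have "t ^ 2 \<le> 1 + t ^ 4" for t :: real
      using sum_squares_bound[of "t * t" 1] zero_le_square[of t]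
      by (simp only: power2_eq_square power4_eq_xxxx mult.assoc mult_1_right)
    then have "expectation (\<lambda>\<omega>. X n \<omega> ^ 2) \<le> expectation (\<lambda>\<omega>. 1 + X n \<omega> ^ 4)"
      using intX by (intro integral_mono) auto
    also have "\<dots> = 1 + expectation (\<lambda>\<omega>. X n \<omega> ^ 4)"
      using int by (simp add: prob_space)
    finally show ?thesis using bound[of n] by (simp add: K_def)
  qed
  \<comment> \<open>Independence of \<open>S n\<close> and \<open>X n\<close> suffices: in the
    expansion of the fourth power, the terms \<open>S ^ 3 * X\<close> and \<open>S * X ^ 3\<close>
    have expectation 0 because \<open>X n\<close> and \<open>S n\<close> are centred. The remaining
    terms match the increase of \<open>3 * K\<^sup>2 * n\<^sup>2\<close> from \<open>n\<close> to
    \<open>n + 1\<close>.\<close>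
  have moments: "integrable M (\<lambda>\<omega>. S n \<omega> ^ 4) \<and> expectation (S n) = 0 \<and>
      expectation (\<lambda>\<omega>. S n \<omega> ^ 2) \<le> real n * K \<and> expectation (\<lambda>\<omega>. S n \<omega> ^ 4) \<le> 3 * K\<^sup>2 * (real n)\<^sup>2" for n
  proof (induction n)
    case 0
    then show ?case by (simp add: S_def)
  next
    case (Suc n)
    have intS: "integrable M (\<lambda>\<omega>. S n \<omega> ^ k)" if "k \<le> 4" for k
      by (rule integrable_power_of_integrable_power4[OF prob_space_axioms _ _ that]) (use Suc in auto)
    have SX: "integrable M (\<lambda>\<omega>. S n \<omega> ^ k * X n \<omega> ^ l)"
      "expectation (\<lambda>\<omega>. S n \<omega> ^ k * X n \<omega> ^ l) = expectation (\<lambda>\<omega>. S n \<omega> ^ k) * expectation (\<lambda>\<omega>. X n \<omega> ^ l)"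
      if "k \<le> 4" "l \<le> 4" for k l
      using indep_var_expectation_mult[OF prob_space_axioms indep, of "\<lambda>x. x ^ k" "\<lambda>x. x ^ l" n]
        intS[OF that(1)] intX[OF that(2)] by simp_all
    note ints = SX(1)[of 3 1] SX(1)[of 2 2] SX(1)[of 1 3] SX(1)[of 1 1] intS[of 4] intX[of 4 n] intS[of 2] intX[of 2 n] intS[of 1] intX[of 1 n]
    note exps = SX(2)[of 3 1] SX(2)[of 2 2] SX(2)[of 1 3] SX(2)[of 1 1]
    have S_Suc: "S (Suc n) \<omega> = S n \<omega> + X n \<omega>" for \<omega>
      by (simp add: S_def)
    have e4: "S (Suc n) \<omega> ^ 4 = S n \<omega> ^ 4 + (4 * (S n \<omega> ^ 3 * X n \<omega> ^ 1) + (6 * (S n \<omega> ^ 2 * X n \<omega> ^ 2)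
        + (4 * (S n \<omega> ^ 1 * X n \<omega> ^ 3) + X n \<omega> ^ 4)))" for \<omega>
      unfolding S_Suc by (simp add: power2_eq_square power3_eq_cube power4_eq_xxxx algebra_simps)
    have e2: "S (Suc n) \<omega> ^ 2 = S n \<omega> ^ 2 + (2 * (S n \<omega> ^ 1 * X n \<omega> ^ 1) + X n \<omega> ^ 2)" for \<omega>
      unfolding S_Suc by (simp add: power2_eq_square algebra_simps)
    have int4: "integrable M (\<lambda>\<omega>. S (Suc n) \<omega> ^ 4)"
      unfolding e4 using ints by (intro Bochner_Integration.integrable_add integrable_mult_right) auto
    have "expectation (S (Suc n)) = expectation (\<lambda>\<omega>. S n \<omega> + X n \<omega>)"
      by (intro Bochner_Integration.integral_cong) (auto simp: S_Suc)
    also have "\<dots> = 0"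
      using ints Suc mean by simp
    finally have E1: "expectation (S (Suc n)) = 0" .
    have "expectation (\<lambda>\<omega>. S (Suc n) \<omega> ^ 2) = expectation (\<lambda>\<omega>. S n \<omega> ^ 2) + (2 * expectation (\<lambda>\<omega>. S n \<omega> ^ 1 * X n \<omega> ^ 1) + expectation (\<lambda>\<omega>. X n \<omega> ^ 2))"
      unfolding e2 using ints by (subst Bochner_Integration.integral_add; (intro Bochner_Integration.integrable_add integrable_mult_right)?; simp)+
    also have "\<dots> \<le> real (Suc n) * K"
      using Suc mean X2[of n] exps by (simp add: algebra_simps)
    finally have E2: "expectation (\<lambda>\<omega>. S (Suc n) \<omega> ^ 2) \<le> real (Suc n) * K" .
    have "expectation (\<lambda>\<omega>. S (Suc n) \<omega> ^ 4) = expectation (\<lambda>\<omega>. S n \<omega> ^ 4) + (4 * expectation (\<lambda>\<omega>. S n \<omega> ^ 3 * X n \<omega> ^ 1)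
        + (6 * expectation (\<lambda>\<omega>. S n \<omega> ^ 2 * X n \<omega> ^ 2) + (4 * expectation (\<lambda>\<omega>. S n \<omega> ^ 1 * X n \<omega> ^ 3) + expectation (\<lambda>\<omega>. X n \<omega> ^ 4))))"
      unfolding e4 using ints by (subst Bochner_Integration.integral_add; (intro Bochner_Integration.integrable_add integrable_mult_right)?; simp)+
    also have "\<dots> = expectation (\<lambda>\<omega>. S n \<omega> ^ 4) + 6 * (expectation (\<lambda>\<omega>. S n \<omega> ^ 2) * expectation (\<lambda>\<omega>. X n \<omega> ^ 2)) + expectation (\<lambda>\<omega>. X n \<omega> ^ 4)"
      using Suc mean exps by simp
    also have "\<dots> \<le> 3 * K\<^sup>2 * (real n)\<^sup>2 + 6 * (real n * K * K) + K"
      using Suc X2[of n] bound[of n] \<open>1 \<le> K\<close>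
      by (intro add_mono mult_left_mono mult_mono) (auto simp: K_def)
    also have "\<dots> \<le> 3 * K\<^sup>2 * (real (Suc n))\<^sup>2"
      using \<open>1 \<le> K\<close> mult_mono[of 1 K K K] by (simp add: power2_eq_square algebra_simps)
    finally show ?case using int4 E1 E2 by simp
  qed
  have "(\<integral>\<^sup>+\<omega>. (\<Sum>n. ennreal ((S n \<omega> / real n) ^ 4)) \<partial>M) = (\<Sum>n. \<integral>\<^sup>+\<omega>. ennreal ((S n \<omega> / real n) ^ 4) \<partial>M)"
    by (rule nn_integral_suminf) measurable
  also have "\<dots> \<le> (\<Sum>n. ennreal (3 * K\<^sup>2 * (1 / (real n)\<^sup>2)))"
  proof (intro suminf_le allI)
    fix n
    have int_n: "integrable M (\<lambda>\<omega>. (S n \<omega> / real n) ^ 4)"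
      using moments[of n] by (simp add: power_divide)
    have "(\<integral>\<^sup>+\<omega>. ennreal ((S n \<omega> / real n) ^ 4) \<partial>M) = ennreal (expectation (\<lambda>\<omega>. (S n \<omega> / real n) ^ 4))"
      by (rule nn_integral_eq_integral[OF int_n]) simp
    also have "expectation (\<lambda>\<omega>. (S n \<omega> / real n) ^ 4) = expectation (\<lambda>\<omega>. S n \<omega> ^ 4) / (real n) ^ 4"
      by (simp add: power_divide)
    also have "\<dots> \<le> 3 * K\<^sup>2 * (real n)\<^sup>2 / (real n) ^ 4"
      using moments[of n] by (intro divide_right_mono) auto
    also have "\<dots> = 3 * K\<^sup>2 * (1 / (real n)\<^sup>2)"
      by (simp add: power2_eq_square power4_eq_xxxx)
    finally show "(\<integral>\<^sup>+\<omega>. ennreal ((S n \<omega> / real n) ^ 4) \<partial>M) \<le> ennreal (3 * K\<^sup>2 * (1 / (real n)\<^sup>2))"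
      by (simp add: ennreal_leI)
  qed auto
  also have "\<dots> < \<infinity>"
  proof -
    have "summable (\<lambda>n. 3 * K\<^sup>2 * (1 / (real n)\<^sup>2))"
      using inverse_power_summable[of 2, where 'a=real] by (intro summable_mult) (simp add: inverse_eq_divide)
    then show ?thesis
      by (subst suminf_ennreal2) auto
  qed
  finally have "AE \<omega> in M. (\<Sum>n. ennreal ((S n \<omega> / real n) ^ 4)) \<noteq> \<infinity>"
    by (intro nn_integral_PInf_AE) auto
  then show ?thesis
  proof eventually_elim
    case (elim \<omega>)
    then have "summable (\<lambda>n. (S n \<omega> / real n) ^ 4)"
      by (intro summable_suminf_not_top) auto
    then have "(\<lambda>n. (S n \<omega> / real n) ^ 4) \<longlonglongrightarrow> 0"
      by (rule summable_LIMSEQ_zero)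
    then have "(\<lambda>n. root 4 ((S n \<omega> / real n) ^ 4)) \<longlonglongrightarrow> root 4 0"
      by (intro tendsto_real_root)
    moreover have "root 4 (t ^ 4) = \<bar>t\<bar>" for t :: real
      using real_root_power_cancel[of 4 "\<bar>t\<bar>"] by simp
    ultimately have "(\<lambda>n. \<bar>S n \<omega> / real n\<bar>) \<longlonglongrightarrow> 0"
      by (simp only: real_root_zero)
    then show ?case
      by (rule tendsto_rabs_zero_cancel)
  qed
qed

section \<open>The law of the increments\<close>

text \<open>A conditional law that is the same at every point means independence from
  \<open>F\<close>: integrating over a set of \<open>F\<close> replaces the conditional probability
  by the constant \<open>measure \<nu> B\<close>. Rectangles then determine the joint law.\<close>

lemma (in prob_space) has_conditional_law_distr_pair:
  assumes sub: "subalgebra M F" and law: "has_conditional_law M F X \<nu>" and \<nu>: "prob_space \<nu>"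
    and X [measurable]: "X \<in> measurable M \<nu>" and Y: "Y \<in> measurable F K"
  shows "distr M (K \<Otimes>\<^sub>M \<nu>) (\<lambda>\<omega>. (Y \<omega>, X \<omega>)) = distr M K Y \<Otimes>\<^sub>M \<nu>"
proof -
  interpret \<nu>: prob_space \<nu> by fact
  interpret F: sigma_finite_subalgebra M F
    by (intro finite_measure_subalgebra_is_sigma_finite finite_measure_subalgebra.intro
        finite_measure_axioms finite_measure_subalgebra_axioms.intro sub)
  have YM [measurable]: "Y \<in> measurable M K"
    using measurable_from_subalg[OF sub Y] .
  interpret Y: prob_space "distr M K Y"
    by (rule prob_space_distr) fact
  have indep: "prob (A \<inter> (X -` B \<inter> space M)) = prob A * measure \<nu> B"
    if A: "A \<in> sets F" and B [measurable]: "B \<in> sets \<nu>" for A B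
  proof -
    let ?g = "indicator (X -` B \<inter> space M) :: 'a \<Rightarrow> real"
    have AM [measurable]: "A \<in> sets M"
      using A sub by (auto simp: subalgebra_def)
    have int: "integrable M ?g"
      by (intro integrable_real_indicator) (auto simp: emeasure_eq_measure)
    have "prob (A \<inter> (X -` B \<inter> space M)) = (\<integral>\<omega>\<in>A. ?g \<omega> \<partial>M)"
      by (simp add: set_lebesgue_integral_def flip: indicator_inter_arith)
    also have "\<dots> = (\<integral>\<omega>\<in>A. real_cond_exp M F ?g \<omega> \<partial>M)"
      by (rule F.real_cond_exp_intA[OF int A])
    also have "\<dots> = (\<integral>\<omega>\<in>A. measure \<nu> B \<partial>M)"
      using law B unfolding has_conditional_law_def set_lebesgue_integral_def
      by (intro integral_cong_AE) (auto simp: measurable_from_subalg[OF sub])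
    also have "\<dots> = prob A * measure \<nu> B"
      by (simp add: set_lebesgue_integral_def)
    finally show ?thesis .
  qed
  show ?thesis
  proof (rule sym, rule pair_measure_eqI)
    fix A B assume A: "A \<in> sets (distr M K Y)" and B: "B \<in> sets \<nu>"
    have "Y -` A \<inter> space M \<in> sets F"
      using measurable_sets[OF Y, of A] A sub by (simp add: subalgebra_def)
    then have "prob ((Y -` A \<inter> space M) \<inter> (X -` B \<inter> space M)) = prob (Y -` A \<inter> space M) * measure \<nu> B"
      using B by (rule indep)
    moreover have "(\<lambda>\<omega>. (Y \<omega>, X \<omega>)) -` (A \<times> B) \<inter> space M = (Y -` A \<inter> space M) \<inter> (X -` B \<inter> space M)"
      by auto
    ultimately show "emeasure (distr M K Y) A * emeasure \<nu> B = emeasure (distr M (K \<Otimes>\<^sub>M \<nu>) (\<lambda>\<omega>. (Y \<omega>, X \<omega>))) (A \<times> B)"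
      using A B by (simp add: emeasure_distr emeasure_eq_measure \<nu>.emeasure_eq_measure ennreal_mult'')
  qed (auto intro: Y.sigma_finite_measure_axioms \<nu>.sigma_finite_measure_axioms)
qed

lemma orthogonal_matrix_transpose_iff: "orthogonal_matrix (transpose U) \<longleftrightarrow> orthogonal_matrix U"
  by (auto simp: orthogonal_matrix_def)

text \<open>Pulling out \<open>q ** U\<close> turns a perturbation of an orthogonal matrix into one
  of the identity, with the noise moved only by orthogonal factors. The factor pulled out leaves the
  Gram-Schmidt norms unchanged.\<close>

lemma add_scaleR_eq_orthogonal_mult:
  fixes q x :: "real^'n^'n"
  assumes "orthogonal_matrix q" "orthogonal_matrix U"
  shows "(q + \<epsilon> *\<^sub>R x) ** U = (q ** U) ** (mat 1 + \<epsilon> *\<^sub>R (transpose (q ** U) ** x ** U))"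
proof -
  have "q ** U ** (transpose (q ** U) ** x ** U) = (q ** U ** transpose (q ** U)) ** x ** U"
    by (simp add: matrix_mul_assoc)
  also have "q ** U ** transpose (q ** U) = mat 1"
    using orthogonal_matrix_mul[OF assms] by (simp add: orthogonal_matrix_def)
  finally have "q ** U ** (transpose (q ** U) ** x ** U) = x ** U" by simp
  moreover have "(q + \<epsilon> *\<^sub>R x) ** U = q ** U + \<epsilon> *\<^sub>R (x ** U)"
    by (simp add: matrix_matrix_mult_def vec_eq_iff sum.distrib sum_distrib_left algebra_simps)
  moreover have "A ** (mat 1 + \<epsilon> *\<^sub>R Y) = A + \<epsilon> *\<^sub>R (A ** Y)" for A Y :: "real^'n^'n"
  proof -
    have "A ** (\<epsilon> *\<^sub>R Y) = \<epsilon> *\<^sub>R (A ** Y)"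
      by (simp add: matrix_matrix_mult_def vec_eq_iff sum_distrib_left algebra_simps)
    then show ?thesis by (simp add: matrix_add_ldistrib)
  qed
  ultimately show ?thesis by simp
qed

lemma AE_gaussian_conj:
  assumes "orthogonal_matrix U" "orthogonal_matrix V" "AE X in gaussian_matrix. P X"
  shows "AE X in gaussian_matrix. P (U ** X ** V)"
proof -
  have [measurable]: "(\<lambda>X. U ** X ** V) \<in> borel_measurable borel"
    unfolding matrix_matrix_mult_def by measurable
  have "AE X in distr gaussian_matrix borel (\<lambda>X. U ** X ** V). P X"
    using assms(3) unfolding gaussian_matrix_orthogonal_invariant[OF assms(1,2)] .
  then show ?thesis by (rule AE_distrD[rotated]) measurable
qed

definition log_gs :: "real \<Rightarrow> 'n \<Rightarrow> real^'n::{finite,linorder}^'n::{finite,linorder} \<Rightarrow> real" where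
  "log_gs \<epsilon> j X = ln (norm (gs (mat 1 + \<epsilon> *\<^sub>R X) j))"

lemma borel_measurable_log_gs [measurable]: "log_gs \<epsilon> j \<in> borel_measurable borel"
  unfolding log_gs_def by measurable

text \<open>The QR decomposition of \<open>B\<close> isolates \<open>norm (gs B j)\<close> as a
  factor, which the difference of logarithms cancels. The constant \<open>c\<close> will be the mean
  of \<open>log_gs \<epsilon> j\<close>.\<close>

lemma distr_log_gs_increment:
  fixes q B :: "real^'n::{finite,linorder}^'n::{finite,linorder}"
  assumes q: "orthogonal_matrix q" and B: "det B \<noteq> 0"
  shows "distr gaussian_matrix borel (\<lambda>X. ln (norm (gs ((q + \<epsilon> *\<^sub>R X) ** B) j)) - ln (norm (gs B j)) - c)
    = distr gaussian_matrix borel (\<lambda>X. log_gs \<epsilon> j X - c)"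
proof -
  have nz: "gs B k \<noteq> 0" for k
    using B gram_schmidt_nonzero_iff_det by blast
  obtain U R where U: "orthogonal_matrix U" and BUR: "B = U ** R"
    and upper: "\<And>i j. j < i \<Longrightarrow> R $ i $ j = 0" and diag: "\<And>k. R $ k $ k = norm (gs B k)"
    using QR_decomposition[OF nz] by blast
  let ?V = "transpose (q ** U)"
  have V: "orthogonal_matrix ?V"
    using orthogonal_matrix_mul[OF q U] by (simp add: orthogonal_matrix_transpose_iff)
  have key: "norm (gs ((q + \<epsilon> *\<^sub>R X) ** B) j) = norm (gs B j) * norm (gs (mat 1 + \<epsilon> *\<^sub>R (?V ** X ** U)) j)" for X
  proof -
    have "gs ((q + \<epsilon> *\<^sub>R X) ** B) j = gs (((q + \<epsilon> *\<^sub>R X) ** U) ** R) j"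
      by (simp add: BUR matrix_mul_assoc)
    also have "\<dots> = norm (gs B j) *\<^sub>R gs ((q + \<epsilon> *\<^sub>R X) ** U) j"
      by (subst gram_schmidt_mult_upper_triangular) (use upper diag nz in auto)
    finally show ?thesis
      unfolding add_scaleR_eq_orthogonal_mult[OF q U]
      by (simp add: norm_gram_schmidt_orthogonal_matrix_mult[OF orthogonal_matrix_mul[OF q U]])
  qed
  have [measurable]: "(\<lambda>X. (q + \<epsilon> *\<^sub>R X) ** B) \<in> borel_measurable borel" "(\<lambda>X. ?V ** X ** U) \<in> borel_measurable borel"
    unfolding matrix_matrix_mult_def by measurable
  have "distr gaussian_matrix borel (\<lambda>X. ln (norm (gs ((q + \<epsilon> *\<^sub>R X) ** B) j)) - ln (norm (gs B j)) - c)
      = distr gaussian_matrix borel (\<lambda>X. log_gs \<epsilon> j (?V ** X ** U) - c)"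
  \<comment> \<open>The logarithm of the product splits only where both factors are nonzero, since
    \<open>ln 0 = 0\<close>; the exceptional matrices form a null set.\<close>
  proof (rule distr_cong_AE)
    show "AE X in gaussian_matrix. ln (norm (gs ((q + \<epsilon> *\<^sub>R X) ** B) j)) - ln (norm (gs B j)) - c = log_gs \<epsilon> j (?V ** X ** U) - c"
      using AE_gaussian_conj[OF V U AE_gaussian_det_nonzero[where \<epsilon>=\<epsilon>]]
    proof eventually_elim
      case (elim X)
      then have "gs (mat 1 + \<epsilon> *\<^sub>R (?V ** X ** U)) j \<noteq> 0"
        using gram_schmidt_nonzero_iff_det by blast
      then show ?case
        using nz[of j] by (simp add: key log_gs_def ln_mult)
    qed
  qed measurable
  also have "\<dots> = distr (distr gaussian_matrix borel (\<lambda>X. ?V ** X ** U)) borel (\<lambda>X. log_gs \<epsilon> j X - c)"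
    by (subst distr_distr) (auto simp: comp_def)
  also have "distr gaussian_matrix borel (\<lambda>X. ?V ** X ** U) = gaussian_matrix"
    by (rule gaussian_matrix_orthogonal_invariant[OF V U])
  finally show ?thesis .
qed

section \<open>Growth rates\<close>

text \<open>The logarithm of the sum lies between the maximum of the two logarithms and that maximum
  plus \<open>ln 2\<close>.\<close>

lemma tendsto_ln_add_growth:
  fixes a b :: "nat \<Rightarrow> real"
  assumes "\<And>n. 0 < a n" "\<And>n. 0 < b n"
    and "(\<lambda>n. ln (a n) / real n) \<longlonglongrightarrow> g" "(\<lambda>n. ln (b n) / real n) \<longlonglongrightarrow> g"
  shows "(\<lambda>n. ln (a n + b n) / real n) \<longlonglongrightarrow> g"
proof (rule tendsto_sandwich)
  let ?m = "\<lambda>n. max (ln (a n)) (ln (b n))"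
  have lower: "?m n \<le> ln (a n + b n)" for n
    using assms(1,2)[of n] by simp
  have upper: "ln (a n + b n) \<le> ln 2 + ?m n" for n
  proof -
    have "ln (a n + b n) \<le> ln (2 * max (a n) (b n))"
      using assms(1,2)[of n] by (intro ln_mono) auto
    also have "\<dots> = ln 2 + ln (max (a n) (b n))"
      using assms(1,2)[of n] by (subst ln_mult) (auto simp: max_def)
    also have "ln (max (a n) (b n)) \<le> ?m n"
      by (simp add: max_def)
    finally show ?thesis by simp
  qed
  have max: "(\<lambda>n. max (ln (a n) / real n) (ln (b n) / real n)) \<longlonglongrightarrow> g"
    using tendsto_max[OF assms(3,4)] by simp
  show "\<forall>\<^sub>F n in sequentially. max (ln (a n) / real n) (ln (b n) / real n) \<le> ln (a n + b n) / real n"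
    using lower by (intro always_eventually allI) (simp add: divide_right_mono)
  show "\<forall>\<^sub>F n in sequentially. ln (a n + b n) / real n \<le> ln 2 / real n + max (ln (a n) / real n) (ln (b n) / real n)"
  proof (intro always_eventually allI)
    fix n
    have "ln (a n + b n) / real n \<le> (ln 2 + ?m n) / real n"
      using upper by (intro divide_right_mono) auto
    also have "\<dots> = ln 2 / real n + max (ln (a n) / real n) (ln (b n) / real n)"
      by (cases "n = 0") (auto simp: add_divide_distrib max_def divide_le_cancel)
    finally show "ln (a n + b n) / real n \<le> ln 2 / real n + max (ln (a n) / real n) (ln (b n) / real n)" .
  qed
  show "(\<lambda>n. max (ln (a n) / real n) (ln (b n) / real n)) \<longlonglongrightarrow> g" by (rule max)
  show "(\<lambda>n. ln 2 / real n + max (ln (a n) / real n) (ln (b n) / real n)) \<longlonglongrightarrow> g"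
    using tendsto_add[OF lim_const_over_n[of "ln 2"] max] by simp
qed

lemma tendsto_ln_sum_growth:
  fixes a :: "'i \<Rightarrow> nat \<Rightarrow> real"
  assumes "finite F" "F \<noteq> {}" "\<And>i n. i \<in> F \<Longrightarrow> 0 < a i n"
    and "\<And>i. i \<in> F \<Longrightarrow> (\<lambda>n. ln (a i n) / real n) \<longlonglongrightarrow> g"
  shows "(\<lambda>n. ln (\<Sum>i\<in>F. a i n) / real n) \<longlonglongrightarrow> g"
  using assms
proof (induction F rule: finite_ne_induct)
  case (insert i F)
  have "(\<lambda>n. ln (a i n + (\<Sum>i\<in>F. a i n)) / real n) \<longlonglongrightarrow> g"
    using insert by (intro tendsto_ln_add_growth sum_pos) auto
  then show ?case using insert by simp
qed simp

text \<open>The minors are comparable only with the products \<open>W k\<close> of the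
  \<open>k\<close> largest squared singular values; a single singular value is recovered from two
  consecutive \<open>W\<close>. The factor 2 in the rates comes from the squares.\<close>

lemma growth_rate_of_singular_values:
  fixes C :: "nat \<Rightarrow> real^'n::{finite,linorder}^'n::{finite,linorder}"
  assumes det: "\<And>n. det (C n) \<noteq> 0"
    and rate: "\<And>\<pi> j. \<pi> permutes UNIV \<Longrightarrow>
      (\<lambda>n. ln (norm (gram_schmidt_column (C n ** permutation_matrix \<pi>) j)) / real n) \<longlonglongrightarrow> \<mu> j"
  shows "(\<lambda>n. ereal (1 / real n) * log_ereal (singular_value (C n) j)) \<longlonglongrightarrow> ereal (\<mu> j)"
proof -
  let ?d = "CARD('n)"
  let ?s = "\<lambda>n i. singular_values (C n) ! i"
  define W where "W k n = (\<Prod>i<k. (?s n i)\<^sup>2)" for k n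
  define G where "G k n = (\<Sum>I | card I = k. principal_minor (transpose (C n) ** C n) I)" for k n
  have minor: "0 < principal_minor (transpose (C n) ** C n) I \<and>
      (\<lambda>n. ln (principal_minor (transpose (C n) ** C n) I) / real n) \<longlonglongrightarrow> (\<Sum>j\<in>initial_segment k. 2 * \<mu> j)"
    if I: "card I = k" and k: "k \<le> ?d" for I k n
  proof -
    obtain \<pi> where \<pi>: "\<pi> permutes UNIV" and eq:
      "\<And>A. principal_minor (transpose A ** A) I =
        (\<Prod>j\<in>initial_segment k. (norm (gram_schmidt_column (A ** permutation_matrix \<pi>) j))\<^sup>2)"
      using principal_minor_gram[OF k I] by blast
    have pos: "0 < norm (gram_schmidt_column (C n ** permutation_matrix \<pi>) j)" for n j
    proof -
      have "det (permutation_matrix \<pi>) \<noteq> 0"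
        using det_orthogonal_matrix[OF orthogonal_permutation_matrix[OF \<pi>]] by auto
      then have "det (C n ** permutation_matrix \<pi>) \<noteq> 0"
        using det by (simp add: det_mul)
      then show ?thesis by (simp add: gram_schmidt_nonzero_iff_det)
    qed
    have "ln (principal_minor (transpose (C n) ** C n) I) / real n =
        (\<Sum>j\<in>initial_segment k. 2 * (ln (norm (gram_schmidt_column (C n ** permutation_matrix \<pi>) j)) / real n))" for n
      unfolding eq using pos[of n]
      by (subst ln_prod) (auto simp: ln_realpow sum_divide_distrib)
    moreover have "(\<lambda>n. \<Sum>j\<in>initial_segment k. 2 * (ln (norm (gram_schmidt_column (C n ** permutation_matrix \<pi>) j)) / real n))
        \<longlonglongrightarrow> (\<Sum>j\<in>initial_segment k. 2 * \<mu> j)"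
      by (intro tendsto_sum tendsto_mult_left rate \<pi>)
    moreover have "0 < principal_minor (transpose (C n) ** C n) I"
      unfolding eq using pos by (intro prod_pos) auto
    ultimately show ?thesis by simp
  qed
  have nonempty: "{I :: 'n set. card I = k} \<noteq> {}" if "k \<le> ?d" for k
    using card_initial_segment[OF that] by auto
  have G_pos: "0 < G k n" if "k \<le> ?d" for k n
    unfolding G_def using minor[OF _ that] nonempty[OF that] by (intro sum_pos) auto
  have G_lim: "(\<lambda>n. ln (G k n) / real n) \<longlonglongrightarrow> (\<Sum>j\<in>initial_segment k. 2 * \<mu> j)" if "k \<le> ?d" for k
    unfolding G_def using minor[OF _ that] nonempty[OF that] by (intro tendsto_ln_sum_growth) auto
  have W_le: "W k n \<le> G k n" and G_le: "G k n \<le> 2 ^ ?d * W k n" if "k \<le> ?d" for k n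
    using prod_singular_values_bounds[OF that, of "C n"] by (simp_all add: W_def G_def)
  have W_pos: "0 < W k n" if "k \<le> ?d" for k n
    using order_less_le_trans[OF G_pos[OF that] G_le[OF that]] by (simp add: zero_less_mult_iff)
  have W_lim: "(\<lambda>n. ln (W k n) / real n) \<longlonglongrightarrow> (\<Sum>j\<in>initial_segment k. 2 * \<mu> j)" if k: "k \<le> ?d" for k
  proof (rule tendsto_sandwich)
    show "\<forall>\<^sub>F n in sequentially. ln (W k n) / real n \<le> ln (G k n) / real n"
      using W_le[OF k] W_pos[OF k] G_pos[OF k] by (intro always_eventually allI divide_right_mono) auto
    show "\<forall>\<^sub>F n in sequentially. ln (G k n) / real n - ln (2 ^ ?d) / real n \<le> ln (W k n) / real n"
    proof (intro always_eventually allI)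
      fix n
      have "ln (G k n) \<le> ln (2 ^ ?d * W k n)"
        using G_pos[OF k] G_le[OF k] W_pos[OF k] by simp
      also have "\<dots> = ln (2 ^ ?d) + ln (W k n)"
        using W_pos[OF k, of n] by (simp add: ln_mult)
      finally show "ln (G k n) / real n - ln (2 ^ ?d) / real n \<le> ln (W k n) / real n"
        by (simp add: divide_right_mono flip: diff_divide_distrib)
    qed
    show "(\<lambda>n. ln (G k n) / real n - ln (2 ^ ?d) / real n) \<longlonglongrightarrow> (\<Sum>j\<in>initial_segment k. 2 * \<mu> j)"
      using tendsto_diff[OF G_lim[OF k] lim_const_over_n[of "ln (2 ^ ?d)"]] by simp
  qed (rule G_lim[OF k])
  define k where "k = card {..<j}"
  have k: "k < ?d"
    unfolding k_def by (intro psubset_card_mono) auto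
  \<comment> \<open>Positivity passes from the minors to the singular values, so
    \<open>log_ereal\<close> agrees with \<open>ln\<close> here.\<close>
  have s_pos: "0 < ?s n k" for n
  proof -
    have "W (Suc k) n = W k n * (?s n k)\<^sup>2" by (simp add: W_def)
    then have "?s n k \<noteq> 0" using W_pos[of "Suc k" n] k by auto
    then show ?thesis using singular_values_nonneg[OF k, of "C n"] by simp
  qed
  have "ln (?s n k) / real n = (ln (W (Suc k) n) / real n - ln (W k n) / real n) / 2" for n
  proof -
    have "W (Suc k) n = W k n * (?s n k)\<^sup>2" by (simp add: W_def)
    then have "ln (W (Suc k) n) = ln (W k n) + ln ((?s n k)\<^sup>2)"
      using s_pos[of n] W_pos[of k n] k by (simp add: ln_mult)
    then show ?thesis
      using s_pos[of n] by (simp add: ln_realpow flip: diff_divide_distrib)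
  qed
  moreover have "(\<lambda>n. (ln (W (Suc k) n) / real n - ln (W k n) / real n) / 2)
      \<longlonglongrightarrow> ((\<Sum>j\<in>initial_segment (Suc k). 2 * \<mu> j) - (\<Sum>j\<in>initial_segment k. 2 * \<mu> j)) / 2"
    using k by (intro tendsto_divide tendsto_diff W_lim) auto
  \<comment> \<open>The rank \<open>k\<close> of \<open>j\<close> counts from 0, so the segments of
    length \<open>Suc k\<close> and \<open>k\<close> differ exactly by \<open>j\<close>.\<close>
  moreover have "((\<Sum>j\<in>initial_segment (Suc k). 2 * \<mu> j) - (\<Sum>j\<in>initial_segment k. 2 * \<mu> j)) / 2 = \<mu> j"
    unfolding k_def initial_segment_Suc(1) using initial_segment_Suc(2)[of j] by simp
  ultimately have "(\<lambda>n. ln (?s n k) / real n) \<longlonglongrightarrow> \<mu> j"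
    by (simp only:)
  then have "(\<lambda>n. ereal (ln (?s n k) / real n)) \<longlonglongrightarrow> ereal (\<mu> j)"
    by simp
  moreover have "ereal (1 / real n) * log_ereal (singular_value (C n) j) = ereal (ln (?s n k) / real n)" for n
    using s_pos[of n] by (simp add: log_ereal_def singular_value_def k_def)
  ultimately show ?thesis by simp
qed

lemma measurable_matrix_mult [measurable (raw)]:
  fixes f :: "'a \<Rightarrow> real^'n^'m" and g :: "'a \<Rightarrow> real^'k^'n"
  assumes [measurable]: "f \<in> borel_measurable M" "g \<in> borel_measurable M"
  shows "(\<lambda>x. f x ** g x) \<in> borel_measurable M"
  unfolding matrix_matrix_mult_def by measurable

text \<open>Makes the logarithm 0 at \<open>n = 0\<close>, so that the later logarithms are exact
  sums of their increments for every initial orthogonal matrix.\<close>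

lemma norm_gram_schmidt_orthogonal_matrix:
  fixes P :: "real^'n::{finite,linorder}^'n::{finite,linorder}"
  assumes "orthogonal_matrix P"
  shows "norm (gs P j) = 1"
proof -
  have "axis j 1 = gs (mat 1 :: real^'n::{finite,linorder}^'n::{finite,linorder}) j"
  proof (rule gram_schmidt_column_unique)
    have col: "column i (mat 1 :: real^'n::{finite,linorder}^'n::{finite,linorder}) = axis i 1" for i
      by (auto simp: column_def mat_def axis_def vec_eq_iff)
    show "axis j 1 - column j (mat 1) \<in> span ((\<lambda>i. column i (mat 1 :: real^'n::{finite,linorder}^'n::{finite,linorder})) ` {..<j})"
      by (simp add: col span_zero)
    show "i < j \<Longrightarrow> axis j 1 \<bullet> column i (mat 1 :: real^'n::{finite,linorder}^'n::{finite,linorder}) = 0" for i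
      by (simp add: col inner_axis_axis)
  qed
  then have "norm (gs (mat 1 :: real^'n::{finite,linorder}^'n::{finite,linorder}) j) = 1"
    by (metis norm_axis_1)
  then show ?thesis
    using norm_gram_schmidt_orthogonal_matrix_mult[OF assms, of "mat 1" j] by simp
qed

section \<open>Orbits of the invertible system\<close>

context invertible_ergodic_system
begin

abbreviation "\<tau> \<equiv> inv_into (space M) \<sigma>"

lemma measurable_funpow:
  assumes "f \<in> measurable M M"
  shows "(f ^^ n) \<in> measurable M M"
proof (induction n)
  case (Suc n)
  then show ?case using measurable_comp[OF Suc assms] by (simp add: comp_def)
qed (simp add: id_def)

lemma distr_funpow: "distr M M (\<sigma> ^^ n) = M"
proof (induction n)
  case (Suc n)
  have "distr M M (\<sigma> ^^ Suc n) = distr (distr M M (\<sigma> ^^ n)) M \<sigma>"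
    using measurable_funpow[OF measurable_map, of n] measurable_map by (simp add: distr_distr)
  then show ?case by (simp add: Suc measure_preserving comp_def)
qed (simp add: id_def distr_id2)

lemma measurable_int_iterate: "int_iterate M \<sigma> n \<in> measurable M M"
  unfolding int_iterate_def
  using measurable_funpow[OF measurable_map] measurable_funpow[OF measurable_inverse] by auto

lemma in_space: "\<omega> \<in> space M \<Longrightarrow> (\<sigma> ^^ n) \<omega> \<in> space M" "\<omega> \<in> space M \<Longrightarrow> (\<tau> ^^ n) \<omega> \<in> space M"
  using measurable_space[OF measurable_funpow[OF measurable_map]]
    measurable_space[OF measurable_funpow[OF measurable_inverse]] by auto

lemma map_inverse: "\<omega> \<in> space M \<Longrightarrow> \<sigma> (\<tau> \<omega>) = \<omega>" "\<omega> \<in> space M \<Longrightarrow> \<tau> (\<sigma> \<omega>) = \<omega>"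
  using bij bij_betw_inv_into_right[OF bij] bij_betw_inv_into_left[OF bij] by auto

lemma funpow_inverse_funpow:
  assumes "\<omega> \<in> space M" "k \<le> n"
  shows "(\<sigma> ^^ k) ((\<tau> ^^ n) \<omega>) = (\<tau> ^^ (n - k)) \<omega>"
  using assms(2)
proof (induction k)
  case (Suc k)
  then have "n - k = Suc (n - Suc k)" by simp
  then have "(\<tau> ^^ (n - k)) \<omega> = \<tau> ((\<tau> ^^ (n - Suc k)) \<omega>)" by simp
  then show ?case
    using Suc map_inverse(1)[OF in_space(2)[OF assms(1)]] by simp
qed simp

lemma inverse_funpow_funpow:
  assumes "\<omega> \<in> space M"
  shows "(\<tau> ^^ n) ((\<sigma> ^^ n) \<omega>) = \<omega>"
proof (induction n)
  case (Suc n)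
  have "(\<tau> ^^ Suc n) ((\<sigma> ^^ Suc n) \<omega>) = (\<tau> ^^ n) (\<tau> (\<sigma> ((\<sigma> ^^ n) \<omega>)))"
    by (simp add: funpow_swap1)
  then show ?case using Suc map_inverse(2)[OF in_space(1)[OF assms]] by simp
qed simp

lemma AE_funpow:
  assumes "AE \<omega> in M. P \<omega>"
  shows "AE \<omega> in M. P ((\<sigma> ^^ n) \<omega>)"
proof (rule AE_distrD[where f="\<sigma> ^^ n" and M'=M])
  show "(\<sigma> ^^ n) \<in> measurable M M" by (rule measurable_funpow[OF measurable_map])
  show "AE \<omega> in distr M M (\<sigma> ^^ n). P \<omega>" unfolding distr_funpow by (rule assms)
qed

end

section \<open>The cocycle with Gaussian noise\<close>

locale gaussian_cocycle = invertible_ergodic_system M \<sigma>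
  for M :: "'a measure" and \<sigma> +
  fixes Q N :: "'a \<Rightarrow> real^'n::{finite,linorder}^'n::{finite,linorder}" and \<epsilon> :: real
  assumes Q_meas [measurable]: "Q \<in> borel_measurable M"
    and Q_orth: "\<And>\<omega>. \<omega> \<in> space M \<Longrightarrow> orthogonal_matrix (Q \<omega>)"
    and N_meas [measurable]: "N \<in> borel_measurable M"
    and N_law: "has_conditional_law M (conditioning_algebra M \<sigma> Q N) N gaussian_matrix"
begin

abbreviation "F \<equiv> conditioning_algebra M \<sigma> Q N"
abbreviation "A \<equiv> \<lambda>\<omega>. Q \<omega> + \<epsilon> *\<^sub>R N \<omega>"
abbreviation "C \<equiv> cocycle \<sigma> A"

text \<open>
  The cocycle \<open>C n\<close> seen from time \<open>n\<close>: in contrast to \<open>C n\<close> itself, this only depends on the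
  variables generating \<open>F\<close>.
\<close>

definition "past n \<omega> = C n ((\<tau> ^^ n) \<omega>)"

lemma generators_subset:
  "{(\<lambda>\<omega>. Q (int_iterate M \<sigma> n \<omega>)) -` B \<inter> space M | n B. B \<in> sets borel} \<union>
    {(\<lambda>\<omega>. N (int_iterate M \<sigma> n \<omega>)) -` B \<inter> space M | n B. n \<noteq> 0 \<and> B \<in> sets borel} \<subseteq> sets M" (is "?G \<subseteq> _")
proof -
  have "(\<lambda>\<omega>. Q (int_iterate M \<sigma> n \<omega>)) \<in> borel_measurable M" "(\<lambda>\<omega>. N (int_iterate M \<sigma> n \<omega>)) \<in> borel_measurable M" for n
    by (rule measurable_compose[OF measurable_int_iterate], measurable)+
  then show ?thesis by (auto intro: measurable_sets)
qed

lemma sets_F: "sets F = sigma_sets (space M)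
    ({(\<lambda>\<omega>. Q (int_iterate M \<sigma> n \<omega>)) -` B \<inter> space M | n B. B \<in> sets borel} \<union>
      {(\<lambda>\<omega>. N (int_iterate M \<sigma> n \<omega>)) -` B \<inter> space M | n B. n \<noteq> 0 \<and> B \<in> sets borel})"
  and space_F: "space F = space M"
  unfolding conditioning_algebra_def
  by (intro sets_measure_of space_measure_of; blast)+

lemma subalgebra_F: "subalgebra M F"
  unfolding subalgebra_def space_F sets_F
  using sets.sigma_sets_subset[OF generators_subset] by simp

lemma Q_iterate_F: "(\<lambda>\<omega>. Q (int_iterate M \<sigma> n \<omega>)) \<in> borel_measurable F"
  by (rule measurableI) (auto simp: space_F sets_F intro!: sigma_sets.Basic)

lemma N_iterate_F: "n \<noteq> 0 \<Longrightarrow> (\<lambda>\<omega>. N (int_iterate M \<sigma> n \<omega>)) \<in> borel_measurable F"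
  by (rule measurableI) (simp_all add: space_F sets_F, rule sigma_sets.Basic, rule UnI2, blast)

lemma Q_F: "Q \<in> borel_measurable F"
  using Q_iterate_F[of 0] by (simp add: int_iterate_def)

text \<open>The factors of \<open>past n\<close> sit at the times \<open>-n, ..., -1\<close> and
  never involve \<open>N\<close> at time 0, the one variable left out of \<open>F\<close>. The
  induction runs over the number \<open>k\<close> of factors with the starting time fixed.\<close>

lemma past_F: "past n \<in> borel_measurable F"
proof -
  have "(\<lambda>\<omega>. C k ((\<tau> ^^ n) \<omega>)) \<in> borel_measurable F" if "k \<le> n" for k
    using that
  proof (induction k)
    case (Suc k)
    have it: "int_iterate M \<sigma> (int k - int n) = \<tau> ^^ (n - k)"
      using Suc.prems by (simp add: int_iterate_def nat_diff_distrib)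
    have "int k - int n \<noteq> 0" using Suc.prems by simp
    note [measurable] = Q_iterate_F[of "int k - int n", unfolded it] N_iterate_F[OF this, unfolded it]
    have [measurable]: "(\<lambda>\<omega>. C k ((\<tau> ^^ n) \<omega>)) \<in> borel_measurable F"
      using Suc by simp
    have "(\<lambda>\<omega>. (Q ((\<tau> ^^ (n - k)) \<omega>) + \<epsilon> *\<^sub>R N ((\<tau> ^^ (n - k)) \<omega>)) ** C k ((\<tau> ^^ n) \<omega>)) \<in> borel_measurable F"
      by measurable
    then show ?case
      using Suc.prems by (subst measurable_cong) (auto simp: space_F funpow_inverse_funpow)
  qed simp
  then show ?thesis unfolding past_def by simp
qed

lemma past_funpow: "\<omega> \<in> space M \<Longrightarrow> past n ((\<sigma> ^^ n) \<omega>) = C n \<omega>"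
  by (simp add: past_def inverse_funpow_funpow)

lemma past_meas [measurable]: "past n \<in> borel_measurable M"
  by (rule measurable_from_subalg[OF subalgebra_F past_F])

lemma C_meas [measurable]: "C n \<in> borel_measurable M"
proof -
  have "(\<lambda>\<omega>. past n ((\<sigma> ^^ n) \<omega>)) \<in> borel_measurable M"
    by (rule measurable_compose[OF measurable_funpow[OF measurable_map]]) measurable
  then show ?thesis
    by (subst measurable_cong) (auto simp: past_funpow)
qed

lemma distr_F_N:
  assumes "Y \<in> measurable F K"
  shows "distr M (K \<Otimes>\<^sub>M gaussian_matrix) (\<lambda>\<omega>. (Y \<omega>, N \<omega>)) = distr M K Y \<Otimes>\<^sub>M gaussian_matrix"
proof (rule has_conditional_law_distr_pair[OF subalgebra_F N_law prob_space_gaussian_matrix _ assms])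
  show "N \<in> measurable M gaussian_matrix"
    by (simp cong: measurable_cong_sets)
qed

text \<open>Freezing \<open>Y\<close> reduces probabilities in \<open>M\<close> to probabilities
  under \<open>gaussian_matrix\<close> with deterministic parameters.\<close>

lemma emeasure_F_N:
  assumes Y: "Y \<in> measurable F K" and T [measurable]: "T \<in> sets (K \<Otimes>\<^sub>M gaussian_matrix)"
  shows "emeasure M {\<omega>\<in>space M. (Y \<omega>, N \<omega>) \<in> T} = (\<integral>\<^sup>+\<omega>. emeasure gaussian_matrix (Pair (Y \<omega>) -` T) \<partial>M)"
proof -
  interpret \<nu>: prob_space "gaussian_matrix :: (real^'n::{finite,linorder}^'n::{finite,linorder}) measure"
    by (rule prob_space_gaussian_matrix)
  have YM [measurable]: "Y \<in> measurable M K"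
    using measurable_from_subalg[OF subalgebra_F Y] .
  have [measurable]: "N \<in> measurable M gaussian_matrix"
    by (simp cong: measurable_cong_sets)
  have "emeasure M {\<omega>\<in>space M. (Y \<omega>, N \<omega>) \<in> T} = emeasure (distr M (K \<Otimes>\<^sub>M gaussian_matrix) (\<lambda>\<omega>. (Y \<omega>, N \<omega>))) T"
    by (subst emeasure_distr[OF _ T]) (auto intro!: arg_cong[where f="emeasure M"])
  also have "\<dots> = (\<integral>\<^sup>+y. emeasure gaussian_matrix (Pair y -` T) \<partial>distr M K Y)"
    unfolding distr_F_N[OF Y]
  proof (rule \<nu>.emeasure_pair_measure_alt)
    have "sets (distr M K Y \<Otimes>\<^sub>M gaussian_matrix) = sets (K \<Otimes>\<^sub>M gaussian_matrix)"
      by (rule sets_pair_measure_cong) simp_all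
    with T show "T \<in> sets (distr M K Y \<Otimes>\<^sub>M gaussian_matrix)" by metis
  qed
  also have "\<dots> = (\<integral>\<^sup>+\<omega>. emeasure gaussian_matrix (Pair (Y \<omega>) -` T) \<partial>M)"
    by (subst nn_integral_distr) (auto intro!: \<nu>.measurable_emeasure_Pair)
  finally show ?thesis .
qed

text \<open>Moves an event observed at time \<open>n\<close> to time 0, where the conditional law of
  \<open>N\<close> is known.\<close>

lemma emeasure_funpow:
  assumes [measurable]: "Measurable.pred M P"
  shows "emeasure M {\<omega>\<in>space M. P ((\<sigma> ^^ n) \<omega>)} = emeasure M {\<omega>\<in>space M. P \<omega>}"
proof -
  have [measurable]: "(\<sigma> ^^ n) \<in> measurable M M" by (rule measurable_funpow[OF measurable_map])
  have "emeasure M {\<omega>\<in>space M. P \<omega>} = emeasure (distr M M (\<sigma> ^^ n)) {\<omega>\<in>space M. P \<omega>}"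
    by (simp add: distr_funpow)
  also have "\<dots> = emeasure M {\<omega>\<in>space M. P ((\<sigma> ^^ n) \<omega>)}"
    by (subst emeasure_distr) (auto intro!: arg_cong[where f="emeasure M"] simp: in_space)
  finally show ?thesis ..
qed

lemma AE_det_A: "AE \<omega> in M. det (A \<omega>) \<noteq> 0"
proof -
  let ?T = "{p :: (real^'n::{finite,linorder}^'n::{finite,linorder}) \<times> (real^'n::{finite,linorder}^'n::{finite,linorder}).
    det (fst p + \<epsilon> *\<^sub>R snd p) = 0}"
  have T: "?T \<in> sets (borel \<Otimes>\<^sub>M gaussian_matrix)"
  proof -
    have "{p \<in> space (borel \<Otimes>\<^sub>M gaussian_matrix). det (fst p + \<epsilon> *\<^sub>R snd p) = 0} \<in> sets (borel \<Otimes>\<^sub>M gaussian_matrix)"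
      by measurable
    also have "{p \<in> space (borel \<Otimes>\<^sub>M gaussian_matrix). det (fst p + \<epsilon> *\<^sub>R snd p) = 0} = ?T"
      by (auto simp: space_pair_measure)
    finally show ?thesis .
  qed
  \<comment> \<open>With \<open>Q \<omega>\<close> frozen, multiplication by its transpose reduces
    the claim to a perturbation of the identity by orthogonally transformed noise.\<close>
  have "emeasure gaussian_matrix (Pair (Q \<omega>) -` ?T) = 0" if "\<omega> \<in> space M" for \<omega>
  proof -
    have orth: "orthogonal_matrix (transpose (Q \<omega>))"
      using Q_orth[OF that] by (simp add: orthogonal_matrix_transpose_iff)
    have "AE X in gaussian_matrix. det (mat 1 + \<epsilon> *\<^sub>R (transpose (Q \<omega>) ** X ** mat 1)) \<noteq> 0"
      by (rule AE_gaussian_conj[OF orth orthogonal_matrix_id AE_gaussian_det_nonzero])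
    then have "AE X in gaussian_matrix. det (Q \<omega> + \<epsilon> *\<^sub>R X) \<noteq> 0"
    proof eventually_elim
      case (elim X)
      have "det (Q \<omega>) \<noteq> 0" using det_orthogonal_matrix[OF Q_orth[OF that]] by auto
      then show ?case
        using elim add_scaleR_eq_orthogonal_mult[OF Q_orth[OF that] orthogonal_matrix_id, of \<epsilon> X]
        by (simp add: det_mul)
    qed
    moreover have "{X \<in> space gaussian_matrix. \<not> det (Q \<omega> + \<epsilon> *\<^sub>R X) \<noteq> 0} \<in> sets gaussian_matrix"
      by measurable
    ultimately show ?thesis
      by (simp add: AE_iff_measurable[OF _ refl] vimage_def)
  qed
  then have "emeasure M {\<omega>\<in>space M. (Q \<omega>, N \<omega>) \<in> ?T} = 0"
    unfolding emeasure_F_N[OF Q_F T] by (simp cong: nn_integral_cong)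
  then show ?thesis
    by (subst AE_iff_measurable[OF _ refl]) auto
qed

lemma AE_det_C: "AE \<omega> in M. \<forall>n. det (C n \<omega>) \<noteq> 0"
proof -
  have "AE \<omega> in M. \<forall>n. det (A ((\<sigma> ^^ n) \<omega>)) \<noteq> 0"
    using AE_funpow[OF AE_det_A] by (simp add: AE_all_countable)
  then show ?thesis
  proof eventually_elim
    case (elim \<omega>)
    have "det (C n \<omega>) \<noteq> 0" for n
      by (induction n) (use elim in \<open>auto simp: det_mul\<close>)
    then show ?case by simp
  qed
qed

lemma AE_det_past: "AE \<omega> in M. det (past n \<omega>) \<noteq> 0"
proof -
  have "emeasure M {\<omega>\<in>space M. det (past n \<omega>) = 0} = emeasure M {\<omega>\<in>space M. det (past n ((\<sigma> ^^ n) \<omega>)) = 0}"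
    by (rule emeasure_funpow[symmetric]) measurable
  also have "{\<omega>\<in>space M. det (past n ((\<sigma> ^^ n) \<omega>)) = 0} = {\<omega>\<in>space M. det (C n \<omega>) = 0}"
    by (auto simp: past_funpow)
  also have "emeasure M \<dots> = 0"
    using AE_det_C by (subst (asm) AE_all_countable) (auto dest!: spec[of _ n] simp: AE_iff_measurable[OF _ refl])
  finally show ?thesis
    by (subst AE_iff_measurable[OF _ refl]) auto
qed

text \<open>After the shift to time 0, \<open>S n\<close> is a function of \<open>past n\<close>,
  and \<open>X n\<close> of \<open>Q\<close>, \<open>past n\<close> and \<open>N\<close>. With
  \<open>Q\<close> and \<open>past n\<close> frozen, \<open>X n\<close> has the law
  \<open>?L\<close> whatever their values, as long as the past is invertible; so the joint
  probabilities factor. The term \<open>real n * c\<close> makes \<open>S n\<close> the sum of the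
  earlier \<open>X i\<close>.\<close>

lemma increment_indep:
  fixes P :: "real^'n::{finite,linorder}^'n::{finite,linorder}" and c :: real and j :: 'n
  assumes P: "orthogonal_matrix P"
  defines "S \<equiv> \<lambda>n \<omega>. ln (norm (gs (C n \<omega> ** P) j)) - real n * c"
    and "X \<equiv> \<lambda>n \<omega>. ln (norm (gs (C (Suc n) \<omega> ** P) j)) - ln (norm (gs (C n \<omega> ** P) j)) - c"
  shows "distr M borel (X n) = distr gaussian_matrix borel (\<lambda>X. log_gs \<epsilon> j X - c)"
    and "indep_var borel (S n) borel (X n)"
proof -
  let ?L = "distr gaussian_matrix borel (\<lambda>X. log_gs \<epsilon> j X - c)"
  interpret \<nu>: prob_space "gaussian_matrix :: (real^'n::{finite,linorder}^'n::{finite,linorder}) measure"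
    by (rule prob_space_gaussian_matrix)
  interpret L: prob_space ?L
    by (rule \<nu>.prob_space_distr) measurable
  have [measurable]: "S n \<in> borel_measurable M" "X n \<in> borel_measurable M" for n
    unfolding S_def X_def by measurable
  define u where "u b = ln (norm (gs (b ** P) j)) - real n * c" for b
  define h where "h q b x = ln (norm (gs ((q + \<epsilon> *\<^sub>R x) ** (b ** P)) j)) - ln (norm (gs (b ** P) j)) - c" for q b x
  have [measurable]: "u \<in> borel_measurable borel"
    unfolding u_def by measurable
  have S_eq: "S n \<omega> = u (past n ((\<sigma> ^^ n) \<omega>))" if "\<omega> \<in> space M" for \<omega>
    using that by (simp add: S_def u_def past_funpow)
  have X_eq: "X n \<omega> = h (Q ((\<sigma> ^^ n) \<omega>)) (past n ((\<sigma> ^^ n) \<omega>)) (N ((\<sigma> ^^ n) \<omega>))" if "\<omega> \<in> space M" for \<omega>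
    using that by (simp add: X_def h_def past_funpow matrix_mul_assoc)
  have [measurable]: "(\<lambda>\<omega>. h (Q \<omega>) (past n \<omega>) (N \<omega>)) \<in> borel_measurable M"
    unfolding h_def by measurable
  have joint: "emeasure M {\<omega>\<in>space M. S n \<omega> \<in> E \<and> X n \<omega> \<in> B} = emeasure M {\<omega>\<in>space M. S n \<omega> \<in> E} * emeasure ?L B"
    if E [measurable]: "E \<in> sets borel" and B [measurable]: "B \<in> sets borel" for E B
  proof -
    let ?Y = "\<lambda>\<omega>. (Q \<omega>, past n \<omega>)"
    have Y: "?Y \<in> measurable F (borel \<Otimes>\<^sub>M borel)"
      using Q_F past_F by (rule measurable_Pair)
    define T where "T = {p. u (snd (fst p)) \<in> E \<and> h (fst (fst p)) (snd (fst p)) (snd p) \<in> B}"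
    have T: "T \<in> sets ((borel \<Otimes>\<^sub>M borel) \<Otimes>\<^sub>M gaussian_matrix)"
    proof -
      have "{p \<in> space ((borel \<Otimes>\<^sub>M borel) \<Otimes>\<^sub>M gaussian_matrix). u (snd (fst p)) \<in> E \<and>
          h (fst (fst p)) (snd (fst p)) (snd p) \<in> B} \<in> sets ((borel \<Otimes>\<^sub>M borel) \<Otimes>\<^sub>M gaussian_matrix)"
        unfolding h_def by measurable
      then show ?thesis by (simp add: space_pair_measure T_def)
    qed
    have slice: "emeasure gaussian_matrix (Pair (?Y \<omega>) -` T) = indicator E (u (past n \<omega>)) * emeasure ?L B"
      if "\<omega> \<in> space M" "det (past n \<omega>) \<noteq> 0" for \<omega>
    proof (cases "u (past n \<omega>) \<in> E")
      case True
      have "det (past n \<omega> ** P) \<noteq> 0"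
        using that(2) det_orthogonal_matrix[OF P] by (auto simp: det_mul)
      from distr_log_gs_increment[OF Q_orth[OF that(1)] this, of \<epsilon> j c]
      have law: "distr gaussian_matrix borel (h (Q \<omega>) (past n \<omega>)) = ?L"
        by (simp add: h_def[abs_def])
      have "Pair (?Y \<omega>) -` T = h (Q \<omega>) (past n \<omega>) -` B"
        using True by (auto simp: T_def)
      moreover have "h (Q \<omega>) (past n \<omega>) \<in> borel_measurable gaussian_matrix"
        unfolding h_def by measurable
      ultimately have "emeasure gaussian_matrix (Pair (?Y \<omega>) -` T) = emeasure (distr gaussian_matrix borel (h (Q \<omega>) (past n \<omega>))) B"
        by (simp add: emeasure_distr)
      then show ?thesis using True by (simp only: law) simp
    next
      case False
      then have "Pair (?Y \<omega>) -` T = {}" by (auto simp: T_def)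
      then show ?thesis using False by simp
    qed
    have "emeasure M {\<omega>\<in>space M. S n \<omega> \<in> E \<and> X n \<omega> \<in> B} =
        emeasure M {\<omega>\<in>space M. u (past n ((\<sigma> ^^ n) \<omega>)) \<in> E \<and>
          h (Q ((\<sigma> ^^ n) \<omega>)) (past n ((\<sigma> ^^ n) \<omega>)) (N ((\<sigma> ^^ n) \<omega>)) \<in> B}"
      by (intro arg_cong[where f="emeasure M"]) (auto simp: S_eq X_eq)
    also have "\<dots> = emeasure M {\<omega>\<in>space M. u (past n \<omega>) \<in> E \<and> h (Q \<omega>) (past n \<omega>) (N \<omega>) \<in> B}"
      by (rule emeasure_funpow) measurable
    also have "\<dots> = emeasure M {\<omega>\<in>space M. (?Y \<omega>, N \<omega>) \<in> T}"
      by (simp add: T_def)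
    also have "\<dots> = (\<integral>\<^sup>+\<omega>. emeasure gaussian_matrix (Pair (?Y \<omega>) -` T) \<partial>M)"
      by (rule emeasure_F_N[OF Y T])
    also have "\<dots> = (\<integral>\<^sup>+\<omega>. indicator {\<omega>\<in>space M. u (past n \<omega>) \<in> E} \<omega> * emeasure ?L B \<partial>M)"
      using AE_det_past[of n] AE_space
      by (intro nn_integral_cong_AE, eventually_elim) (simp add: slice indicator_def)
    also have "\<dots> = emeasure M {\<omega>\<in>space M. u (past n \<omega>) \<in> E} * emeasure ?L B"
      by (subst nn_integral_multc) auto
    also have "emeasure M {\<omega>\<in>space M. u (past n \<omega>) \<in> E} = emeasure M {\<omega>\<in>space M. u (past n ((\<sigma> ^^ n) \<omega>)) \<in> E}"
      by (rule emeasure_funpow[symmetric]) measurable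
    also have "\<dots> = emeasure M {\<omega>\<in>space M. S n \<omega> \<in> E}"
      by (intro arg_cong[where f="emeasure M"]) (auto simp: S_eq)
    finally show ?thesis .
  qed
  show law: "distr M borel (X n) = ?L"
  proof (rule measure_eqI)
    fix B assume "B \<in> sets (distr M borel (X n))"
    then have [measurable]: "B \<in> sets borel" by simp
    have "emeasure (distr M borel (X n)) B = emeasure M {\<omega>\<in>space M. S n \<omega> \<in> UNIV \<and> X n \<omega> \<in> B}"
      by (subst emeasure_distr) (auto intro!: arg_cong[where f="emeasure M"])
    also have "\<dots> = emeasure ?L B"
      by (subst joint) (auto simp: emeasure_space_1)
    finally show "emeasure (distr M borel (X n)) B = emeasure ?L B" .
  qed simp
  show "indep_var borel (S n) borel (X n)"
    unfolding indep_var_distribution_eq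
  proof (intro conjI)
    interpret S: prob_space "distr M borel (S n)" by (rule prob_space_distr) measurable
    show "distr M borel (S n) \<Otimes>\<^sub>M distr M borel (X n) = distr M (borel \<Otimes>\<^sub>M borel) (\<lambda>x. (S n x, X n x))"
    proof (rule pair_measure_eqI)
      fix E B assume "E \<in> sets (distr M borel (S n))" "B \<in> sets (distr M borel (X n))"
      then have [measurable]: "E \<in> sets borel" "B \<in> sets borel" by simp_all
      have "emeasure (distr M borel (S n)) E * emeasure (distr M borel (X n)) B
          = emeasure M {\<omega>\<in>space M. S n \<omega> \<in> E} * emeasure ?L B"
        unfolding law by (subst emeasure_distr) (auto intro!: arg_cong2[where f="(*)"] arg_cong[where f="emeasure M"])
      also have "\<dots> = emeasure M {\<omega>\<in>space M. S n \<omega> \<in> E \<and> X n \<omega> \<in> B}"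
        by (rule joint[symmetric]) measurable
      also have "\<dots> = emeasure (distr M (borel \<Otimes>\<^sub>M borel) (\<lambda>x. (S n x, X n x))) (E \<times> B)"
        by (subst emeasure_distr) (auto intro!: arg_cong[where f="emeasure M"])
      finally show "emeasure (distr M borel (S n)) E * emeasure (distr M borel (X n)) B
          = emeasure (distr M (borel \<Otimes>\<^sub>M borel) (\<lambda>x. (S n x, X n x))) (E \<times> B)" .
    qed (simp_all add: law S.sigma_finite_measure_axioms L.sigma_finite_measure_axioms)
  qed simp_all
qed

lemma growth_rate_gram_schmidt:
  fixes P :: "real^'n::{finite,linorder}^'n::{finite,linorder}"
  assumes P: "orthogonal_matrix P"
  shows "AE \<omega> in M. (\<lambda>n. ln (norm (gs (C n \<omega> ** P) j)) / real n) \<longlonglongrightarrow> (\<integral>X. log_gs \<epsilon> j X \<partial>gaussian_matrix)"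
proof -
  let ?\<nu> = "gaussian_matrix :: (real^'n::{finite,linorder}^'n::{finite,linorder}) measure"
  interpret \<nu>: prob_space ?\<nu> by (rule prob_space_gaussian_matrix)
  define \<mu> where "\<mu> = (\<integral>X. log_gs \<epsilon> j X \<partial>?\<nu>)"
  define X where "X n \<omega> = ln (norm (gs (C (Suc n) \<omega> ** P) j)) - ln (norm (gs (C n \<omega> ** P) j)) - \<mu>" for n \<omega>
  have [measurable]: "X n \<in> borel_measurable M" for n
    unfolding X_def by measurable
  have [measurable]: "(\<lambda>X. log_gs \<epsilon> j X - \<mu>) \<in> borel_measurable ?\<nu>"
    by measurable
  have S_eq: "(\<Sum>i<n. X i \<omega>) = ln (norm (gs (C n \<omega> ** P) j)) - real n * \<mu>" for n \<omega>
  proof (induction n)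
    case 0
    then show ?case by (simp add: norm_gram_schmidt_orthogonal_matrix[OF P])
  next
    case (Suc n)
    then show ?case by (simp add: X_def algebra_simps)
  qed
  have law: "distr M borel (X n) = distr ?\<nu> borel (\<lambda>X. log_gs \<epsilon> j X - \<mu>)"
    and indep: "indep_var borel (\<lambda>\<omega>. \<Sum>i<n. X i \<omega>) borel (X n)" for n
    using increment_indep[OF P, where n=n and j=j and c=\<mu>] unfolding S_eq unfolding X_def[abs_def] by simp_all
  have int4: "integrable ?\<nu> (\<lambda>X. log_gs \<epsilon> j X ^ 4)"
    unfolding log_gs_def by (rule integrable_ln_gram_schmidt_power4)
  then have int1: "integrable ?\<nu> (log_gs \<epsilon> j)"
    using integrable_power_of_integrable_power4[OF \<nu>.prob_space_axioms _ int4, of 1] by simp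
  have int4': "integrable ?\<nu> (\<lambda>X. (log_gs \<epsilon> j X - \<mu>) ^ 4)"
  proof (rule Bochner_Integration.integrable_bound)
    show "integrable ?\<nu> (\<lambda>X. 8 * (log_gs \<epsilon> j X ^ 4 + (- \<mu>) ^ 4))"
      using int4 by simp
    have "(log_gs \<epsilon> j Y - \<mu>) ^ 4 \<le> 8 * (log_gs \<epsilon> j Y ^ 4 + (- \<mu>) ^ 4)" for Y
      using power4_add_le[of "log_gs \<epsilon> j Y" "- \<mu>"] by simp
    then show "AE Y in ?\<nu>. norm ((log_gs \<epsilon> j Y - \<mu>) ^ 4) \<le> norm (8 * (log_gs \<epsilon> j Y ^ 4 + (- \<mu>) ^ 4))"
      by (intro AE_I2) (simp add: abs_of_nonneg)
  qed measurable
  have "AE \<omega> in M. (\<lambda>n. (\<Sum>i<n. X i \<omega>) / real n) \<longlonglongrightarrow> 0"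
  proof (rule strong_law_fourth_moment)
    show "indep_var borel (\<lambda>\<omega>. \<Sum>i<n. X i \<omega>) borel (X n)" for n
      by (rule indep)
    show "integrable M (\<lambda>\<omega>. X n \<omega> ^ 4)" for n
    proof (rule integrable_distr[where f="\<lambda>x. x ^ 4"])
      show "integrable (distr M borel (X n)) (\<lambda>x. x ^ 4)"
        unfolding law using int4' by (subst integrable_distr_eq) auto
    qed measurable
    have X_int: "expectation (\<lambda>\<omega>. g (X n \<omega>)) = (\<integral>Y. g (log_gs \<epsilon> j Y - \<mu>) \<partial>?\<nu>)"
      if [measurable]: "g \<in> borel_measurable borel" for g :: "real \<Rightarrow> real" and n
    proof -
      have "expectation (\<lambda>\<omega>. g (X n \<omega>)) = (\<integral>x. g x \<partial>distr M borel (X n))"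
        by (subst integral_distr) auto
      also have "\<dots> = (\<integral>Y. g (log_gs \<epsilon> j Y - \<mu>) \<partial>?\<nu>)"
        unfolding law by (subst integral_distr) auto
      finally show ?thesis .
    qed
    show "expectation (X n) = 0" for n
      using X_int[of "\<lambda>x. x" n] int1 \<nu>.prob_space by (simp add: \<mu>_def)
    show "expectation (\<lambda>\<omega>. X n \<omega> ^ 4) \<le> (\<integral>Y. (log_gs \<epsilon> j Y - \<mu>) ^ 4 \<partial>?\<nu>)" for n
      using X_int[of "\<lambda>x. x ^ 4" n] by simp
  qed measurable
  then show ?thesis
  proof eventually_elim
    case (elim \<omega>)
    have "(\<lambda>n. (\<Sum>i<n. X i \<omega>) / real n + \<mu>) \<longlonglongrightarrow> 0 + \<mu>"
      using elim by (intro tendsto_add) auto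
    \<comment> \<open>At \<open>n = 0\<close> the left-hand side is \<open>\<mu>\<close> and the
      right-hand side 0, by \<open>x / 0 = 0\<close>; the equation holds from \<open>n = 1\<close>
      on.\<close>
    moreover have "\<forall>\<^sub>F n in sequentially. (\<Sum>i<n. X i \<omega>) / real n + \<mu> = ln (norm (gs (C n \<omega> ** P) j)) / real n"
      using eventually_gt_at_top[of 0]
      by eventually_elim (simp add: S_eq diff_divide_distrib)
    ultimately show ?case
      unfolding \<mu>_def[symmetric] using tendsto_cong by fastforce
  qed
qed

lemma lyapunov_exponent:
  "is_lyapunov_exponent M \<sigma> A j (\<integral>X. log_gs \<epsilon> j X \<partial>gaussian_matrix)"
proof -
  \<comment> \<open>Finitely many permutations and indices share one null set, so all the rates hold
    at the same \<open>\<omega>\<close>.\<close>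
  have "finite {\<pi> :: 'n \<Rightarrow> 'n. \<pi> permutes UNIV}"
    by (rule finite_permutations) simp
  then have "AE \<omega> in M. \<forall>\<pi>\<in>{\<pi>. \<pi> permutes UNIV}. \<forall>j\<in>UNIV.
      (\<lambda>n. ln (norm (gs (C n \<omega> ** permutation_matrix \<pi>) j)) / real n) \<longlonglongrightarrow> (\<integral>X. log_gs \<epsilon> j X \<partial>gaussian_matrix)"
    using growth_rate_gram_schmidt[OF orthogonal_permutation_matrix]
    by (intro AE_finite_allI) auto
  then show ?thesis
    unfolding is_lyapunov_exponent_def using AE_det_C
  proof eventually_elim
    case (elim \<omega>)
    then show ?case
      by (intro growth_rate_of_singular_values) auto
  qed
qed

end

text \<open>As \<open>ln 0 = 0\<close> and the integral of a non-integrable function is 0 by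
  convention, the first two claims are what make the integral the genuine expectation of the
  logarithm.\<close>

theorem theorem1:
  fixes M :: "'a measure" and \<sigma> :: "'a \<Rightarrow> 'a"
    and Q N :: "'a \<Rightarrow> real^'n::{finite,linorder}^'n::{finite,linorder}"
    and \<epsilon> :: real and j :: 'n
  assumes "invertible_ergodic_system M \<sigma>"
    and "Q \<in> borel_measurable M"
    and "\<And>\<omega>. \<omega> \<in> space M \<Longrightarrow> orthogonal_matrix (Q \<omega>)"
    and "N \<in> borel_measurable M"
    and "has_conditional_law M (conditioning_algebra M \<sigma> Q N) N gaussian_matrix"
  shows "(AE X in gaussian_matrix. gram_schmidt_column (mat 1 + \<epsilon> *\<^sub>R X) j \<noteq> 0) \<and>
    integrable gaussian_matrix (\<lambda>X. ln (norm (gram_schmidt_column (mat 1 + \<epsilon> *\<^sub>R X) j))) \<and>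
    is_lyapunov_exponent M \<sigma> (\<lambda>\<omega>. Q \<omega> + \<epsilon> *\<^sub>R N \<omega>) j
      (\<integral>X. ln (norm (gram_schmidt_column (mat 1 + \<epsilon> *\<^sub>R X) j)) \<partial>gaussian_matrix)"
proof (intro conjI)
  interpret gaussian_cocycle M \<sigma> Q N \<epsilon>
    using assms by (intro gaussian_cocycle.intro gaussian_cocycle_axioms.intro)
  show "AE X in gaussian_matrix. gram_schmidt_column (mat 1 + \<epsilon> *\<^sub>R X) j \<noteq> 0"
    using AE_gaussian_det_nonzero[where \<epsilon>=\<epsilon>]
    by eventually_elim (use gram_schmidt_nonzero_iff_det in blast)
  show "integrable gaussian_matrix (\<lambda>X. ln (norm (gram_schmidt_column (mat 1 + \<epsilon> *\<^sub>R X) j)))"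
    using integrable_power_of_integrable_power4[OF prob_space_gaussian_matrix _ integrable_ln_gram_schmidt_power4[of \<epsilon> j], of 1]
    by simp
  show "is_lyapunov_exponent M \<sigma> (\<lambda>\<omega>. Q \<omega> + \<epsilon> *\<^sub>R N \<omega>) j
      (\<integral>X. ln (norm (gram_schmidt_column (mat 1 + \<epsilon> *\<^sub>R X) j)) \<partial>gaussian_matrix)"
    using lyapunov_exponent[of j] unfolding log_gs_def .
qed

end
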